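(* If $a>0$, $0\le c<1$ and $H_{a,c}$ is a Bernstein function, then $$H_{a',c'}\text{ is a Bernstein function whenever } 0<a'\le a,\quad 0\le c'\le c .$$ If at least one of the inequalities $a'\le a$, $c'\le c$ is strict, then $m_{a',c'}(t)>0$ for every $t\ge 0$.
   Context: A function $g\in C^\infty(0,\infty)$ is completely monotone if $(-1)^n g^{(n)}\ge 0$ on $(0,\infty)$ for every integer $n\ge 0$. A nonnegative smooth function $f$ on $(0,\infty)$ is a Bernstein function if $f'$ is completely monotone. For $a>0$, $0\le c<1$, $y>0$: $H_{a,c}(y)=\left(1+\frac1y\right)^{ay-c}$. For $a>0$, $0\le c<1$, $a+c<3$, put $$w_{a,c}(s)=\frac1\pi\left(\frac{s}{1-s}\right)^{as+c}\sin\bigl(\pi(as+c)\bigr)\quad(0<s<1),$$ $$q_1=\frac a2+c,\qquad q_2=\frac a3+\frac c2+\frac12\left(\frac a2+c\right)^2,$$ $$D_{a,c}(t)=q_1+(q_1-q_2)t+e^{-a}\int_0^1 w_{a,c}(s)\bigl[e^{(1-s)t}-1-(1-s)t\bigr]\,ds,$$ and $m_{a,c}(t)=e^{-t}D_{a,c}(t)$. (If $H_{a,c}$ is Bernstein then necessarily $a+c<3$, so $m_{a',c'}$ is defined in the claim.) *)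

theory Defs
  imports "HOL-Analysis.Analysis"
begin

text \<open>
  Functions on the open half-line are total functions on the reals whose values outside
  the half-line are irrelevant: since the half-line is open, the iterated derivatives at its
  points depend only on the values there.
\<close>

definition smooth_on_pos :: "(real \<Rightarrow> real) \<Rightarrow> bool" where
  "smooth_on_pos g \<longleftrightarrow> (\<forall>n. ((deriv ^^ n) g) differentiable_on {0<..})"

definition completely_monotone :: "(real \<Rightarrow> real) \<Rightarrow> bool" where
  "completely_monotone g \<longleftrightarrow>
     smooth_on_pos g \<and> (\<forall>n. \<forall>x>0. (- 1) ^ n * (deriv ^^ n) g x \<ge> 0)"

definition bernstein_function :: "(real \<Rightarrow> real) \<Rightarrow> bool" where
  "bernstein_function f \<longleftrightarrow>
     smooth_on_pos f \<and> (\<forall>x>0. f x \<ge> 0) \<and> completely_monotone (deriv f)"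

definition H :: "real \<Rightarrow> real \<Rightarrow> real \<Rightarrow> real" where
  "H a c y = (1 + 1 / y) powr (a * y - c)"

definition w :: "real \<Rightarrow> real \<Rightarrow> real \<Rightarrow> real" where
  "w a c s = 1 / pi * (s / (1 - s)) powr (a * s + c) * sin (pi * (a * s + c))"

definition q1 :: "real \<Rightarrow> real \<Rightarrow> real" where
  "q1 a c = a / 2 + c"

definition q2 :: "real \<Rightarrow> real \<Rightarrow> real" where
  "q2 a c = a / 3 + c / 2 + 1 / 2 * (a / 2 + c)\<^sup>2"

text \<open>
  For \<open>0 < a\<close>, \<open>0 \<le> c < 1\<close> and \<open>a + c < 3\<close> the integral below converges absolutely:
  near \<open>s = 1\<close> the weight grows at most like \<open>(1 - s) powr (- (a + c))\<close>, while the bracket is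
  of order \<open>(1 - s)\<^sup>2\<close>. Outside this range the value of \<open>D\<close> carries no meaning, because the
  Lebesgue integral of a non-integrable function is \<open>0\<close> by convention.
\<close>

definition D :: "real \<Rightarrow> real \<Rightarrow> real \<Rightarrow> real" where
  "D a c t = q1 a c + (q1 a c - q2 a c) * t
     + exp (- a) * (LINT s:{0<..<1}|lborel. w a c s * (exp ((1 - s) * t) - 1 - (1 - s) * t))"

definition m :: "real \<Rightarrow> real \<Rightarrow> real \<Rightarrow> real" where
  "m a c t = exp (- t) * D a c t"

end

theory Submission
  imports Defs "HOL-Complex_Analysis.Complex_Analysis"
begin

text \<open>
Put \<open>X = 1 / (1 + y)\<close>. Then \<open>exp (- a) * H a c y\<close> is the value at \<open>X\<close> of
\<open>G = exp (- \<Psi>)\<close> with \<open>\<Psi>(X) = \<Sum>n\<ge>1. (a / (n * (n + 1)) + c / n) * X ^ n\<close>. Writing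
\<open>G = 1 - (\<Sum>n. d n * X ^ (n + 1))\<close> and \<open>D(t) = (\<Sum>n. d n * t ^ n / n!)\<close>, the function
\<open>1 - exp (- a) * H a c y\<close> is the Laplace transform of \<open>exp (- t) * D(t)\<close>. Differentiating under
the integral in one direction and inverting the transform in the other, \<open>H a c\<close> is a Bernstein
function exactly when \<open>D \<ge> 0\<close> on the half-line (\<open>bernstein_H_iff\<close>).

The equation \<open>X * G' = - X * \<Psi>' * G\<close> becomes a renewal equation \<open>t * D = v - v * D\<close>, where the
product of \<open>v\<close> and \<open>D\<close> is a convolution over \<open>[0, t]\<close> and \<open>v\<close> is an explicit combination of
exponentials (\<open>D_series_renewal\<close>). Along a segment of parameters on which \<open>a\<close> and \<open>c\<close> decrease with
speeds \<open>\<alpha>\<close> and \<open>\<gamma>\<close>, the derivative of \<open>D\<close> is \<open>U * D - U\<close>, where \<open>t * U(t)\<close> is the function \<open>v\<close>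
formed with \<open>\<alpha>, \<gamma>\<close> instead of \<open>a, c\<close> (\<open>D_series_dot_eq\<close>). The quotient \<open>U / v\<close> is strictly
decreasing. Hence, if \<open>D \<ge> 0\<close> up to time \<open>t\<close> and \<open>D(t) = 0\<close>, comparing \<open>U(t - r)\<close> with
\<open>(U(t) / v(t)) * v(t - r)\<close> under the convolution and using the renewal equation shows that the
derivative of \<open>D(t)\<close> along the segment is strictly positive. A nonnegative \<open>D\<close> can therefore never
become negative when the parameters decrease, and it is strictly positive as soon as they have moved
(\<open>positivity_propagates\<close>, \<open>D_series_pos_if_smaller_parameters\<close>).

It remains to identify the series \<open>D\<close> with the function defined through the weight. With
\<open>s = 1 / (1 - exp (- \<theta>))\<close> \<open>\<pi>\<close> times the weight is the imaginary part of
\<open>exp ((a * s + c) * \<theta>)\<close> on the line \<open>Im \<theta> = \<pi>\<close>, so the moments of the weight are residues at \<open>\<theta> = 0\<close>; the coordinate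
\<open>X = 1 - exp \<theta>\<close> turns these residues into the coefficients of \<open>G\<close> (\<open>residue_of_integrand\<close>,
\<open>w_moment_eq_dcoef\<close>). The moment of order \<open>n\<close> exists for \<open>a + c < n + 1\<close>, and order \<open>2\<close> is the
lowest one needed, whence the condition \<open>a + c < 3\<close>. That condition follows from the Bernstein property: every
pair with \<open>c < 1\<close> and \<open>a + c \<ge> 3\<close> lies above \<open>(2, 1 / 2)\<close> or above \<open>(5 / 2, 0)\<close>, and \<open>D\<close> takes a
negative value for both of these, which the monotonicity just described excludes.
\<close>

section \<open>Power series coefficients of the normalised function\<close>

definition kern :: "real \<Rightarrow> real \<Rightarrow> nat \<Rightarrow> real" where
  "kern a c k = a / (real k + 1) + c"

text \<open>
These are the coefficients of \<open>G = exp (- \<Psi>)\<close>, and \<open>kern a c k\<close> is the \<open>k\<close>-th coefficient of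
\<open>X * \<Psi>'(X)\<close>. The recursion is the coefficient form of \<open>X * G' = - X * \<Psi>' * G\<close>.
\<close>

fun gcoef :: "real \<Rightarrow> real \<Rightarrow> nat \<Rightarrow> real" where
  "gcoef a c 0 = 1"
| "gcoef a c (Suc n) = - (\<Sum>k\<le>n. kern a c (Suc k) * gcoef a c (n - k)) / (real n + 1)"

declare gcoef.simps(2) [simp del]

definition dcoef :: "real \<Rightarrow> real \<Rightarrow> nat \<Rightarrow> real" where
  "dcoef a c n = - gcoef a c (Suc n)"

lemma gcoef_rec:
  "(real n + 1) * gcoef a c (Suc n) = - (\<Sum>k\<le>n. kern a c (Suc k) * gcoef a c (n - k))"
  by (simp add: gcoef.simps(2) field_simps)

lemma sum_pochhammer_over_fact:
  "(\<Sum>k\<le>n. pochhammer B k / fact k) = pochhammer (B + 1) n / (fact n :: real)"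
proof (induction n)
  case (Suc n)
  have "pochhammer (B + 1) n / fact n + pochhammer B (Suc n) / fact (Suc n)
      = pochhammer (B + 1) n * (B + 1 + real n) / fact (Suc n)"
    using add_pos_nonneg[of 1 "real n"]
    by (simp add: pochhammer_rec[of B]) (simp add: divide_simps, simp add: algebra_simps)
  then show ?case
    using Suc by (simp add: pochhammer_Suc)
qed auto

text \<open>
The bound is the coefficient of \<open>(1 - X) powr (- B)\<close>, which solves the same recursion with equality
when \<open>kern\<close> is replaced by the constant \<open>- B\<close>.
\<close>

lemma abs_gcoef_le:
  assumes "\<And>k. \<bar>kern a c (Suc k)\<bar> \<le> B"
  shows "\<bar>gcoef a c n\<bar> \<le> pochhammer B n / fact n"
proof (induction n rule: less_induct)
  case (less n)
  show ?case
  proof (cases n)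
    case 0 then show ?thesis by simp
  next
    case (Suc j)
    have B: "B \<ge> 0" using assms[of 0] by linarith
    have "(real j + 1) * \<bar>gcoef a c (Suc j)\<bar> = \<bar>\<Sum>k\<le>j. kern a c (Suc k) * gcoef a c (j - k)\<bar>"
      by (metis abs_minus_cancel abs_mult abs_of_nonneg gcoef_rec of_nat_0_le_iff of_nat_Suc add.commute)
    also have "\<dots> \<le> (\<Sum>k\<le>j. \<bar>kern a c (Suc k) * gcoef a c (j - k)\<bar>)"
      by (rule sum_abs)
    also have "\<dots> \<le> (\<Sum>k\<le>j. B * (pochhammer B (j - k) / fact (j - k)))"
    proof (intro sum_mono)
      fix k assume "k \<in> {..j}"
      have "\<bar>gcoef a c (j - k)\<bar> \<le> pochhammer B (j - k) / fact (j - k)"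
        by (rule less.IH) (use Suc in auto)
      then show "\<bar>kern a c (Suc k) * gcoef a c (j - k)\<bar> \<le> B * (pochhammer B (j - k) / fact (j - k))"
        unfolding abs_mult by (intro mult_mono assms B) auto
    qed
    also have "\<dots> = B * (\<Sum>k\<le>j. pochhammer B k / fact k)"
      unfolding sum_distrib_left by (rule sum.nat_diff_reindex[of "\<lambda>k. B * (pochhammer B k / fact k)" "Suc j", unfolded lessThan_Suc_atMost diff_Suc_Suc])
    also have "\<dots> = pochhammer B (Suc j) / fact j"
      by (simp add: sum_pochhammer_over_fact pochhammer_rec)
    finally have "\<bar>gcoef a c (Suc j)\<bar> \<le> pochhammer B (Suc j) / fact j / (real j + 1)"
      by (simp add: pos_le_divide_eq mult_ac)
    then show ?thesis using Suc by (simp add: algebra_simps)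
  qed
qed

lemma summable_pochhammer_over_fact:
  fixes B r :: real
  assumes "\<bar>r\<bar> < 1"
  shows "summable (\<lambda>n. pochhammer B n / fact n * r ^ n)"
proof -
  have "summable (\<lambda>n. ((- B) gchoose n) * (- r) ^ n)"
    using gen_binomial_real[of "- r" "- B"] assms by (auto simp: sums_iff)
  moreover have "((- B) gchoose n) * (- r) ^ n = pochhammer B n / fact n * r ^ n" for n
  proof -
    have "((- B) gchoose n) * (- r) ^ n = ((- 1) ^ n * (- 1) ^ n) * (pochhammer B n / fact n * r ^ n)"
      by (simp only: gbinomial_pochhammer power_minus[of r] minus_minus times_divide_eq_left times_divide_eq_right mult_ac)
    also have "(- 1) ^ n * (- 1) ^ n = (1::real)"
      by (simp flip: power_mult_distrib)
    finally show ?thesis by simp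
  qed
  ultimately show ?thesis by simp
qed

lemma abs_kern_le:
  assumes "0 \<le> a" "0 \<le> c"
  shows "\<bar>kern a c (Suc k)\<bar> \<le> a / 2 + c"
  using assms by (auto simp: kern_def field_simps intro!: mult_left_mono)

text \<open>
The constant depends on the parameters only through \<open>B\<close>. This uniformity is what allows termwise
differentiation in the parameters, and the freedom in \<open>K > 1\<close> gives radius of convergence \<open>1\<close>.
\<close>

lemma gcoef_geometric_bound:
  fixes B :: real
  assumes "B \<ge> 0" "K > 1"
  obtains C where "C \<ge> 0" "\<And>a c n. (\<And>k. \<bar>kern a c (Suc k)\<bar> \<le> B) \<Longrightarrow> \<bar>gcoef a c n\<bar> \<le> C * K ^ n"
proof -
  define r where "r = 1 / K"
  have r: "\<bar>r\<bar> < 1" "r > 0" using assms by (auto simp: r_def)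
  define C where "C = (\<Sum>n. pochhammer B n / fact n * r ^ n)"
  have sm: "summable (\<lambda>n. pochhammer B n / fact n * r ^ n)"
    by (rule summable_pochhammer_over_fact) (use r in auto)
  have nn: "pochhammer B n / fact n * r ^ n \<ge> 0" for n
    using assms r by (simp add: pochhammer_nonneg pochhammer_prod prod_nonneg)
  have C0: "C \<ge> 0" unfolding C_def by (intro suminf_nonneg sm nn)
  have "\<bar>gcoef a c n\<bar> \<le> C * K ^ n" if "\<And>k. \<bar>kern a c (Suc k)\<bar> \<le> B" for a c n
  proof -
    have "pochhammer B n / fact n * r ^ n \<le> C"
      unfolding C_def using sum_le_suminf[OF sm, of "{n}"] nn by auto
    then have "pochhammer B n / fact n \<le> C * K ^ n"
      using assms by (simp add: r_def field_simps)
    then show ?thesis using abs_gcoef_le[OF that, of n] by linarith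
  qed
  with C0 that show ?thesis by blast
qed

section \<open>Exponential generating functions and convolution\<close>

definition egf :: "(nat \<Rightarrow> real) \<Rightarrow> real \<Rightarrow> real" where
  "egf x t = (\<Sum>n. x n * t ^ n / fact n)"

lemma summable_egf_norm:
  fixes x :: "nat \<Rightarrow> real"
  assumes "\<And>n. \<bar>x n\<bar> \<le> C * K ^ n"
  shows "summable (\<lambda>n. norm (x n * t ^ n / fact n))"
proof (rule summable_comparison_test')
  have "summable (\<lambda>n. C * (inverse (fact n) * (K * \<bar>t\<bar>) ^ n))"
    by (rule summable_mult[OF summable_exp])
  then show "summable (\<lambda>n. C * (K * \<bar>t\<bar>) ^ n / fact n)"
    by (simp only: divide_inverse mult_ac)
  show "norm (norm (x n * t ^ n / fact n)) \<le> C * (K * \<bar>t\<bar>) ^ n / fact n" for n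
  proof -
    have "norm (norm (x n * t ^ n / fact n)) = \<bar>x n\<bar> * \<bar>t\<bar> ^ n / fact n"
      by (simp add: abs_mult power_abs)
    also have "\<dots> \<le> (C * K ^ n) * \<bar>t\<bar> ^ n / fact n"
      by (intro divide_right_mono mult_right_mono assms) simp_all
    finally show ?thesis
      by (simp only: power_mult_distrib mult.assoc)
  qed
qed

lemma egf_sums:
  assumes "\<And>n. \<bar>x n\<bar> \<le> C * K ^ n"
  shows "(\<lambda>n. x n * t ^ n / fact n) sums egf x t"
  unfolding egf_def
  by (rule summable_sums[OF summable_norm_cancel[OF summable_egf_norm[OF assms]]])

lemma has_integral_power_convolution:
  fixes t :: real
  assumes "t \<ge> 0"
  shows "((\<lambda>r. (t - r) ^ i / fact i * (r ^ j / fact j)) has_integral t ^ Suc (i + j) / fact (Suc (i + j))) {0..t}"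
proof (induction i arbitrary: j)
  case 0
  have "((\<lambda>r. r ^ j / fact j) has_integral t ^ Suc j / fact (Suc j) - 0 ^ Suc j / fact (Suc j)) {0..t}"
  proof (rule fundamental_theorem_of_calculus[OF assms])
    fix x assume "x \<in> {0..t}"
    have "((\<lambda>r. r ^ Suc j / fact (Suc j)) has_real_derivative x ^ j / fact j) (at x within {0..t})"
      by (rule derivative_eq_intros refl | simp add: divide_simps)+
    then show "((\<lambda>r. r ^ Suc j / fact (Suc j)) has_vector_derivative x ^ j / fact j) (at x within {0..t})"
      by (simp add: has_real_derivative_iff_has_vector_derivative)
  qed
  then show ?case by simp
next
  case (Suc i)
  let ?F = "\<lambda>r. (t - r) ^ Suc i / fact (Suc i) * (r ^ Suc j / fact (Suc j))"
  have "((\<lambda>r. (t - r) ^ Suc i / fact (Suc i) * (r ^ j / fact j) - (t - r) ^ i / fact i * (r ^ Suc j / fact (Suc j)))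
      has_integral ?F t - ?F 0) {0..t}"
  proof (rule fundamental_theorem_of_calculus[OF assms])
    fix x assume "x \<in> {0..t}"
    have 1: "((\<lambda>r. (t - r) ^ Suc i / fact (Suc i)) has_real_derivative - ((t - x) ^ i / fact i)) (at x within {0..t})"
      by (rule derivative_eq_intros refl | simp add: divide_simps)+
    have 2: "((\<lambda>r. r ^ Suc j / fact (Suc j)) has_real_derivative x ^ j / fact j) (at x within {0..t})"
      by (rule derivative_eq_intros refl | simp add: divide_simps)+
    show "(?F has_vector_derivative ((t - x) ^ Suc i / fact (Suc i) * (x ^ j / fact j)
        - (t - x) ^ i / fact i * (x ^ Suc j / fact (Suc j)))) (at x within {0..t})"
      unfolding has_real_derivative_iff_has_vector_derivative[symmetric]
      by (rule DERIV_cong[OF DERIV_mult[OF 1 2]]) (simp add: mult_ac)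
  qed
  from has_integral_add[OF this Suc[of "Suc j"]] show ?case by simp
qed

text \<open>
Convolving \<open>t ^ i / i!\<close> with \<open>t ^ j / j!\<close> gives \<open>t ^ (i + j + 1) / (i + j + 1)!\<close>, so convolution
of exponential generating functions is the Cauchy product of their coefficients, shifted by one.
\<close>

lemma egf_convolution:
  fixes x y :: "nat \<Rightarrow> real"
  assumes x: "\<And>n. \<bar>x n\<bar> \<le> C * K ^ n" and y: "\<And>n. \<bar>y n\<bar> \<le> C' * K' ^ n" and t: "t \<ge> 0"
  shows "(\<lambda>n. (\<Sum>i\<le>n. x i * y (n - i)) * t ^ Suc n / fact (Suc n)) sums
           integral {0..t} (\<lambda>r. egf x (t - r) * egf y r)"
    and "(\<lambda>r. egf x (t - r) * egf y r) integrable_on {0..t}"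
proof -
  define f where "f = (\<lambda>n r. \<Sum>i\<le>n. (x i * (t - r) ^ i / fact i) * (y (n - i) * r ^ (n - i) / fact (n - i)))"
  define M where "M = (\<lambda>n. \<Sum>i\<le>n. norm (x i * t ^ i / fact i) * norm (y (n - i) * t ^ (n - i) / fact (n - i)))"
  have sM: "summable M"
    unfolding M_def
    by (rule summable_Cauchy_product; unfold real_norm_def abs_idempotent; fold real_norm_def; rule summable_egf_norm)
       (rule x y)+
  have le: "norm (f n r) \<le> M n" if "r \<in> {0..t}" for n r
  proof -
    have "norm (f n r) \<le> (\<Sum>i\<le>n. norm (x i * (t - r) ^ i / fact i) * norm (y (n - i) * r ^ (n - i) / fact (n - i)))"
      unfolding f_def by (rule order.trans[OF norm_sum]) (simp add: abs_mult)
    also have "\<dots> \<le> M n"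
      unfolding M_def
    proof (intro sum_mono mult_mono)
      fix i assume "i \<in> {..n}"
      have "(t - r) ^ i \<le> t ^ i" "r ^ (n - i) \<le> t ^ (n - i)"
        by (rule power_mono; use that in auto)+
      then show "norm (x i * (t - r) ^ i / fact i) \<le> norm (x i * t ^ i / fact i)"
        "norm (y (n - i) * r ^ (n - i) / fact (n - i)) \<le> norm (y (n - i) * t ^ (n - i) / fact (n - i))"
        using that by (auto simp: abs_mult intro!: divide_right_mono mult_left_mono)
    qed auto
    finally show ?thesis .
  qed
  have ul: "uniform_limit {0..t} (\<lambda>n r. \<Sum>i<n. f i r) (\<lambda>r. \<Sum>i. f i r) sequentially"
    by (rule Weierstrass_m_test[OF le sM])
  have fs: "(\<Sum>i. f i r) = egf x (t - r) * egf y r" for r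
    unfolding f_def egf_def
    by (intro Cauchy_product[symmetric] summable_egf_norm[OF x] summable_egf_norm[OF y])
  have hi: "(f n has_integral (\<Sum>i\<le>n. x i * y (n - i)) * t ^ Suc n / fact (Suc n)) {0..t}" for n
  proof -
    have "((\<lambda>r. \<Sum>i\<le>n. (x i * y (n - i)) * ((t - r) ^ i / fact i * (r ^ (n - i) / fact (n - i))))
        has_integral (\<Sum>i\<le>n. (x i * y (n - i)) * (t ^ Suc (i + (n - i)) / fact (Suc (i + (n - i)))))) {0..t}"
      by (intro has_integral_sum has_integral_mult_right has_integral_power_convolution t) auto
    also have "(\<Sum>i\<le>n. (x i * y (n - i)) * (t ^ Suc (i + (n - i)) / fact (Suc (i + (n - i)))))
        = (\<Sum>i\<le>n. (x i * y (n - i)) * (t ^ Suc n / fact (Suc n)))"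
      by (intro sum.cong) auto
    also have "\<dots> = (\<Sum>i\<le>n. x i * y (n - i)) * t ^ Suc n / fact (Suc n)"
      by (simp add: sum_distrib_right sum_divide_distrib)
    finally show ?thesis
      by (simp add: f_def mult_ac)
  qed
  have ct: "continuous_on (cbox 0 t) (\<lambda>r. \<Sum>i<n. f i r)" for n
    unfolding f_def by (intro continuous_intros) auto
  have ul': "uniform_limit (cbox 0 t) (\<lambda>n r. \<Sum>i<n. f i r) (\<lambda>r. egf x (t - r) * egf y r) sequentially"
    using ul unfolding fs box_real .
  obtain I J where IJ: "\<And>n. ((\<lambda>r. \<Sum>i<n. f i r) has_integral I n) (cbox 0 t)"
    "((\<lambda>r. egf x (t - r) * egf y r) has_integral J) (cbox 0 t)" "I \<longlonglongrightarrow> J"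
    using uniform_limit_integral_cbox[OF ul' ct trivial_limit_sequentially] by blast
  have "I n = (\<Sum>j<n. (\<Sum>i\<le>j. x i * y (j - i)) * t ^ Suc j / fact (Suc j))" for n
  proof (rule has_integral_unique[OF IJ(1)])
    show "((\<lambda>r. \<Sum>i<n. f i r) has_integral (\<Sum>j<n. (\<Sum>i\<le>j. x i * y (j - i)) * t ^ Suc j / fact (Suc j))) (cbox 0 t)"
      unfolding box_real by (intro has_integral_sum hi finite_lessThan)
  qed
  then have "I = (\<lambda>n. \<Sum>j<n. (\<Sum>i\<le>j. x i * y (j - i)) * t ^ Suc j / fact (Suc j))"
    by (rule ext)
  from IJ(3)[unfolded this]
  have "(\<lambda>n. \<Sum>j<n. (\<Sum>i\<le>j. x i * y (j - i)) * t ^ Suc j / fact (Suc j)) \<longlonglongrightarrow> J" .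
  then show "(\<lambda>n. (\<Sum>i\<le>n. x i * y (n - i)) * t ^ Suc n / fact (Suc n)) sums
           integral {0..t} (\<lambda>r. egf x (t - r) * egf y r)"
    unfolding sums_def integral_unique[OF IJ(2)[unfolded box_real]] .
  show "(\<lambda>r. egf x (t - r) * egf y r) integrable_on {0..t}"
    by (rule has_integral_integrable[OF IJ(2)[unfolded box_real]])
qed

section \<open>Dependence of the coefficients on the parameters\<close>

text \<open>
Coefficient of \<open>X ^ (k + 1)\<close> in \<open>\<Psi>\<close> formed with the speeds \<open>\<alpha>, \<gamma>\<close> in place of \<open>a, c\<close>; the
index is shifted because \<open>\<Psi>\<close> has no constant term.
\<close>

definition eta :: "real \<Rightarrow> real \<Rightarrow> nat \<Rightarrow> real" where
  "eta \<alpha> \<gamma> k = kern \<alpha> \<gamma> (Suc k) / (real k + 1)"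

text \<open>
Moving the parameters by \<open>(- \<alpha>, - \<gamma>)\<close> multiplies \<open>G = exp (- \<Psi>)\<close> by the exponential of a
multiple of the series with coefficients \<open>eta \<alpha> \<gamma>\<close>; its derivative is therefore the Cauchy product
of that series with \<open>G\<close>.
\<close>

fun gcoef_dot :: "real \<Rightarrow> real \<Rightarrow> real \<Rightarrow> real \<Rightarrow> nat \<Rightarrow> real" where
  "gcoef_dot \<alpha> \<gamma> a c 0 = 0"
| "gcoef_dot \<alpha> \<gamma> a c (Suc n) = (\<Sum>k\<le>n. eta \<alpha> \<gamma> k * gcoef a c (n - k))"

text \<open>
With \<open>E\<close> the series of the \<open>eta\<close> and \<open>G' = - B * G\<close>, the product rule gives
\<open>(E * G)' = E' * G - B * (E * G)\<close>; the coefficients of this identity are the recursion obtained by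
differentiating the recursion for \<open>gcoef\<close> in the parameter.
\<close>

lemma gcoef_dot_rec:
  "(real n + 1) * gcoef_dot \<alpha> \<gamma> a c (Suc n) =
     (\<Sum>k\<le>n. kern \<alpha> \<gamma> (Suc k) * gcoef a c (n - k) - kern a c (Suc k) * gcoef_dot \<alpha> \<gamma> a c (n - k))"
proof -
  define G where "G = Abs_fps (gcoef a c)"
  define B where "B = Abs_fps (\<lambda>k. kern a c (Suc k))"
  define E where "E = fps_X * Abs_fps (eta \<alpha> \<gamma>)"
  have G': "fps_deriv G = - (B * G)"
  proof (rule fps_ext)
    fix n show "fps_nth (fps_deriv G) n = fps_nth (- (B * G)) n"
      using gcoef_rec[of n a c] by (simp add: G_def B_def fps_mult_nth atLeast0AtMost add.commute)
  qed
  have EG: "fps_nth (E * G) n = gcoef_dot \<alpha> \<gamma> a c n" for n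
    by (cases n) (simp_all add: E_def G_def mult.assoc fps_mult_nth[of "Abs_fps (eta \<alpha> \<gamma>)"] atLeast0AtMost)
  have E': "fps_deriv E = Abs_fps (\<lambda>k. kern \<alpha> \<gamma> (Suc k))"
    by (rule fps_ext) (simp add: E_def eta_def divide_simps, simp add: algebra_simps)
  have "fps_deriv (E * G) = Abs_fps (\<lambda>k. kern \<alpha> \<gamma> (Suc k)) * G - B * (E * G)"
    by (simp add: G' E' algebra_simps)
  then have "fps_nth (fps_deriv (E * G)) n = fps_nth (Abs_fps (\<lambda>k. kern \<alpha> \<gamma> (Suc k)) * G - B * (E * G)) n"
    by (rule arg_cong)
  then have "(real n + 1) * gcoef_dot \<alpha> \<gamma> a c (Suc n)
      = fps_nth (Abs_fps (\<lambda>k. kern \<alpha> \<gamma> (Suc k)) * G) n - fps_nth (B * (E * G)) n"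
    by (simp only: fps_deriv_nth EG fps_sub_nth of_nat_add of_nat_1 Suc_eq_plus1)
  then show ?thesis
    unfolding fps_mult_nth[of "Abs_fps _" G] fps_mult_nth[of B] EG sum_subtractf
    by (simp only: G_def B_def atLeast0AtMost fps_nth_Abs_fps)
qed

lemma kern_diff: "kern (a - s * \<alpha>) (c - s * \<gamma>) k = kern a c k - s * kern \<alpha> \<gamma> k"
  by (simp add: kern_def diff_divide_distrib algebra_simps)

lemma gcoef_dot_Suc_eq:
  "- (\<Sum>k\<le>n. kern a c (Suc k) * gcoef_dot \<alpha> \<gamma> a c (n - k) + (- kern \<alpha> \<gamma> (Suc k)) * gcoef a c (n - k)) / (real n + 1)
     = gcoef_dot \<alpha> \<gamma> a c (Suc n)"
proof -
  have "(\<Sum>k\<le>n. kern a c (Suc k) * gcoef_dot \<alpha> \<gamma> a c (n - k) + (- kern \<alpha> \<gamma> (Suc k)) * gcoef a c (n - k))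
      = - ((real n + 1) * gcoef_dot \<alpha> \<gamma> a c (Suc n))"
    unfolding gcoef_dot_rec by (simp add: sum_subtractf sum.distrib sum_negf)
  then show ?thesis
    by (simp del: gcoef_dot.simps)
qed

lemma gcoef_has_derivative:
  "((\<lambda>s. gcoef (a - s * \<alpha>) (c - s * \<gamma>) n) has_real_derivative gcoef_dot \<alpha> \<gamma> (a - s * \<alpha>) (c - s * \<gamma>) n) (at s)"
proof (induction n rule: less_induct)
  case (less n)
  show ?case
  proof (cases n)
    case 0 then show ?thesis by simp
  next
    case (Suc j)
    have der: "((\<lambda>s. kern (a - s * \<alpha>) (c - s * \<gamma>) (Suc k) * gcoef (a - s * \<alpha>) (c - s * \<gamma>) (j - k)) has_real_derivative
         kern (a - s * \<alpha>) (c - s * \<gamma>) (Suc k) * gcoef_dot \<alpha> \<gamma> (a - s * \<alpha>) (c - s * \<gamma>) (j - k)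
           + (- kern \<alpha> \<gamma> (Suc k)) * gcoef (a - s * \<alpha>) (c - s * \<gamma>) (j - k)) (at s)" for k
    proof -
      have 1: "((\<lambda>s. kern (a - s * \<alpha>) (c - s * \<gamma>) (Suc k)) has_real_derivative (- kern \<alpha> \<gamma> (Suc k))) (at s)"
        unfolding kern_diff
        by (rule DERIV_cong[OF DERIV_diff[OF DERIV_const DERIV_cmult_right[OF DERIV_ident]]]) simp
      have "j - k < n" unfolding Suc by (rule diff_less_Suc)
      then have "((\<lambda>s. gcoef (a - s * \<alpha>) (c - s * \<gamma>) (j - k)) has_real_derivative gcoef_dot \<alpha> \<gamma> (a - s * \<alpha>) (c - s * \<gamma>) (j - k)) (at s)"
        by (rule less.IH)
      from DERIV_mult'[OF 1 this] show ?thesis .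
    qed
    show ?thesis
      unfolding Suc gcoef.simps(2)
      by (rule DERIV_cong[OF DERIV_cdivide[OF DERIV_minus[OF DERIV_sum[OF der]]] gcoef_dot_Suc_eq])
  qed
qed

section \<open>A first-crossing principle\<close>

text \<open>
Let \<open>\<sigma>\<close> be the infimum of the parameters at which \<open>F\<close> is somewhere negative. By continuity \<open>F\<close> is
still nonnegative at \<open>\<sigma>\<close>, and negative values at parameters decreasing to \<open>\<sigma>\<close> accumulate, by
compactness of \<open>[0, T]\<close>, at a zero of \<open>F\<close>. The mean value theorem gives a nonpositive parameter
derivative there, against the assumption on zeros. For the strict statement, a zero at a positive
parameter would force negative values at slightly smaller parameters.
\<close>

lemma positivity_propagates:
  fixes F F' :: "real \<Rightarrow> real \<Rightarrow> real"
  assumes T: "0 \<le> T"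
    and der: "\<And>s t. s \<in> {0..1} \<Longrightarrow> t \<in> {0..T} \<Longrightarrow> ((\<lambda>s. F s t) has_real_derivative F' s t) (at s)"
    and contF: "continuous_on ({0..1} \<times> {0..T}) (\<lambda>(s, t). F s t)"
    and contF': "continuous_on ({0..1} \<times> {0..T}) (\<lambda>(s, t). F' s t)"
    and start: "\<And>t. t \<in> {0..T} \<Longrightarrow> F 0 t \<ge> 0"
    and push: "\<And>s t. s \<in> {0..1} \<Longrightarrow> t \<in> {0..T} \<Longrightarrow> (\<And>r. r \<in> {0..T} \<Longrightarrow> F s r \<ge> 0) \<Longrightarrow>
                 F s t = 0 \<Longrightarrow> F' s t > 0"
  shows "\<And>s t. s \<in> {0..1} \<Longrightarrow> t \<in> {0..T} \<Longrightarrow> F s t \<ge> 0"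
    and "\<And>s t. s \<in> {0<..1} \<Longrightarrow> t \<in> {0..T} \<Longrightarrow> F s t > 0"
proof -
  define A where "A = {s \<in> {0..1}. \<exists>t\<in>{0..T}. F s t < 0}"
  have "A = {}"
  proof (rule ccontr)
    assume ne: "A \<noteq> {}"
    define \<sigma> where "\<sigma> = Inf A"
    have bdd: "bdd_below A" by (rule bdd_belowI[of _ 0]) (auto simp: A_def)
    obtain a where a: "a \<in> A" using ne by auto
    have \<sigma>01: "\<sigma> \<in> {0..1}"
    proof -
      have "0 \<le> \<sigma>" unfolding \<sigma>_def by (rule cInf_greatest[OF ne]) (auto simp: A_def)
      moreover have "\<sigma> \<le> a" unfolding \<sigma>_def by (rule cInf_lower[OF a bdd])
      ultimately show ?thesis using a by (auto simp: A_def)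
    qed
    have before: "F s t \<ge> 0" if "s \<in> {0..<\<sigma>}" "t \<in> {0..T}" for s t
    proof (rule ccontr)
      assume "\<not> F s t \<ge> 0"
      then have "s \<in> A" using that \<sigma>01 by (force simp: A_def not_le)
      then have "\<sigma> \<le> s" unfolding \<sigma>_def by (rule cInf_lower[OF _ bdd])
      with that show False by simp
    qed
    have at_\<sigma>: "F \<sigma> t \<ge> 0" if t: "t \<in> {0..T}" for t
    proof (cases "\<sigma> = 0")
      case True then show ?thesis using start t by simp
    next
      case False
      then have pos: "\<sigma> > 0" using \<sigma>01 by auto
      have "isCont (\<lambda>s. F s t) \<sigma>" using der[OF \<sigma>01 t] by (rule DERIV_isCont)
      then have "((\<lambda>s. F s t) \<longlongrightarrow> F \<sigma> t) (at_left \<sigma>)"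
        by (simp add: isCont_def filterlim_at_split)
      moreover have "eventually (\<lambda>s. F s t \<ge> 0) (at_left \<sigma>)"
        using eventually_at_left_real[OF pos] by eventually_elim (use before t in auto)
      ultimately show ?thesis
        by (intro tendsto_lowerbound) auto
    qed
    have "\<exists>s t. s \<in> {0..1} \<and> t \<in> {0..T} \<and> \<sigma> < s \<and> s < \<sigma> + 1 / real (Suc n) \<and> F s t < 0" for n
    proof -
      have "Inf A < \<sigma> + 1 / real (Suc n)" by (simp add: \<sigma>_def)
      then obtain s where s: "s \<in> A" "s < \<sigma> + 1 / real (Suc n)"
        using cInf_lessD[OF ne] by blast
      then obtain t where t: "t \<in> {0..T}" "F s t < 0" "s \<in> {0..1}" by (auto simp: A_def)
      have "\<sigma> \<le> s" unfolding \<sigma>_def by (rule cInf_lower[OF s(1) bdd])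
      moreover have "\<sigma> \<noteq> s" using at_\<sigma>[OF t(1)] t(2) by auto
      ultimately show ?thesis using s t by force
    qed
    then obtain S R where SR: "\<And>n. S n \<in> {0..1}" "\<And>n. R n \<in> {0..T}" "\<And>n. \<sigma> < S n"
        "\<And>n. S n < \<sigma> + 1 / real (Suc n)" "\<And>n. F (S n) (R n) < 0"
      by metis
    have Slim: "S \<longlonglongrightarrow> \<sigma>"
    proof (rule tendsto_sandwich[of "\<lambda>_. \<sigma>" S _ "\<lambda>n. \<sigma> + 1 / real (Suc n)"])
      show "(\<lambda>n. \<sigma> + 1 / real (Suc n)) \<longlonglongrightarrow> \<sigma>"
        using tendsto_add[OF tendsto_const LIMSEQ_inverse_real_of_nat, of \<sigma>] by (simp add: divide_inverse)
    qed (intro always_eventually allI less_imp_le SR tendsto_const)+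
    obtain \<tau> \<rho> where \<tau>: "\<tau> \<in> {0..T}" "strict_mono \<rho>" "(R \<circ> \<rho>) \<longlonglongrightarrow> \<tau>"
      using compact_Icc[of 0 T, unfolded compact_def] SR(2) by metis
    have S\<rho>: "(\<lambda>n. S (\<rho> n)) \<longlonglongrightarrow> \<sigma>"
      using LIMSEQ_subseq_LIMSEQ[OF Slim \<tau>(2)] by (simp add: o_def)
    have R\<rho>: "(\<lambda>n. R (\<rho> n)) \<longlonglongrightarrow> \<tau>" using \<tau>(3) by (simp add: o_def)
    obtain X where X: "\<And>n. \<sigma> < X n" "\<And>n. X n < S (\<rho> n)"
      "\<And>n. F (S (\<rho> n)) (R (\<rho> n)) - F \<sigma> (R (\<rho> n)) = (S (\<rho> n) - \<sigma>) * F' (X n) (R (\<rho> n))"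
    proof -
      have "\<exists>x. \<sigma> < x \<and> x < S (\<rho> n) \<and> F (S (\<rho> n)) (R (\<rho> n)) - F \<sigma> (R (\<rho> n)) = (S (\<rho> n) - \<sigma>) * F' x (R (\<rho> n))" for n
      proof -
        have "\<exists>x>\<sigma>. x < S (\<rho> n) \<and> F (S (\<rho> n)) (R (\<rho> n)) - F \<sigma> (R (\<rho> n)) = (S (\<rho> n) - \<sigma>) * F' x (R (\<rho> n))"
        proof (rule MVT2[OF SR(3)])
          fix x assume "\<sigma> \<le> x" "x \<le> S (\<rho> n)"
          then have "x \<in> {0..1}" using \<sigma>01 SR(1)[of "\<rho> n"] by auto
          then show "((\<lambda>s. F s (R (\<rho> n))) has_real_derivative F' x (R (\<rho> n))) (at x)"
            by (rule der) (rule SR(2))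
        qed
        then show ?thesis by blast
      qed
      then show ?thesis using that by metis
    qed
    have Xlim: "X \<longlonglongrightarrow> \<sigma>"
      by (rule tendsto_sandwich[OF _ _ tendsto_const S\<rho>]) (intro always_eventually allI less_imp_le X)+
    have X01: "X n \<in> {0..1}" for n
      using X(1,2)[of n] \<sigma>01 SR(1)[of "\<rho> n"] by auto
    have neg: "F' (X n) (R (\<rho> n)) \<le> 0" for n
    proof (rule ccontr)
      assume "\<not> F' (X n) (R (\<rho> n)) \<le> 0"
      then have "(S (\<rho> n) - \<sigma>) * F' (X n) (R (\<rho> n)) > 0" using SR(3)[of "\<rho> n"] by simp
      then show False using X(3)[of n] at_\<sigma>[OF SR(2)[of "\<rho> n"]] SR(5)[of "\<rho> n"] by linarith
    qed
    have "(\<lambda>n. F (S (\<rho> n)) (R (\<rho> n))) \<longlonglongrightarrow> F \<sigma> \<tau>"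
      using continuous_on_tendsto_compose[OF contF tendsto_Pair[OF S\<rho> R\<rho>]] \<sigma>01 \<tau> SR by auto
    then have "F \<sigma> \<tau> \<le> 0"
      by (rule tendsto_upperbound) (intro always_eventually allI less_imp_le SR(5) trivial_limit_sequentially)+
    then have "F \<sigma> \<tau> = 0" using at_\<sigma> \<tau> by (simp add: antisym)
    then have "F' \<sigma> \<tau> > 0" using push[OF \<sigma>01 \<tau>(1)] at_\<sigma> by blast
    moreover have "(\<lambda>n. F' (X n) (R (\<rho> n))) \<longlonglongrightarrow> F' \<sigma> \<tau>"
      using continuous_on_tendsto_compose[OF contF' tendsto_Pair[OF Xlim R\<rho>]] \<sigma>01 \<tau> SR X01 by auto
    then have "F' \<sigma> \<tau> \<le> 0"
      by (rule tendsto_upperbound) (intro always_eventually allI neg trivial_limit_sequentially)+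
    ultimately show False by simp
  qed
  then show nonneg: "F s t \<ge> 0" if "s \<in> {0..1}" "t \<in> {0..T}" for s t
    using that by (force simp: A_def not_less)
  show "F s t > 0" if s: "s \<in> {0<..1}" and t: "t \<in> {0..T}" for s t
  proof (rule ccontr)
    assume "\<not> F s t > 0"
    then have "F s t = 0" using nonneg[of s t] that by auto
    then have "F' s t > 0" using push[of s t] nonneg that by auto
    from DERIV_pos_inc_left[OF der this] s t obtain d where d: "d > 0"
      "\<And>h. h > 0 \<Longrightarrow> h < d \<Longrightarrow> F (s - h) t < F s t" by auto
    define h where "h = min (d / 2) s"
    have "F (s - h) t < 0" using d s \<open>F s t = 0\<close> by (simp add: h_def)
    moreover have "F (s - h) t \<ge> 0" using s t d by (intro nonneg) (auto simp: h_def)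
    ultimately show False by simp
  qed
qed

section \<open>The renewal equation and the parameter derivative\<close>

text \<open>
The coefficients of \<open>X * \<Psi>'(X)\<close>; their exponential generating function is the kernel \<open>v\<close> of
the renewal equation.
\<close>

definition vcoef :: "real \<Rightarrow> real \<Rightarrow> nat \<Rightarrow> real" where
  "vcoef a c n = (if n = 0 then 0 else kern a c n)"

definition D_series :: "real \<Rightarrow> real \<Rightarrow> real \<Rightarrow> real" where
  "D_series a c = egf (dcoef a c)"

lemma continuous_egf:
  assumes "\<And>n. \<bar>x n\<bar> \<le> C * K ^ n"
  shows "continuous_on A (egf x)"
proof -
  have "isCont (\<lambda>t. \<Sum>n. x n / fact n * t ^ n) t" for t
  proof (rule isCont_powser_converges_everywhere)
    fix y :: real
    from egf_sums[OF assms, of y] show "summable (\<lambda>n. x n / fact n * y ^ n)"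
      by (auto simp: sums_iff)
  qed
  then have "isCont (egf x) t" for t
    by (simp add: egf_def[abs_def])
  then show ?thesis
    by (simp add: continuous_at_imp_continuous_on)
qed

lemma egf_0: "egf x 0 = x 0"
  using powser_zero[of "\<lambda>n. x n / fact n"] by (simp add: egf_def)

lemma vcoef_dcoef_convolution:
  "(\<Sum>i\<le>n. vcoef a c i * dcoef a c (n - i)) = kern a c (Suc n) - (real n + 1) * dcoef a c n"
proof (cases n)
  case 0
  then show ?thesis using gcoef_rec[of 0 a c] by (simp add: vcoef_def dcoef_def)
next
  case (Suc k)
  have "(real (Suc k) + 1) * gcoef a c (Suc (Suc k)) =
      - (\<Sum>i\<le>k. kern a c (Suc i) * gcoef a c (Suc k - i)) - kern a c (Suc (Suc k))"
    unfolding gcoef_rec sum.atMost_Suc by simp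
  also have "(\<Sum>i\<le>k. kern a c (Suc i) * gcoef a c (Suc k - i)) = - (\<Sum>i\<le>k. vcoef a c (Suc i) * dcoef a c (Suc k - Suc i))"
    unfolding sum_negf[symmetric] by (intro sum.cong) (simp_all add: vcoef_def dcoef_def Suc_diff_le)
  finally show ?thesis
    unfolding Suc sum.atMost_Suc_shift by (simp add: vcoef_def dcoef_def)
qed

lemma eta_dcoef_convolution:
  "(\<Sum>i\<le>n. eta \<alpha> \<gamma> i * dcoef a c (n - i)) = eta \<alpha> \<gamma> (Suc n) - gcoef_dot \<alpha> \<gamma> a c (Suc (Suc n))"
proof -
  have "gcoef_dot \<alpha> \<gamma> a c (Suc (Suc n)) = (\<Sum>i\<le>n. eta \<alpha> \<gamma> i * gcoef a c (Suc n - i)) + eta \<alpha> \<gamma> (Suc n)"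
    unfolding gcoef_dot.simps sum.atMost_Suc by simp
  also have "(\<Sum>i\<le>n. eta \<alpha> \<gamma> i * gcoef a c (Suc n - i)) = - (\<Sum>i\<le>n. eta \<alpha> \<gamma> i * dcoef a c (n - i))"
    unfolding sum_negf[symmetric] by (intro sum.cong) (simp_all add: dcoef_def Suc_diff_le)
  finally show ?thesis by simp
qed

lemma dcoef_geometric_bound:
  assumes "B \<ge> 0"
  shows "\<exists>C\<ge>0. \<forall>a c. (\<forall>k. \<bar>kern a c (Suc k)\<bar> \<le> B) \<longrightarrow>
           (\<forall>n. \<bar>gcoef a c n\<bar> \<le> C * 2 ^ n \<and> \<bar>dcoef a c n\<bar> \<le> (2 * C) * 2 ^ n)"
proof -
  have "(2::real) > 1" by simp
  from gcoef_geometric_bound[OF assms this] obtain C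
    where C: "C \<ge> 0" "\<And>a c n. (\<And>k. \<bar>kern a c (Suc k)\<bar> \<le> B) \<Longrightarrow> \<bar>gcoef a c n\<bar> \<le> C * 2 ^ n"
    by blast
  have "\<bar>dcoef a c n\<bar> \<le> (2 * C) * 2 ^ n" if "\<And>k. \<bar>kern a c (Suc k)\<bar> \<le> B" for a c n
    using C(2)[OF that, of "Suc n"] by (simp add: dcoef_def)
  with C show ?thesis by blast
qed

lemma abs_kern_le_abs: "\<bar>kern a c k\<bar> \<le> \<bar>a\<bar> + \<bar>c\<bar>"
proof -
  have "\<bar>a / (real k + 1)\<bar> \<le> \<bar>a\<bar> / 1"
    unfolding abs_divide by (intro divide_left_mono) auto
  then show ?thesis unfolding kern_def using abs_triangle_ineq[of "a / (real k + 1)" c] by simp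
qed

lemma abs_eta_le: "\<bar>eta \<alpha> \<gamma> k\<bar> \<le> (\<bar>\<alpha>\<bar> + \<bar>\<gamma>\<bar>) * 1 ^ k"
proof -
  have "\<bar>kern \<alpha> \<gamma> (Suc k)\<bar> / \<bar>real k + 1\<bar> \<le> (\<bar>\<alpha>\<bar> + \<bar>\<gamma>\<bar>) / 1"
    by (intro frac_le abs_kern_le_abs) auto
  then show ?thesis by (simp add: eta_def)
qed

lemma abs_vcoef_le: "\<bar>vcoef a c k\<bar> \<le> (\<bar>a\<bar> + \<bar>c\<bar>) * 1 ^ k"
  using abs_kern_le_abs[of a c k] by (simp add: vcoef_def)

lemma dcoef_bounded:
  obtains C where "\<And>n. \<bar>dcoef a c n\<bar> \<le> C * 2 ^ n"
proof -
  have "\<bar>a\<bar> + \<bar>c\<bar> \<ge> 0" by simp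
  from dcoef_geometric_bound[OF this] abs_kern_le_abs[of a c]
  obtain C where "\<forall>n. \<bar>dcoef a c n\<bar> \<le> (2 * C) * 2 ^ n" by blast
  with that show ?thesis by blast
qed

text \<open>
The coefficient form of \<open>X * G' = - X * \<Psi>' * G\<close>, read as an identity of exponential generating
functions.
\<close>

lemma D_series_renewal:
  assumes "t \<ge> 0"
  shows "integral {0..t} (\<lambda>r. egf (vcoef a c) (t - r) * D_series a c r) = egf (vcoef a c) t - t * D_series a c t"
proof -
  obtain C where C: "\<And>n. \<bar>dcoef a c n\<bar> \<le> C * 2 ^ n" using dcoef_bounded[of a c] by blast
  have "(\<lambda>n. vcoef a c n * t ^ n / fact n) sums egf (vcoef a c) t"
    by (rule egf_sums[OF abs_vcoef_le])
  then have 1: "(\<lambda>n. vcoef a c (Suc n) * t ^ Suc n / fact (Suc n)) sums egf (vcoef a c) t"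
    using sums_Suc_iff[of "\<lambda>n. vcoef a c n * t ^ n / fact n" "egf (vcoef a c) t"] by (simp add: vcoef_def[of _ _ 0])
  have 2: "(\<lambda>n. t * (dcoef a c n * t ^ n / fact n)) sums (t * D_series a c t)"
    unfolding D_series_def by (rule sums_mult[OF egf_sums[OF C]])
  have eq: "vcoef a c (Suc n) * t ^ Suc n / fact (Suc n) - t * (dcoef a c n * t ^ n / fact n)
      = (\<Sum>i\<le>n. vcoef a c i * dcoef a c (n - i)) * t ^ Suc n / fact (Suc n)" for n
    unfolding vcoef_dcoef_convolution by (simp add: vcoef_def divide_simps) (simp add: algebra_simps)
  from sums_diff[OF 1 2]
  have "(\<lambda>n. (\<Sum>i\<le>n. vcoef a c i * dcoef a c (n - i)) * t ^ Suc n / fact (Suc n)) sums (egf (vcoef a c) t - t * D_series a c t)"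
    unfolding eq .
  with egf_convolution(1)[OF abs_vcoef_le C assms, of a c] show ?thesis
    unfolding D_series_def by (rule sums_unique2)
qed

text \<open>
The derivative of \<open>D_series\<close> along the segment \<open>s \<mapsto> (a - s * \<alpha>, c - s * \<gamma>)\<close>, at \<open>s = 0\<close>.
\<close>

definition D_series_dot :: "real \<Rightarrow> real \<Rightarrow> real \<Rightarrow> real \<Rightarrow> real \<Rightarrow> real" where
  "D_series_dot \<alpha> \<gamma> a c = egf (\<lambda>n. - gcoef_dot \<alpha> \<gamma> a c (Suc n))"

lemma D_series_dot_eq:
  assumes "t \<ge> 0"
  shows "D_series_dot \<alpha> \<gamma> a c t = integral {0..t} (\<lambda>r. egf (eta \<alpha> \<gamma>) (t - r) * D_series a c r) - egf (eta \<alpha> \<gamma>) t"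
proof -
  obtain C where C: "\<And>n. \<bar>dcoef a c n\<bar> \<le> C * 2 ^ n" using dcoef_bounded[of a c] by blast
  have "(\<lambda>n. (eta \<alpha> \<gamma> (Suc n) - gcoef_dot \<alpha> \<gamma> a c (Suc (Suc n))) * t ^ Suc n / fact (Suc n)) sums
      integral {0..t} (\<lambda>r. egf (eta \<alpha> \<gamma>) (t - r) * D_series a c r)"
    using egf_convolution(1)[OF abs_eta_le C assms, of \<alpha> \<gamma>]
    unfolding D_series_def eta_dcoef_convolution .
  then have "(\<lambda>n. (eta \<alpha> \<gamma> n - gcoef_dot \<alpha> \<gamma> a c (Suc n)) * t ^ n / fact n) sums
      integral {0..t} (\<lambda>r. egf (eta \<alpha> \<gamma>) (t - r) * D_series a c r)"
    by (subst (asm) sums_Suc_iff) simp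
  from sums_diff[OF this egf_sums[OF abs_eta_le, of \<alpha> \<gamma> t]]
  have "(\<lambda>n. - gcoef_dot \<alpha> \<gamma> a c (Suc n) * t ^ n / fact n) sums
     (integral {0..t} (\<lambda>r. egf (eta \<alpha> \<gamma>) (t - r) * D_series a c r) - egf (eta \<alpha> \<gamma>) t)"
    by (simp add: left_diff_distrib diff_divide_distrib del: gcoef_dot.simps)
  then show ?thesis
    unfolding D_series_dot_def egf_def[of "\<lambda>n. - gcoef_dot \<alpha> \<gamma> a c (Suc n)"] by (rule sums_unique[symmetric])
qed

section \<open>Strict monotonicity in the parameters\<close>

lemma egf_vcoef:
  assumes "t \<noteq> 0"
  shows "egf (vcoef a c) t = a * ((exp t - 1 - t) / t) + c * (exp t - 1)"
proof -
  have e: "(\<lambda>n. t ^ n / fact n) sums exp t"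
    using exp_converges[of t] by (simp add: divide_inverse mult.commute)
  have e1: "(\<lambda>n. t ^ Suc n / fact (Suc n)) sums (exp t - 1)"
    using sums_Suc_iff[of "\<lambda>n. t ^ n / fact n" "exp t - 1"] e by simp
  have e2: "(\<lambda>n. t ^ Suc (Suc n) / fact (Suc (Suc n))) sums (exp t - 1 - t)"
    using sums_Suc_iff[of "\<lambda>n. t ^ Suc n / fact (Suc n)" "exp t - 1 - t"] e1 by simp
  have eq: "vcoef a c (Suc n) * t ^ Suc n / fact (Suc n)
      = a * (t ^ Suc (Suc n) / fact (Suc (Suc n)) / t) + c * (t ^ Suc n / fact (Suc n))" for n
    using assms by (simp add: vcoef_def kern_def divide_simps) (simp add: algebra_simps)
  have "(\<lambda>n. vcoef a c (Suc n) * t ^ Suc n / fact (Suc n)) sums (a * ((exp t - 1 - t) / t) + c * (exp t - 1))"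
    unfolding eq by (intro sums_add sums_mult sums_divide e1 e2)
  then have "(\<lambda>n. vcoef a c n * t ^ n / fact n) sums (a * ((exp t - 1 - t) / t) + c * (exp t - 1))"
    unfolding sums_Suc_iff[of "\<lambda>n. vcoef a c n * t ^ n / fact n"] by (simp add: vcoef_def[of _ _ 0])
  with egf_sums[OF abs_vcoef_le] show ?thesis by (rule sums_unique2)
qed

lemma times_egf_eta: "t * egf (eta \<alpha> \<gamma>) t = egf (vcoef \<alpha> \<gamma>) t"
proof -
  have eq: "t * (eta \<alpha> \<gamma> n * t ^ n / fact n) = vcoef \<alpha> \<gamma> (Suc n) * t ^ Suc n / fact (Suc n)" for n
    by (simp add: vcoef_def eta_def divide_simps)
  have "(\<lambda>n. vcoef \<alpha> \<gamma> (Suc n) * t ^ Suc n / fact (Suc n)) sums (t * egf (eta \<alpha> \<gamma>) t)"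
    unfolding eq[symmetric] by (rule sums_mult[OF egf_sums[OF abs_eta_le]])
  then have "(\<lambda>n. vcoef \<alpha> \<gamma> n * t ^ n / fact n) sums (t * egf (eta \<alpha> \<gamma>) t)"
    unfolding sums_Suc_iff[of "\<lambda>n. vcoef \<alpha> \<gamma> n * t ^ n / fact n"] by (simp add: vcoef_def[of _ _ 0])
  then show ?thesis using egf_sums[OF abs_vcoef_le] by (rule sums_unique2)
qed

lemma exp_minus_one_bounds:
  fixes t :: real
  assumes "t > 0"
  shows "exp t - 1 > t" "(exp t - 1)\<^sup>2 \<ge> t\<^sup>2 * exp t"
proof -
  show "exp t - 1 > t" using exp_minus_greater[of "- t"] assms by simp
  have "t / 2 \<le> (exp (t / 2) - inverse (exp (t / 2))) / 2"
    using real_le_x_sinh[of "t / 2"] assms by simp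
  then have "t * exp (t / 2) \<le> (exp (t / 2) - inverse (exp (t / 2))) * exp (t / 2)"
    by (intro mult_right_mono) auto
  also have "\<dots> = exp t - 1"
    by (simp add: left_diff_distrib mult_exp_exp)
  finally have "(t * exp (t / 2))\<^sup>2 \<le> (exp t - 1)\<^sup>2"
    using assms by (intro power_mono) auto
  then show "(exp t - 1)\<^sup>2 \<ge> t\<^sup>2 * exp t"
    by (simp add: power_mult_distrib flip: exp_double)
qed

lemma expm1_quotient_strict_mono:
  fixes x y :: real
  assumes "0 < x" "x < y"
  shows "x * (exp y - 1) > y * (exp x - 1)"
proof -
  have "(exp x - 1) / x < (exp y - 1) / y"
  proof (rule DERIV_pos_imp_increasing[OF assms(2)])
    fix t assume "x \<le> t" "t \<le> y"
    then have t: "t > 0" using assms by simp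
    have "((\<lambda>t. (exp t - 1) / t) has_real_derivative (exp t * t - (exp t - 1)) / (t * t)) (at t)"
      using t by (auto intro!: derivative_eq_intros)
    moreover have "exp t * t - (exp t - 1) > 0"
    proof -
      have "exp (- t) > 1 - t" using exp_minus_greater[of t] t by simp
      then have "exp (- t) * exp t > (1 - t) * exp t" by simp
      then show ?thesis by (simp add: algebra_simps mult_exp_exp)
    qed
    ultimately show "\<exists>D. ((\<lambda>t. (exp t - 1) / t) has_real_derivative D) (at t) \<and> D > 0"
      using t by (meson divide_pos_pos mult_pos_pos)
  qed
  then show ?thesis using assms by (simp add: field_simps)
qed

text \<open>
The claim is that \<open>Q(t) = t ^ 2 * (exp t - 1) / (exp t - 1 - t)\<close> increases. The numerator of its
derivative is \<open>t\<close> times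
\<open>((exp t - 1) ^ 2 - t ^ 2 * exp t) + (exp t - 1) * (exp t - 1 - t)\<close>. The first bracket is
nonnegative because \<open>2 * sinh (t / 2) \<ge> t\<close>, the second product is positive.
\<close>

lemma expm1_over_remainder_strict_mono:
  fixes x y :: real
  assumes "0 < x" "x < y"
  shows "(exp x - 1 - x) / x\<^sup>2 * (exp y - 1) > (exp y - 1 - y) / y\<^sup>2 * (exp x - 1)"
proof -
  define Q where "Q = (\<lambda>t::real. t\<^sup>2 * (exp t - 1) / (exp t - 1 - t))"
  have "Q x < Q y"
  proof (rule DERIV_pos_imp_increasing[OF assms(2)])
    fix t assume "x \<le> t" "t \<le> y"
    then have t: "t > 0" using assms by simp
    note b = exp_minus_one_bounds[OF t]
    have "(Q has_real_derivative ((2 * t * (exp t - 1) + t\<^sup>2 * exp t) * (exp t - 1 - t) - t\<^sup>2 * (exp t - 1) * (exp t - 1))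
        / ((exp t - 1 - t) * (exp t - 1 - t))) (at t)"
      unfolding Q_def using b(1) by (auto intro!: derivative_eq_intros simp: mult_ac)
    moreover have "(2 * t * (exp t - 1) + t\<^sup>2 * exp t) * (exp t - 1 - t) - t\<^sup>2 * (exp t - 1) * (exp t - 1)
        = t * (((exp t - 1)\<^sup>2 - t\<^sup>2 * exp t) + (exp t - 1) * (exp t - 1 - t))"
      by (simp add: algebra_simps power2_eq_square)
    moreover have "t * (((exp t - 1)\<^sup>2 - t\<^sup>2 * exp t) + (exp t - 1) * (exp t - 1 - t)) > 0"
      using b t by (intro mult_pos_pos add_nonneg_pos) auto
    ultimately show "\<exists>D. (Q has_real_derivative D) (at t) \<and> D > 0"
      using b by (metis diff_gt_0_iff_gt divide_pos_pos mult_pos_pos)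
  qed
  moreover have "exp x - 1 - x > 0" "exp y - 1 - y > 0"
    using exp_minus_one_bounds(1)[of x] exp_minus_one_bounds(1)[of y] assms by auto
  ultimately show ?thesis
    using assms by (simp add: Q_def field_simps)
qed

text \<open>
With \<open>S t = exp t - 1\<close> and \<open>R t = (exp t - 1 - t) / t\<close> one has \<open>v = a * R + c * S\<close> and
\<open>t * U = \<alpha> * R + \<gamma> * S\<close>. The cross difference expands into four terms with coefficients
\<open>\<alpha> * a\<close>, \<open>\<alpha> * c\<close>, \<open>\<gamma> * a\<close> and \<open>\<gamma> * c\<close>, each of which has a positive cofactor: for the mixed
terms these are the monotonicity of \<open>t * S t / R t\<close> and of \<open>t * R t / S t\<close>.
\<close>

lemma eta_vcoef_ratio_decreasing:
  assumes a: "a > 0" and c: "c \<ge> 0" and \<alpha>: "\<alpha> \<ge> 0" and \<gamma>: "\<gamma> \<ge> 0" and ne: "\<alpha> + \<gamma> > 0"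
    and x: "0 < x" and xy: "x < y"
  shows "egf (eta \<alpha> \<gamma>) x * egf (vcoef a c) y > egf (eta \<alpha> \<gamma>) y * egf (vcoef a c) x"
proof -
  define S where "S = (\<lambda>t::real. exp t - 1)"
  define R where "R = (\<lambda>t::real. (exp t - 1 - t) / t)"
  have y: "y > 0" using x xy by simp
  have pos: "S x > 0" "S y > 0" "R x > 0" "R y > 0"
    using exp_minus_one_bounds(1)[OF x] exp_minus_one_bounds(1)[OF y] x y by (auto simp: S_def R_def)
  have A: "y * R x * S y - x * R y * S x > 0"
  proof -
    have "R x / x * S y > R y / y * S x"
      using expm1_over_remainder_strict_mono[OF x xy] by (simp add: R_def S_def power2_eq_square)
    then show ?thesis using x y by (simp add: field_simps)
  qed
  have B: "y * S x * R y - x * S y * R x > 0"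
  proof -
    have R: "x * R x = S x - x" "y * R y = S y - y" using x y by (auto simp: R_def S_def)
    have "y * S x * R y - x * S y * R x = S x * (y * R y) - S y * (x * R x)"
      by simp
    also have "\<dots> = x * S y - y * S x" unfolding R by (simp add: algebra_simps)
    also have "\<dots> > 0" using expm1_quotient_strict_mono[OF x xy] by (simp add: S_def)
    finally show ?thesis .
  qed
  have "x * y * (egf (eta \<alpha> \<gamma>) x * egf (vcoef a c) y - egf (eta \<alpha> \<gamma>) y * egf (vcoef a c) x)
      = y * egf (vcoef \<alpha> \<gamma>) x * egf (vcoef a c) y - x * egf (vcoef \<alpha> \<gamma>) y * egf (vcoef a c) x"
    unfolding times_egf_eta[symmetric] by (simp add: algebra_simps)
  also have "\<dots> = y * (\<alpha> * R x + \<gamma> * S x) * (a * R y + c * S y) - x * (\<alpha> * R y + \<gamma> * S y) * (a * R x + c * S x)"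
    using x y by (simp add: egf_vcoef R_def S_def)
  also have "\<dots> = (\<alpha> * a) * (R x * R y * (y - x)) + (\<alpha> * c) * (y * R x * S y - x * R y * S x)
      + (\<gamma> * a) * (y * S x * R y - x * S y * R x) + (\<gamma> * c) * (S x * S y * (y - x))"
    by (simp add: algebra_simps)
  also have "\<dots> > 0"
  proof (cases "\<alpha> > 0")
    case True
    then show ?thesis
      using A B pos a c \<gamma> xy by (intro add_pos_nonneg mult_pos_pos mult_nonneg_nonneg) auto
  next
    case False
    then have "\<alpha> = 0" "\<gamma> > 0" using \<alpha> ne by auto
    then have "\<gamma> * a * (y * S x * R y - x * S y * R x) > 0" "\<gamma> * c * (S x * S y * (y - x)) \<ge> 0"
      using B pos a c xy by auto
    then show ?thesis using \<open>\<alpha> = 0\<close> by simp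
  qed
  finally have "x * y * (egf (eta \<alpha> \<gamma>) x * egf (vcoef a c) y - egf (eta \<alpha> \<gamma>) y * egf (vcoef a c) x) > 0" .
  moreover have "x * y > 0" using x y by simp
  ultimately have "egf (eta \<alpha> \<gamma>) x * egf (vcoef a c) y - egf (eta \<alpha> \<gamma>) y * egf (vcoef a c) x > 0"
    by (rule zero_less_mult_pos)
  then show ?thesis by simp
qed

lemma D_series_0: "D_series a c 0 = a / 2 + c"
  using gcoef_rec[of 0 a c] by (simp add: D_series_def egf_0 dcoef_def kern_def)

text \<open>
Let \<open>k = U(t) / v(t)\<close>. Since \<open>D(t) = 0\<close>, the renewal equation says that \<open>v(t)\<close> equals the
convolution of \<open>v\<close> and \<open>D\<close> at \<open>t\<close>, so the derivative is the integral of
\<open>(U(t - r) - k * v(t - r)) * D(r)\<close> over \<open>[0, t]\<close>. The first factor is positive for \<open>0 < r < t\<close>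
because \<open>U / v\<close> decreases, and \<open>D\<close> is nonnegative with \<open>D(0) > 0\<close>.
\<close>

lemma D_series_dot_pos_at_zero:
  assumes a: "a > 0" and c: "c \<ge> 0" and \<alpha>: "\<alpha> \<ge> 0" and \<gamma>: "\<gamma> \<ge> 0" and ne: "\<alpha> + \<gamma> > 0"
    and t: "t \<ge> 0" and nonneg: "\<And>r. r \<in> {0..t} \<Longrightarrow> D_series a c r \<ge> 0" and zero: "D_series a c t = 0"
  shows "D_series_dot \<alpha> \<gamma> a c t > 0"
proof -
  have t0: "t > 0"
    using t zero a c D_series_0[of a c] by (cases "t = 0") auto
  obtain C where C: "\<And>n. \<bar>dcoef a c n\<bar> \<le> C * 2 ^ n" using dcoef_bounded[of a c] by blast
  let ?U = "egf (eta \<alpha> \<gamma>)" and ?v = "egf (vcoef a c)" and ?D = "D_series a c"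
  have vpos: "?v s > 0" if "s > 0" for s
    using that exp_minus_one_bounds(1)[OF that] a c by (auto simp: egf_vcoef intro!: add_pos_nonneg divide_pos_pos)
  define k where "k = ?U t / ?v t"
  have cont: "continuous_on A ?D" "continuous_on A ?U" "continuous_on A ?v" for A
    unfolding D_series_def by (rule continuous_egf[OF C] continuous_egf[OF abs_eta_le] continuous_egf[OF abs_vcoef_le])+
  define h where "h = (\<lambda>r. (?U (t - r) - k * ?v (t - r)) * ?D r)"
  have less: "?U (t - r) - k * ?v (t - r) > 0" if "0 < r" "r < t" for r
    using eta_vcoef_ratio_decreasing[OF a c \<alpha> \<gamma> ne, of "t - r" t] that vpos[OF t0]
    by (simp add: k_def field_simps)
  have eta0: "?U 0 \<ge> 0" "?v 0 = 0"
    using \<alpha> \<gamma> by (auto simp: egf_0 eta_def vcoef_def kern_def)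
  have hn: "h r \<ge> 0" if r: "r \<in> {0..t}" for r
  proof -
    consider "r = 0" | "0 < r" "r < t" | "r = t" using r by fastforce
    then have "?U (t - r) - k * ?v (t - r) \<ge> 0"
    proof cases
      case 1 then show ?thesis using vpos[OF t0] by (simp add: k_def)
    next
      case 2 then show ?thesis using less by (simp add: less_imp_le)
    next
      case 3 then show ?thesis using eta0 by simp
    qed
    then show ?thesis unfolding h_def using nonneg[OF r] by (rule mult_nonneg_nonneg)
  qed
  have hc: "continuous_on {0..t} h"
    unfolding h_def
    by (intro continuous_on_mult continuous_on_diff continuous_on_const cont(1)
        continuous_on_compose2[OF cont(2)[of UNIV], of _ "\<lambda>r. t - r"]
        continuous_on_compose2[OF cont(3)[of UNIV], of _ "\<lambda>r. t - r"] continuous_on_id subset_UNIV)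
  have "integral {0..t} h \<noteq> 0"
  proof
    assume "integral {0..t} h = 0"
    then have hz: "\<forall>r\<in>{0..t}. h r = 0"
      using integral_eq_0_iff[OF hc t0 hn] by simp
    have Dz: "?D r = 0" if "0 < r" "r < t" for r
    proof -
      have "h r = 0" using hz that by simp
      then show ?thesis using less[OF that] unfolding h_def by (metis less_numeral_extra(3) mult_eq_0_iff)
    qed
    have "(?D \<longlongrightarrow> ?D 0) (at_right 0)"
      using cont(1)[of UNIV] unfolding continuous_on_def by (metis Lim_at_imp_Lim_at_within UNIV_I)
    moreover have "eventually (\<lambda>r. ?D r = 0) (at_right 0)"
      using eventually_at_right_real[OF t0] by eventually_elim (use Dz in auto)
    ultimately have "((\<lambda>_. 0) \<longlongrightarrow> ?D 0) (at_right (0::real))"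
      by (rule Lim_transform_eventually)
    then have "?D 0 = 0" by (simp add: tendsto_const_iff)
    then show False using D_series_0[of a c] a c by simp
  qed
  moreover have "integral {0..t} h \<ge> 0"
    by (rule integral_nonneg[OF integrable_continuous_real[OF hc] hn])
  moreover have "integral {0..t} h = integral {0..t} (\<lambda>r. ?U (t - r) * ?D r) - k * integral {0..t} (\<lambda>r. ?v (t - r) * ?D r)"
  proof -
    have i1: "(\<lambda>r. ?U (t - r) * ?D r) integrable_on {0..t}"
      unfolding D_series_def by (rule egf_convolution(2)[OF abs_eta_le C t])
    have i2: "(\<lambda>r. ?v (t - r) * ?D r) integrable_on {0..t}"
      unfolding D_series_def by (rule egf_convolution(2)[OF abs_vcoef_le C t])
    have "h = (\<lambda>r. ?U (t - r) * ?D r - k * (?v (t - r) * ?D r))"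
      by (simp add: h_def algebra_simps)
    then show ?thesis
      using integral_diff[OF i1 integrable_on_mult_right[OF i2, of k]] by simp
  qed
  moreover have "k * integral {0..t} (\<lambda>r. ?v (t - r) * ?D r) = ?U t"
    using D_series_renewal[OF t, of a c] zero vpos[OF t0] by (simp add: k_def)
  ultimately show ?thesis
    using D_series_dot_eq[OF t, of \<alpha> \<gamma> a c] by linarith
qed

text \<open>
The first-crossing principle is applied on \<open>[0, t]\<close> along the segment from \<open>(a, c)\<close> to
\<open>(a', c')\<close>, with the positivity of the parameter derivative at zeros as the driving condition.
\<close>

theorem D_series_pos_if_smaller_parameters:
  assumes a': "0 < a'" "a' \<le> a" and c': "0 \<le> c'" "c' \<le> c" and strict: "a' < a \<or> c' < c"
    and nonneg: "\<And>t. t \<ge> 0 \<Longrightarrow> D_series a c t \<ge> 0" and t: "t \<ge> 0"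
  shows "D_series a' c' t > 0"
proof -
  define \<alpha> \<gamma> where "\<alpha> = a - a'" and "\<gamma> = c - c'"
  have \<alpha>\<gamma>: "\<alpha> \<ge> 0" "\<gamma> \<ge> 0" "\<alpha> + \<gamma> > 0"
    using a' c' strict by (auto simp: \<alpha>_def \<gamma>_def)
  define A Ca where "A = (\<lambda>s::real. a - s * \<alpha>)" and "Ca = (\<lambda>s::real. c - s * \<gamma>)"
  \<comment> \<open>The parameter interval is enlarged to \<open>[-1, 2]\<close> so that \<open>[0, 1]\<close> lies in its interior, as
    termwise differentiation requires; the speeds are multiplied by at most \<open>2\<close> there.\<close>
  define B where "B = \<bar>a\<bar> + \<bar>c\<bar> + 2 * (\<alpha> + \<gamma>)"
  have B0: "B \<ge> 0" using \<alpha>\<gamma> by (simp add: B_def)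
  have kB: "\<bar>kern (A s) (Ca s) k\<bar> \<le> B" if s: "s \<in> {-1..2}" for s k
  proof -
    have "\<bar>s\<bar> \<le> 2" using s by auto
    then have "\<bar>s * \<alpha>\<bar> \<le> 2 * \<alpha>" "\<bar>s * \<gamma>\<bar> \<le> 2 * \<gamma>"
      using \<alpha>\<gamma> by (auto simp: abs_mult intro!: mult_right_mono)
    then have "\<bar>A s\<bar> \<le> \<bar>a\<bar> + 2 * \<alpha>" "\<bar>Ca s\<bar> \<le> \<bar>c\<bar> + 2 * \<gamma>"
      unfolding A_def Ca_def by linarith+
    then show ?thesis using abs_kern_le_abs[of "A s" "Ca s" k] by (simp add: B_def)
  qed
  from dcoef_geometric_bound[OF B0] obtain C where C: "C \<ge> 0"
    "\<And>a c n. (\<forall>k. \<bar>kern a c (Suc k)\<bar> \<le> B) \<Longrightarrow> \<bar>gcoef a c n\<bar> \<le> C * 2 ^ n"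
    "\<And>a c n. (\<forall>k. \<bar>kern a c (Suc k)\<bar> \<le> B) \<Longrightarrow> \<bar>dcoef a c n\<bar> \<le> (2 * C) * 2 ^ n"
    by blast
  have gB: "\<bar>gcoef (A s) (Ca s) n\<bar> \<le> C * 2 ^ n" and dB: "\<bar>dcoef (A s) (Ca s) n\<bar> \<le> (2 * C) * 2 ^ n"
    if "s \<in> {-1..2}" for s n
    using C(2,3) kB[OF that] by blast+
  define E where "E = (\<alpha> + \<gamma>) * C"
  have hB: "\<bar>- gcoef_dot \<alpha> \<gamma> (A s) (Ca s) (Suc n)\<bar> \<le> E * 4 ^ n" if s: "s \<in> {-1..2}" for s n
  proof -
    have "\<bar>- gcoef_dot \<alpha> \<gamma> (A s) (Ca s) (Suc n)\<bar> \<le> (\<Sum>k\<le>n. \<bar>eta \<alpha> \<gamma> k * gcoef (A s) (Ca s) (n - k)\<bar>)"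
      by (simp add: sum_abs)
    also have "\<dots> \<le> (\<Sum>k\<le>n. (\<alpha> + \<gamma>) * (C * 2 ^ (n - k)))"
      unfolding abs_mult using abs_eta_le[of \<alpha> \<gamma>] \<alpha>\<gamma> by (intro sum_mono mult_mono gB s) auto
    also have "\<dots> \<le> (\<Sum>k\<le>n. E * 2 ^ n)"
      using \<alpha>\<gamma> C(1) unfolding E_def mult.assoc[symmetric]
      by (intro sum_mono mult_left_mono power_increasing) auto
    also have "\<dots> = E * ((real n + 1) * 2 ^ n)" by simp
    also have "\<dots> \<le> E * (2 ^ n * 2 ^ n)"
    proof (intro mult_left_mono mult_right_mono)
      show "real n + 1 \<le> 2 ^ n"
        using of_nat_mono[OF Suc_leI[OF less_exp[of n]], where ?'a = real] by simp
      show "0 \<le> E" using \<alpha>\<gamma> C(1) by (simp add: E_def)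
    qed auto
    also have "(2::real) ^ n * 2 ^ n = 4 ^ n" by (simp flip: power_mult_distrib)
    finally show ?thesis .
  qed
  define F where "F = (\<lambda>s. D_series (A s) (Ca s))"
  define F' where "F' = (\<lambda>s. D_series_dot \<alpha> \<gamma> (A s) (Ca s))"
  have dg: "((\<lambda>s. gcoef (A s) (Ca s) n) has_real_derivative gcoef_dot \<alpha> \<gamma> (A s) (Ca s) n) (at s)" for s n
    unfolding A_def Ca_def by (rule gcoef_has_derivative)
  have majorant: "summable (\<lambda>n. K * (M * T) ^ n / fact n)" for K M T :: real
    using summable_mult[OF summable_exp[of "M * T"], of K] by (simp add: divide_inverse mult_ac)
  have le_maj: "norm (x * r ^ n / fact n) \<le> K * (M * T) ^ n / fact n"
    if "\<bar>x\<bar> \<le> K * M ^ n" "r \<in> {0..T}" "M \<ge> 0" for x r K M T :: real and n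
  proof -
    have "\<bar>x\<bar> * \<bar>r\<bar> ^ n \<le> (K * M ^ n) * T ^ n"
      using that by (intro mult_mono power_mono order.trans[OF abs_ge_zero that(1)]) auto
    then have "\<bar>x\<bar> * \<bar>r\<bar> ^ n / fact n \<le> K * (M * T) ^ n / fact n"
      by (intro divide_right_mono) (auto simp: power_mult_distrib)
    then show ?thesis by (simp add: abs_mult power_abs)
  qed
  have der: "((\<lambda>s. F s r) has_real_derivative F' s r) (at s)" if s: "s \<in> {0..1}" and r: "r \<in> {0..t}" for s r
    unfolding F_def F'_def D_series_def D_series_dot_def egf_def
  proof (rule has_field_derivative_series'(2)[where S = "{-1..2}" and ?x0.0 = 0])
    show "((\<lambda>s. dcoef (A s) (Ca s) n * r ^ n / fact n) has_real_derivative
        - gcoef_dot \<alpha> \<gamma> (A x) (Ca x) (Suc n) * r ^ n / fact n) (at x within {-1..2})" for n x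
      unfolding dcoef_def
      by (intro DERIV_cdivide DERIV_cmult_right DERIV_minus has_field_derivative_at_within[OF dg])
    show "uniformly_convergent_on {-1..2} (\<lambda>n s. \<Sum>i<n. - gcoef_dot \<alpha> \<gamma> (A s) (Ca s) (Suc i) * r ^ i / fact i)"
      by (rule Weierstrass_m_test'[OF le_maj[OF hB r] majorant]) auto
    show "summable (\<lambda>n. dcoef (A 0) (Ca 0) n * r ^ n / fact n)"
      by (rule sums_summable[OF egf_sums[OF dB]]) simp
  qed (use s in auto)
  have cg: "continuous_on S (\<lambda>p::real \<times> real. gcoef (A (fst p)) (Ca (fst p)) n)" for S n
  proof -
    have "continuous_on UNIV (\<lambda>s. gcoef (A s) (Ca s) n)"
      using dg DERIV_isCont continuous_at_imp_continuous_on by blast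
    from continuous_on_compose2[OF this continuous_on_fst[OF continuous_on_id]] show ?thesis by simp
  qed
  have contF: "continuous_on ({0..1} \<times> {0..t}) (\<lambda>p. F (fst p) (snd p))"
    unfolding F_def D_series_def egf_def
  proof (rule uniform_limit_theorem[OF always_eventually[OF allI] Weierstrass_m_test[OF le_maj majorant]])
    show "continuous_on ({0..1} \<times> {0..t}) (\<lambda>p. \<Sum>i<n. dcoef (A (fst p)) (Ca (fst p)) i * snd p ^ i / fact i)" for n
      unfolding dcoef_def by (intro continuous_intros cg) auto
    show "\<bar>dcoef (A (fst p)) (Ca (fst p)) n\<bar> \<le> (2 * C) * 2 ^ n" if "p \<in> {0..1} \<times> {0..t}" for n and p :: "real \<times> real"
      using that by (intro dB) auto
  qed auto
  have contF': "continuous_on ({0..1} \<times> {0..t}) (\<lambda>p. F' (fst p) (snd p))"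
    unfolding F'_def D_series_dot_def egf_def
  proof (rule uniform_limit_theorem[OF always_eventually[OF allI] Weierstrass_m_test[OF le_maj majorant]])
    show "continuous_on ({0..1} \<times> {0..t}) (\<lambda>p. \<Sum>i<n. - gcoef_dot \<alpha> \<gamma> (A (fst p)) (Ca (fst p)) (Suc i) * snd p ^ i / fact i)" for n
      unfolding gcoef_dot.simps by (intro continuous_intros cg) auto
    show "\<bar>- gcoef_dot \<alpha> \<gamma> (A (fst p)) (Ca (fst p)) (Suc n)\<bar> \<le> E * 4 ^ n" if "p \<in> {0..1} \<times> {0..t}" for n and p :: "real \<times> real"
      using that by (intro hB) auto
  qed auto
  have "F 1 t > 0"
  proof (rule positivity_propagates(2)[of t F F'])
    show "continuous_on ({0..1} \<times> {0..t}) (\<lambda>(s, r). F s r)" "continuous_on ({0..1} \<times> {0..t}) (\<lambda>(s, r). F' s r)"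
      using contF contF' by (simp_all add: case_prod_beta')
    show "F 0 r \<ge> 0" if "r \<in> {0..t}" for r
      using nonneg that by (simp add: F_def A_def Ca_def)
    show "F' s r > 0" if s: "s \<in> {0..1}" and r: "r \<in> {0..t}" and nn: "\<And>u. u \<in> {0..t} \<Longrightarrow> F s u \<ge> 0" and z: "F s r = 0" for s r
      unfolding F'_def
    proof (rule D_series_dot_pos_at_zero)
      have "s * \<alpha> \<le> \<alpha>" by (rule mult_left_le_one_le) (use s \<alpha>\<gamma> in simp_all)
      moreover have "s * \<gamma> \<le> \<gamma>" by (rule mult_left_le_one_le) (use s \<alpha>\<gamma> in simp_all)
      ultimately show "A s > 0" "Ca s \<ge> 0" using a' c' unfolding A_def Ca_def \<alpha>_def \<gamma>_def by linarith+
    qed (use \<alpha>\<gamma> r nn z in \<open>auto simp: F_def\<close>)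
  qed (use der t in auto)
  then show ?thesis by (simp add: F_def A_def Ca_def \<alpha>_def \<gamma>_def)
qed

section \<open>The generating function in closed form\<close>

lemma summable_abs_gcoef:
  assumes "0 \<le> r" "r < 1"
  shows "summable (\<lambda>n. \<bar>gcoef a c n\<bar> * r ^ n)"
proof -
  define q where "q = (1 + r) / 2"
  have q: "r < q" "q < 1" "0 < q" using assms by (auto simp: q_def)
  have B: "\<bar>a\<bar> + \<bar>c\<bar> \<ge> 0" by simp
  have K: "1 / q > 1" using q by simp
  obtain C where C: "C \<ge> 0" "\<And>n. \<bar>gcoef a c n\<bar> \<le> C * (1 / q) ^ n"
    using gcoef_geometric_bound[OF B K] abs_kern_le_abs[of a c] by metis
  show ?thesis
  proof (rule summable_comparison_test')
    show "summable (\<lambda>n. C * (r / q) ^ n)"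
      using q assms by (intro summable_mult summable_geometric) simp
    show "norm (\<bar>gcoef a c n\<bar> * r ^ n) \<le> C * (r / q) ^ n" for n
    proof -
      have "\<bar>gcoef a c n\<bar> * r ^ n \<le> C * (1 / q) ^ n * r ^ n"
        using C(2) assms by (intro mult_right_mono) auto
      also have "\<dots> = C * (r / q) ^ n"
        by (simp add: power_divide)
      finally show ?thesis using assms by simp
    qed
  qed
qed

text \<open>
Let \<open>S\<close> be the sum of the series with coefficients \<open>gcoef\<close> and \<open>T\<close> that of \<open>\<Psi>\<close>. The recursion
gives \<open>S' = - T' * S\<close> on the unit disc, so \<open>S * exp T\<close> is constant. The closed form of \<open>T\<close> comes
from partial fractions and the logarithmic series.
\<close>

lemma gcoef_generating_function:
  fixes X :: complex
  assumes X: "norm X < 1" "X \<noteq> 0"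
  shows "(\<lambda>n. of_real (gcoef a c n) * X ^ n) sums
           exp (- of_real a + (of_real a + of_real c - of_real a / X) * Ln (1 - X))"
proof -
  define g where "g = (\<lambda>n. complex_of_real (gcoef a c n))"
  define b where "b = (\<lambda>n. complex_of_real (kern a c (Suc n)))"
  define p where "p = (\<lambda>n. complex_of_real (vcoef a c n / real n))"
  have gs: "summable (\<lambda>n. norm (g n * z ^ n))" if "norm z < 1" for z
    using summable_abs_gcoef[OF norm_ge_zero that] by (simp add: g_def norm_mult norm_power)
  have bs: "summable (\<lambda>n. norm (b n * z ^ n))" if "norm z < 1" for z
  proof (rule summable_comparison_test')
    show "summable (\<lambda>n. (\<bar>a\<bar> + \<bar>c\<bar>) * norm z ^ n)"
      using that by (intro summable_mult summable_geometric) simp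
    show "norm (norm (b n * z ^ n)) \<le> (\<bar>a\<bar> + \<bar>c\<bar>) * norm z ^ n" for n
      using mult_right_mono[OF abs_kern_le_abs[of a c "Suc n"], of "norm z ^ n"]
      by (simp add: b_def norm_mult norm_power)
  qed
  have L: "(\<lambda>n. z ^ n / of_nat n) sums (- Ln (1 - z))" if "norm z < 1" for z :: complex
    using sums_minus[OF Ln_series'[of "- z"]] that by simp
  have pz: "(\<lambda>n. p n * z ^ n) sums (of_real a * (- Ln (1 - z) - (- Ln (1 - z)) / z + 1) + of_real c * (- Ln (1 - z)))"
    if z: "norm z < 1" "z \<noteq> 0" for z
  proof -
    note Lz = L[OF z(1)]
    have "(\<lambda>n. z ^ Suc n / of_nat (Suc n)) sums (- Ln (1 - z))"
      using Lz sums_Suc_iff[of "\<lambda>n. z ^ n / of_nat n" "- Ln (1 - z)"] by simp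
    then have "(\<lambda>n. z ^ Suc n / of_nat (Suc n) / z) sums (- Ln (1 - z) / z)"
      by (rule sums_divide)
    moreover have "z ^ Suc n / of_nat (Suc n) / z = z ^ n / of_nat (Suc n)" for n
      using z by (simp del: of_nat_Suc)
    ultimately have "(\<lambda>n. z ^ n / of_nat (Suc n)) sums (- Ln (1 - z) / z)"
      by (simp only:)
    then have "(\<lambda>n. z ^ Suc n / of_nat (Suc (Suc n))) sums (- Ln (1 - z) / z - 1)"
      using sums_Suc_iff[of "\<lambda>n. z ^ n / of_nat (Suc n)" "- Ln (1 - z) / z - 1"] by simp
    then have e1: "(\<lambda>n. if n = 0 then 0 else z ^ n / of_nat (Suc n)) sums (- Ln (1 - z) / z - 1)"
      using sums_Suc_iff[of "\<lambda>n. if n = 0 then 0 else z ^ n / of_nat (Suc n)" "- Ln (1 - z) / z - 1"] by simp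
    have "p n * z ^ n = of_real a * (z ^ n / of_nat n - (if n = 0 then 0 else z ^ n / of_nat (Suc n))) + of_real c * (z ^ n / of_nat n)" for n
    proof (cases "n = 0")
      case False
      then have n0: "of_nat n \<noteq> (0::complex)" "of_nat n + 1 \<noteq> (0::complex)"
        by (simp, metis of_nat_Suc of_nat_neq_0 add.commute)
      have "p n = of_real a / ((of_nat n + 1) * of_nat n) + of_real c / of_nat n"
        using False by (simp add: p_def vcoef_def kern_def add_divide_distrib)
      also have "\<dots> = of_real a * (1 / of_nat n - 1 / of_nat (Suc n)) + of_real c / of_nat n"
        using n0 by (simp add: field_simps)
      finally have "p n * z ^ n = (of_real a * (1 / of_nat n - 1 / of_nat (Suc n)) + of_real c / of_nat n) * z ^ n"
        by (rule arg_cong)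
      then show ?thesis using False by (simp add: ring_distribs del: of_nat_Suc)
    qed (simp add: p_def)
    moreover have "(\<lambda>n. of_real a * (z ^ n / of_nat n - (if n = 0 then 0 else z ^ n / of_nat (Suc n))) + of_real c * (z ^ n / of_nat n))
        sums (of_real a * (- Ln (1 - z) - (- Ln (1 - z) / z - 1)) + of_real c * (- Ln (1 - z)))"
      by (intro sums_add sums_mult sums_diff Lz e1)
    ultimately have "(\<lambda>n. p n * z ^ n) sums (of_real a * (- Ln (1 - z) - (- Ln (1 - z) / z - 1)) + of_real c * (- Ln (1 - z)))"
      by (simp only:)
    moreover have "- Ln (1 - z) - (- Ln (1 - z) / z - 1) = - Ln (1 - z) - (- Ln (1 - z)) / z + 1"
      by simp
    ultimately show ?thesis by (simp only:)
  qed
  have ps: "summable (\<lambda>n. p n * z ^ n)" if "norm z < 1" for z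
    using pz[OF that] by (cases "z = 0") (auto simp: sums_iff)
  define S T where "S = (\<lambda>z. \<Sum>n. g n * z ^ n)" and "T = (\<lambda>z. \<Sum>n. p n * z ^ n)"
  define Bf where "Bf = (\<lambda>z. \<Sum>n. b n * z ^ n)"
  have dS: "(S has_field_derivative - (Bf z * S z)) (at z)" if z: "norm z < 1" for z
  proof -
    have 1: "(S has_field_derivative (\<Sum>n. diffs g n * z ^ n)) (at z)"
      unfolding S_def by (rule termdiffs_strong'[OF _ z]) (rule summable_norm_cancel[OF gs])
    have "diffs g n * z ^ n = - (\<Sum>k\<le>n. (b k * z ^ k) * (g (n - k) * z ^ (n - k)))" for n
    proof -
      have "diffs g n = of_real ((real n + 1) * gcoef a c (Suc n))"
        by (simp add: diffs_def g_def add.commute)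
      also have "\<dots> = - (\<Sum>k\<le>n. b k * g (n - k))"
        unfolding gcoef_rec by (simp add: b_def g_def)
      finally have "diffs g n * z ^ n = - (\<Sum>k\<le>n. b k * g (n - k) * z ^ n)"
        by (simp add: sum_distrib_right)
      also have "(\<Sum>k\<le>n. b k * g (n - k) * z ^ n) = (\<Sum>k\<le>n. (b k * z ^ k) * (g (n - k) * z ^ (n - k)))"
      proof (rule sum.cong[OF refl])
        fix k assume "k \<in> {..n}"
        then have "z ^ n = z ^ k * z ^ (n - k)" by (simp flip: power_add)
        then show "b k * g (n - k) * z ^ n = (b k * z ^ k) * (g (n - k) * z ^ (n - k))" by simp
      qed
      finally show ?thesis .
    qed
    moreover have "(\<lambda>n. - (\<Sum>k\<le>n. (b k * z ^ k) * (g (n - k) * z ^ (n - k)))) sums - (Bf z * S z)"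
      unfolding Bf_def S_def by (intro sums_minus Cauchy_product_sums bs gs z)
    ultimately have "(\<Sum>n. diffs g n * z ^ n) = - (Bf z * S z)"
      by (simp add: sums_iff)
    with 1 show ?thesis by simp
  qed
  have dT: "(T has_field_derivative Bf z) (at z)" if z: "norm z < 1" for z
  proof -
    have 1: "(T has_field_derivative (\<Sum>n. diffs p n * z ^ n)) (at z)"
      unfolding T_def by (rule termdiffs_strong'[OF _ z]) (rule ps)
    have "diffs p n = b n" for n
    proof -
      have "of_nat (Suc n) * complex_of_real (kern a c (Suc n) / real (Suc n)) = complex_of_real (real (Suc n) * (kern a c (Suc n) / real (Suc n)))"
        by (simp only: of_real_mult of_real_of_nat_eq)
      then show ?thesis by (simp add: diffs_def p_def b_def vcoef_def del: of_nat_Suc)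
    qed
    with 1 show ?thesis by (simp add: Bf_def)
  qed
  have "\<exists>k. \<forall>z\<in>ball 0 1. S z * exp (T z) = k"
  proof (rule has_field_derivative_zero_constant)
    fix z :: complex assume "z \<in> ball 0 1"
    then have z: "norm z < 1" by simp
    have "((\<lambda>z. S z * exp (T z)) has_field_derivative - (Bf z * S z) * exp (T z) + exp (T z) * Bf z * S z) (at z)"
      using DERIV_mult[OF dS[OF z] DERIV_fun_exp[OF dT[OF z]]] by simp
    then show "((\<lambda>z. S z * exp (T z)) has_field_derivative 0) (at z within ball 0 1)"
      by (simp add: has_field_derivative_at_within mult_ac)
  qed simp
  then obtain k where k: "\<And>z. norm z < 1 \<Longrightarrow> S z * exp (T z) = k" by auto
  have "S 0 = 1" "T 0 = 0"
    unfolding S_def T_def powser_zero by (simp_all add: g_def p_def)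
  then have "k = 1" using k[of 0] by simp
  then have "S X = exp (- T X)"
    using k[OF X(1)] by (simp add: exp_minus field_simps)
  moreover have "T X = of_real a * (- Ln (1 - X) - (- Ln (1 - X)) / X + 1) + of_real c * (- Ln (1 - X))"
    unfolding T_def using pz[OF X] by (simp add: sums_iff)
  ultimately have "S X = exp (- of_real a + (of_real a + of_real c - of_real a / X) * Ln (1 - X))"
    by (simp add: algebra_simps)
  moreover have "(\<lambda>n. g n * X ^ n) sums S X"
    unfolding S_def by (rule summable_sums[OF summable_norm_cancel[OF gs[OF X(1)]]])
  ultimately show ?thesis by (simp add: g_def)
qed

lemma H_eq_gcoef_series:
  assumes y: "y > 0"
  shows "(\<lambda>n. gcoef a c n * (1 / (1 + y)) ^ n) sums (exp (- a) * H a c y)"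
proof -
  define X where "X = 1 / (1 + y)"
  have X: "0 < X" "X < 1" using y by (auto simp: X_def)
  have "(\<lambda>n. of_real (gcoef a c n) * of_real X ^ n) sums
           exp (- of_real a + (of_real a + of_real c - of_real a / of_real X) * Ln (1 - complex_of_real X))"
    by (rule gcoef_generating_function) (use X in auto)
  also have "Ln (1 - complex_of_real X) = of_real (ln (1 - X))"
    using X by (metis Ln_of_real diff_gt_0_iff_gt of_real_1 of_real_diff)
  also have "exp (- of_real a + (of_real a + of_real c - of_real a / of_real X) * complex_of_real (ln (1 - X)))
      = of_real (exp (- a + (a + c - a / X) * ln (1 - X)))"
    by (simp flip: exp_of_real)
  finally have "(\<lambda>n. complex_of_real (gcoef a c n * X ^ n)) sums of_real (exp (- a + (a + c - a / X) * ln (1 - X)))"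
    by simp
  then have 1: "(\<lambda>n. gcoef a c n * X ^ n) sums exp (- a + (a + c - a / X) * ln (1 - X))"
    by (simp only: sums_of_real_iff)
  have "1 - X = inverse (1 + 1 / y)" using y by (simp add: X_def field_simps)
  then have "ln (1 - X) = - ln (1 + 1 / y)" using y by (simp add: ln_inverse add_pos_pos)
  moreover have "a + c - a / X = - (a * y - c)" by (simp add: X_def algebra_simps)
  ultimately have "(a + c - a / X) * ln (1 - X) = (a * y - c) * ln (1 + 1 / y)"
    by (simp only: minus_mult_minus)
  then have "exp (- a + (a + c - a / X) * ln (1 - X)) = exp (- a) * H a c y"
    using y add_pos_pos[of 1 "1 / y"] by (simp add: H_def powr_def mult_exp_exp)
  with 1 show ?thesis by (simp add: X_def)
qed

section \<open>Laplace transforms and the Bernstein property\<close>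

definition laplace :: "(real \<Rightarrow> real) \<Rightarrow> real \<Rightarrow> real" where
  "laplace g y = (\<integral>t. indicator {0..} t * (exp (- (y * t)) * g t) \<partial>lborel)"

text \<open>
Integrability for every \<open>y > 0\<close> is the form of subexponential growth that is inherited by
\<open>\<lambda>t. t ^ n * g t\<close>, which is what iterated differentiation under the integral needs.
\<close>

definition laplace_integrable :: "(real \<Rightarrow> real) \<Rightarrow> bool" where
  "laplace_integrable g \<longleftrightarrow> g \<in> borel_measurable borel \<and>
     (\<forall>y>0. integrable lborel (\<lambda>t. indicator {0..} t * (exp (- (y * t)) * g t)))"

lemma laplace_integrableD:
  "laplace_integrable g \<Longrightarrow> y > 0 \<Longrightarrow> integrable lborel (\<lambda>t. indicator {0..} t * (exp (- (y * t)) * g t))"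
  "laplace_integrable g \<Longrightarrow> g \<in> borel_measurable borel"
  by (auto simp: laplace_integrable_def)

lemma laplace_integrable_times:
  assumes g: "laplace_integrable g"
  shows "laplace_integrable (\<lambda>t. - t * g t)"
  unfolding laplace_integrable_def
proof (intro conjI allI impI)
  note [measurable] = laplace_integrableD(2)[OF g]
  show "(\<lambda>t. - t * g t) \<in> borel_measurable borel" by measurable
  fix y :: real assume y: "y > 0"
  show "integrable lborel (\<lambda>t. indicator {0..} t * (exp (- (y * t)) * (- t * g t)))"
  proof (rule Bochner_Integration.integrable_bound)
    show "integrable lborel (\<lambda>t. 2 / y * (indicator {0..} t * (exp (- (y / 2 * t)) * g t)))"
      using y by (intro integrable_mult_right laplace_integrableD(1)[OF g]) auto
    show "AE t in lborel. norm (indicator {0..} t * (exp (- (y * t)) * (- t * g t)))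
        \<le> norm (2 / y * (indicator {0..} t * (exp (- (y / 2 * t)) * g t)))"
    proof (intro AE_I2)
      fix t :: real
      show "norm (indicator {0..} t * (exp (- (y * t)) * (- t * g t)))
        \<le> norm (2 / y * (indicator {0..} t * (exp (- (y / 2 * t)) * g t)))"
      proof (cases "t \<ge> 0")
        case True
        have "y / 2 * t \<le> exp (y / 2 * t)"
          using exp_ge_add_one_self[of "y / 2 * t"] by linarith
        then have "t \<le> 2 / y * exp (y / 2 * t)" using y by (simp add: field_simps)
        then have "t * exp (- (y * t)) \<le> 2 / y * exp (y / 2 * t) * exp (- (y * t))"
          by (intro mult_right_mono) auto
        also have "\<dots> = 2 / y * exp (- (y / 2 * t))"
          by (simp add: mult_exp_exp field_simps)
        finally have "t * exp (- (y * t)) * \<bar>g t\<bar> \<le> 2 / y * exp (- (y / 2 * t)) * \<bar>g t\<bar>"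
          by (intro mult_right_mono) auto
        then show ?thesis using True y by (simp add: abs_mult mult_ac)
      qed simp
    qed
  qed measurable
qed

text \<open>
By Taylor's formula the second-order remainder of \<open>h \<mapsto> exp (- ((y + h) * t))\<close> is at most
\<open>h ^ 2 * (32 / y ^ 2) * exp (- (y / 2) * t)\<close> for \<open>\<bar>h\<bar> < y / 4\<close>, and this majorant times \<open>\<bar>g t\<bar>\<close> is integrable.
\<close>

lemma laplace_has_derivative:
  assumes g: "laplace_integrable g" and y: "y > 0"
  shows "(laplace g has_real_derivative laplace (\<lambda>t. - t * g t) y) (at y)"
proof -
  note [measurable] = laplace_integrableD(2)[OF g]
  define M where "M = (\<integral>t. indicator {0..} t * (exp (- (y / 2 * t)) * \<bar>g t\<bar>) \<partial>lborel)"
  have iM: "integrable lborel (\<lambda>t. indicator {0..} t * (exp (- (y / 2 * t)) * \<bar>g t\<bar>))"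
    using integrable_abs[OF laplace_integrableD(1)[OF g, of "y / 2"]] y by (simp add: abs_mult)
  have bound: "\<bar>laplace g (y + h) - laplace g y - h * laplace (\<lambda>t. - t * g t) y\<bar> \<le> h\<^sup>2 * (32 / y\<^sup>2 * M)"
    if h: "\<bar>h\<bar> < y / 4" for h
  proof -
    have yh: "y + h > 0" using h y by linarith
    note i1 = laplace_integrableD(1)[OF g yh] and i2 = laplace_integrableD(1)[OF g y]
      and i3 = laplace_integrableD(1)[OF laplace_integrable_times[OF g] y]
    have eq: "laplace g (y + h) - laplace g y - h * laplace (\<lambda>t. - t * g t) y
       = (\<integral>t. indicator {0..} t * (exp (- ((y + h) * t)) * g t) - indicator {0..} t * (exp (- (y * t)) * g t)
            - h * (indicator {0..} t * (exp (- (y * t)) * (- t * g t))) \<partial>lborel)"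
      unfolding laplace_def using i1 i2 i3 by simp
    have "\<bar>laplace g (y + h) - laplace g y - h * laplace (\<lambda>t. - t * g t) y\<bar> \<le> (\<integral>t. h\<^sup>2 * (32 / y\<^sup>2) * (indicator {0..} t * (exp (- (y / 2 * t)) * \<bar>g t\<bar>)) \<partial>lborel)"
      unfolding eq
    proof (rule order.trans[OF integral_abs_bound Bochner_Integration.integral_mono])
      show "\<bar>indicator {0..} t * (exp (- ((y + h) * t)) * g t) - indicator {0..} t * (exp (- (y * t)) * g t)
            - h * (indicator {0..} t * (exp (- (y * t)) * (- t * g t)))\<bar>
          \<le> h\<^sup>2 * (32 / y\<^sup>2) * (indicator {0..} t * (exp (- (y / 2 * t)) * \<bar>g t\<bar>))" for t
      proof (cases "t \<ge> 0")
        case t: True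
        have "\<bar>exp (- (h * t)) - (1 - h * t)\<bar> \<le> exp \<bar>h * t\<bar> * (h * t)\<^sup>2"
          using Taylor_exp_field[of "- (h * t)" 1] by (simp add: numeral_2_eq_2)
        also have "\<dots> \<le> exp (y / 4 * t) * (h\<^sup>2 * (32 / y\<^sup>2 * exp (y / 4 * t)))"
        proof (rule mult_mono)
          show "exp \<bar>h * t\<bar> \<le> exp (y / 4 * t)"
            using mult_right_mono[of "\<bar>h\<bar>" "y / 4" t] h t by (simp add: abs_mult)
          have "(y / 4 * t)\<^sup>2 / 2 \<le> exp (y / 4 * t)"
            using exp_lower_Taylor_quadratic[of "y / 4 * t"] t y mult_nonneg_nonneg[of "y / 4" t] by linarith
          then have "y\<^sup>2 * t\<^sup>2 / 32 \<le> exp (y / 4 * t)" by (simp add: power_mult_distrib power_divide)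
          then have "t\<^sup>2 \<le> 32 / y\<^sup>2 * exp (y / 4 * t)" using y by (simp add: field_simps)
          then show "(h * t)\<^sup>2 \<le> h\<^sup>2 * (32 / y\<^sup>2 * exp (y / 4 * t))"
            unfolding power_mult_distrib by (intro mult_left_mono) auto
        qed auto
        also have "\<dots> = h\<^sup>2 * (32 / y\<^sup>2) * exp (y / 2 * t)"
        proof -
          have "exp (y / 2 * t) = exp (y / 4 * t) * exp (y / 4 * t)"
            unfolding exp_add[symmetric] by simp
          then show ?thesis by (simp only: mult_ac)
        qed
        finally have "exp (- (y * t)) * \<bar>exp (- (h * t)) - (1 - h * t)\<bar> \<le> exp (- (y * t)) * (h\<^sup>2 * (32 / y\<^sup>2) * exp (y / 2 * t))"
          by (intro mult_left_mono) auto
        also have "\<dots> = h\<^sup>2 * (32 / y\<^sup>2) * exp (- (y / 2 * t))"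
        proof -
          have "exp (- (y / 2 * t)) = exp (- (y * t)) * exp (y / 2 * t)"
            unfolding exp_add[symmetric] by simp
          then show ?thesis by (simp only: mult_ac)
        qed
        finally have 1: "\<bar>exp (- (y * t)) * (exp (- (h * t)) - (1 - h * t))\<bar> * \<bar>g t\<bar> \<le> h\<^sup>2 * (32 / y\<^sup>2) * exp (- (y / 2 * t)) * \<bar>g t\<bar>"
          by (intro mult_right_mono) (auto simp: abs_mult)
        have 2: "exp (- ((y + h) * t)) = exp (- (y * t)) * exp (- (h * t))"
          unfolding exp_add[symmetric] by (simp add: distrib_right)
        have "exp (- ((y + h) * t)) * g t - exp (- (y * t)) * g t - h * (exp (- (y * t)) * (- t * g t))
            = exp (- (y * t)) * (exp (- (h * t)) - (1 - h * t)) * g t"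
          unfolding 2 by (simp add: algebra_simps)
        then have 3: "\<bar>exp (- ((y + h) * t)) * g t - exp (- (y * t)) * g t - h * (exp (- (y * t)) * (- t * g t))\<bar>
            \<le> h\<^sup>2 * (32 / y\<^sup>2) * (exp (- (y / 2 * t)) * \<bar>g t\<bar>)"
          using 1 by (simp only: abs_mult mult.assoc)
        have ind: "indicator {0..} t = (1::real)" using t by simp
        show ?thesis unfolding ind using 3 by (simp only: mult_1)
      qed simp
      show "integrable lborel (\<lambda>t. h\<^sup>2 * (32 / y\<^sup>2) * (indicator {0..} t * (exp (- (y / 2 * t)) * \<bar>g t\<bar>)))"
        by (rule integrable_mult_right[OF iM])
    qed (intro integrable_abs Bochner_Integration.integrable_diff integrable_mult_right i1 i2 i3)
    also have "\<dots> = h\<^sup>2 * (32 / y\<^sup>2 * M)" by (simp add: M_def)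
    finally show ?thesis .
  qed
  have "((\<lambda>h. (laplace g (y + h) - laplace g y) / h - laplace (\<lambda>t. - t * g t) y) \<longlongrightarrow> 0) (at 0)"
  proof (rule Lim_null_comparison)
    have "eventually (\<lambda>h. \<bar>h\<bar> < y / 4 \<and> h \<noteq> 0) (at (0::real))"
      using y by (auto simp: eventually_at intro!: exI[of _ "y / 4"])
    then show "eventually (\<lambda>h. norm ((laplace g (y + h) - laplace g y) / h - laplace (\<lambda>t. - t * g t) y) \<le> \<bar>h\<bar> * (32 / y\<^sup>2 * M)) (at 0)"
    proof eventually_elim
      case (elim h)
      then have h: "\<bar>h\<bar> > 0" by simp
      have "h * ((laplace g (y + h) - laplace g y) / h - laplace (\<lambda>t. - t * g t) y) = laplace g (y + h) - laplace g y - h * laplace (\<lambda>t. - t * g t) y"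
        using elim by (simp only: right_diff_distrib) simp
      then have "\<bar>h\<bar> * \<bar>(laplace g (y + h) - laplace g y) / h - laplace (\<lambda>t. - t * g t) y\<bar> = \<bar>laplace g (y + h) - laplace g y - h * laplace (\<lambda>t. - t * g t) y\<bar>"
        by (simp only: abs_mult[symmetric])
      also have "\<dots> \<le> \<bar>h\<bar> * (\<bar>h\<bar> * (32 / y\<^sup>2 * M))"
      proof -
        have "h\<^sup>2 * (32 / y\<^sup>2 * M) = \<bar>h\<bar> * (\<bar>h\<bar> * (32 / y\<^sup>2 * M))"
          by (simp only: mult.assoc[symmetric] abs_mult_self_eq power2_eq_square)
        with bound[OF conjunct1[OF elim]] show ?thesis by linarith
      qed
      finally have "\<bar>(laplace g (y + h) - laplace g y) / h - laplace (\<lambda>t. - t * g t) y\<bar> \<le> \<bar>h\<bar> * (32 / y\<^sup>2 * M)"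
        by (rule mult_left_le_imp_le[OF _ h])
      then show ?case by (simp only: real_norm_def)
    qed
    show "((\<lambda>h. \<bar>h\<bar> * (32 / y\<^sup>2 * M)) \<longlongrightarrow> 0) (at 0)"
      by (rule tendsto_mult_left_zero[OF tendsto_rabs_zero[OF tendsto_ident_at]])
  qed
  then have "((\<lambda>h. (laplace g (y + h) - laplace g y) / h) \<longlongrightarrow> laplace (\<lambda>t. - t * g t) y) (at 0)"
    by (rule Lim_null[THEN iffD2])
  then show ?thesis by (simp add: DERIV_def)
qed

lemma laplace_integrable_power:
  assumes "laplace_integrable g"
  shows "laplace_integrable (\<lambda>t. (- t) ^ n * g t)"
proof (induction n)
  case (Suc n)
  from laplace_integrable_times[OF this] show ?case by (simp add: mult.assoc)
qed (use assms in simp)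

lemma iterated_deriv_laplace:
  assumes g: "laplace_integrable g" and F: "\<And>y. y > 0 \<Longrightarrow> F y = A + B * laplace g y" and y: "y > 0"
  shows "((deriv ^^ n) F has_real_derivative B * laplace (\<lambda>t. (- t) ^ Suc n * g t) y) (at y)"
  using y
proof (induction n arbitrary: y)
  case 0
  have "((\<lambda>y. A + B * laplace g y) has_real_derivative B * laplace (\<lambda>t. - t * g t) y) (at y)"
    using laplace_has_derivative[OF g 0] by (auto intro!: derivative_eq_intros)
  then have "(F has_real_derivative B * laplace (\<lambda>t. - t * g t) y) (at y)"
    by (rule has_field_derivative_transform_within_open[where S = "{0<..}"]) (use 0 F in auto)
  then show ?case by simp
next
  case (Suc n)
  define G where "G = laplace (\<lambda>t. (- t) ^ Suc n * g t)"
  define G' where "G' = laplace (\<lambda>t. - t * ((- t) ^ Suc n * g t)) y"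
  have "(G has_real_derivative G') (at y)"
    unfolding G_def G'_def by (rule laplace_has_derivative[OF laplace_integrable_power[OF g] Suc.prems])
  then have d: "((\<lambda>x. B * G x) has_real_derivative B * G') (at y)"
    by (rule DERIV_cmult)
  have eq: "B * G x = (deriv ^^ Suc n) F x" if "x \<in> {0<..}" for x
  proof -
    have "x > 0" using that by simp
    then have "((deriv ^^ n) F has_real_derivative B * G x) (at x)"
      unfolding G_def by (rule Suc.IH)
    from DERIV_imp_deriv[OF this] show ?thesis
      unfolding funpow.simps(2) comp_apply by (rule sym)
  qed
  have y: "y \<in> {0<..}" using Suc.prems by simp
  have "((deriv ^^ Suc n) F has_real_derivative B * G') (at y)"
    using has_field_derivative_transform_within_open[where f = "\<lambda>x. B * G x" and g = "(deriv ^^ Suc n) F"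
        and S = "{0<..}", OF d open_greaterThan y eq] .
  moreover have "(\<lambda>t. - t * ((- t) ^ Suc n * g t)) = (\<lambda>t. (- t) ^ Suc (Suc n) * g t)"
    by (simp only: power_Suc mult.assoc)
  ultimately show ?case by (simp only: G'_def)
qed

lemma has_bochner_integral_power_exp:
  fixes p :: real
  assumes p: "p > 0"
  shows "has_bochner_integral lborel (\<lambda>t. indicator {0..} t * (t ^ n * exp (- (p * t)))) (fact n / p ^ Suc n)"
proof -
  define f where "f = (\<lambda>t::real. indicator {0..} t * (t ^ n * exp (- t)))"
  have [measurable]: "f \<in> borel_measurable borel" unfolding f_def by measurable
  have "((\<lambda>t. t powr (real (Suc n) - 1) / exp t) has_integral Gamma (real (Suc n))) {0..}"
    by (rule Gamma_integral_real) simp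
  then have I: "((\<lambda>t::real. t ^ n * exp (- t)) has_integral Gamma (real (Suc n))) {0..}"
  proof (rule has_integral_spike_finite[of "{0}", rotated 2])
    fix t :: real assume "t \<in> {0..} - {0}"
    then show "t ^ n * exp (- t) = t powr (real (Suc n) - 1) / exp t"
      by (simp add: powr_realpow exp_minus divide_inverse)
  qed simp
  have "Gamma (real (Suc n)) = fact n"
    using Gamma_fact[of n, where ?'a = real] by (simp add: add.commute)
  from I[unfolded this] have "((\<lambda>t::real. t ^ n * exp (- t)) has_integral fact n) {0..}" .
  from nn_integral_has_integral_lebesgue[OF _ this]
  have "(\<integral>\<^sup>+t. f t \<partial>lborel) = ennreal (fact n)"
    by (simp add: f_def ennreal_mult' ennreal_indicator[symmetric] flip: ennreal_mult'')
  then have "has_bochner_integral lborel f (fact n)"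
    by (intro has_bochner_integral_nn_integral AE_I2) (auto simp: f_def indicator_def)
  then have "has_bochner_integral lborel (\<lambda>t::real. f (0 + p * t)) (fact n /\<^sub>R \<bar>p\<bar>)"
    using p by (subst lborel_has_bochner_integral_real_affine_iff[symmetric]) auto
  then have "has_bochner_integral lborel (\<lambda>t::real. 1 / p ^ n * f (0 + p * t)) (1 / p ^ n * (fact n /\<^sub>R \<bar>p\<bar>))"
    by (rule has_bochner_integral_mult_right)
  moreover have "1 / p ^ n * f (0 + p * t) = indicator {0..} t * (t ^ n * exp (- (p * t)))" for t :: real
    using p by (auto simp: f_def indicator_def power_mult_distrib zero_le_mult_iff)
  moreover have "1 / p ^ n * (fact n /\<^sub>R \<bar>p\<bar>) = fact n / p ^ Suc n"
    using p by (simp add: divide_inverse)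
  ultimately show ?thesis by simp
qed

definition m_series :: "real \<Rightarrow> real \<Rightarrow> real \<Rightarrow> real" where
  "m_series a c t = exp (- t) * D_series a c t"

lemma continuous_D_series: "continuous_on A (D_series a c)"
proof -
  obtain C where C: "\<And>n. \<bar>dcoef a c n\<bar> \<le> C * 2 ^ n" using dcoef_bounded[of a c] by blast
  show ?thesis unfolding D_series_def by (rule continuous_egf[OF C])
qed

lemma continuous_m_series: "continuous_on A (m_series a c)"
  unfolding m_series_def[abs_def] by (intro continuous_intros continuous_D_series)

text \<open>
Termwise integration: \<open>t ^ n / n! * exp (- (1 + y) * t)\<close> has integral \<open>X ^ (n + 1)\<close> with
\<open>X = 1 / (1 + y)\<close>, and the coefficients \<open>dcoef\<close> are summable against powers of \<open>X < 1\<close>.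
\<close>

lemma laplace_m_series:
  assumes y: "y > 0"
  shows "integrable lborel (\<lambda>t. indicator {0..} t * (exp (- (y * t)) * m_series a c t))"
    and "laplace (m_series a c) y = 1 - exp (- a) * H a c y"
proof -
  define p where "p = 1 + y"
  have p: "p > 1" using y by (simp add: p_def)
  obtain C where C: "\<And>n. \<bar>dcoef a c n\<bar> \<le> C * 2 ^ n" using dcoef_bounded[of a c] by blast
  define f where "f = (\<lambda>n t. dcoef a c n / fact n * (indicator {0..} t * (t ^ n * exp (- (p * t)))))"
  have hb: "has_bochner_integral lborel (\<lambda>t. indicator {0..} t * (t ^ n * exp (- (p * t)))) (fact n / p ^ Suc n)" for n
    by (rule has_bochner_integral_power_exp) (use p in simp)
  have fi: "has_bochner_integral lborel (f n) (dcoef a c n / p ^ Suc n)" for n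
    using has_bochner_integral_mult_right[OF hb[of n], of "dcoef a c n / fact n"] by (simp add: f_def)
  have nf: "(\<lambda>t. norm (f n t)) = (\<lambda>t. \<bar>dcoef a c n\<bar> / fact n * (indicator {0..} t * (t ^ n * exp (- (p * t)))))" for n
    by (auto simp: f_def fun_eq_iff abs_mult indicator_def)
  have fn: "(\<integral>t. norm (f n t) \<partial>lborel) = \<bar>dcoef a c n\<bar> / p ^ Suc n" for n
    unfolding nf using has_bochner_integral_integral_eq[OF has_bochner_integral_mult_right[OF hb[of n], of "\<bar>dcoef a c n\<bar> / fact n"]] by simp
  have fs: "(\<lambda>n. f n t) sums (indicator {0..} t * (exp (- (y * t)) * m_series a c t))" for t
  proof -
    have "(\<lambda>n. (indicator {0..} t * exp (- (p * t))) * (dcoef a c n * t ^ n / fact n)) sums ((indicator {0..} t * exp (- (p * t))) * D_series a c t)"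
      unfolding D_series_def by (rule sums_mult[OF egf_sums[OF C]])
    moreover have "exp (- (p * t)) = exp (- (y * t)) * exp (- t)"
      by (simp add: p_def mult_exp_exp algebra_simps)
    ultimately show ?thesis by (simp add: f_def m_series_def mult_ac)
  qed
  have sn: "summable (\<lambda>n. norm (f n t))" for t
  proof -
    have "summable (\<lambda>n. (indicator {0..} t * exp (- (p * t))) * norm (dcoef a c n * t ^ n / fact n))"
      by (rule summable_mult[OF summable_egf_norm[OF C]])
    moreover have "norm (f n t) = (indicator {0..} t * exp (- (p * t))) * norm (dcoef a c n * t ^ n / fact n)" for n
      by (simp add: f_def abs_mult indicator_def)
    ultimately show ?thesis by simp
  qed
  have si: "summable (\<lambda>n. \<integral>t. norm (f n t) \<partial>lborel)"
  proof -
    have "summable (\<lambda>n. \<bar>gcoef a c n\<bar> * (1 / p) ^ n)" by (rule summable_abs_gcoef) (use p in auto)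
    then have "summable (\<lambda>n. \<bar>gcoef a c (Suc n)\<bar> * (1 / p) ^ Suc n)" by (subst summable_Suc_iff)
    then show ?thesis unfolding fn by (simp add: dcoef_def power_divide)
  qed
  have suminf_f: "(\<Sum>n. f n t) = indicator {0..} t * (exp (- (y * t)) * m_series a c t)" for t
    using fs by (simp add: sums_iff)
  have ii: "integrable lborel (f n)" for n using fi[of n, unfolded has_bochner_integral_iff] by (rule conjunct1)
  have ie: "integral\<^sup>L lborel (f n) = dcoef a c n / p ^ Suc n" for n using fi[of n, unfolded has_bochner_integral_iff] by (rule conjunct2)
  have ae: "AE t in lborel. summable (\<lambda>n. norm (f n t))" using sn by (intro AE_I2)
  have "integrable lborel (\<lambda>t. \<Sum>n. f n t)" by (rule integrable_suminf[OF ii ae si])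
  then show "integrable lborel (\<lambda>t. indicator {0..} t * (exp (- (y * t)) * m_series a c t))"
    by (simp only: suminf_f)
  have "(\<lambda>n. integral\<^sup>L lborel (f n)) sums (\<integral>t. (\<Sum>n. f n t) \<partial>lborel)" by (rule sums_integral[OF ii ae si])
  then have 1: "(\<lambda>n. dcoef a c n / p ^ Suc n) sums laplace (m_series a c) y"
    by (simp only: suminf_f ie laplace_def)
  have "(\<lambda>n. gcoef a c (Suc n) * (1 / p) ^ Suc n) sums (exp (- a) * H a c y - 1)"
    unfolding sums_Suc_iff[of "\<lambda>n. gcoef a c n * (1 / p) ^ n"] using H_eq_gcoef_series[OF y, of a c]
    by (simp add: p_def)
  from sums_minus[OF this] have "(\<lambda>n. dcoef a c n / p ^ Suc n) sums (1 - exp (- a) * H a c y)"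
    by (simp add: dcoef_def power_divide)
  with 1 show "laplace (m_series a c) y = 1 - exp (- a) * H a c y" by (rule sums_unique2)
qed

lemma laplace_integrable_m_series: "laplace_integrable (m_series a c)"
  unfolding laplace_integrable_def
  using laplace_m_series(1) borel_measurable_continuous_onI[OF continuous_m_series] by blast

text \<open>
Inversion by Laplace's method. With \<open>k x = x * exp (1 - x)\<close>, the moment of order \<open>n\<close> at
\<open>y = n / t0\<close> is a positive multiple of the integral of \<open>k (t / t0) ^ n * g t\<close>, and \<open>k\<close> has its
strict maximum \<open>1\<close> at \<open>x = 1\<close>. If \<open>g t0 < 0\<close>, then \<open>g\<close> is below some \<open>- \<epsilon>\<close> near \<open>t0\<close>; away from
\<open>t0\<close> the integrand is \<open>O(\<rho> ^ n)\<close>, while a still smaller neighbourhood of \<open>t0\<close> contributes at most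
a negative constant times \<open>\<rho>' ^ n\<close> with \<open>\<rho> < \<rho>' < 1\<close>. For large \<open>n\<close> the integral is negative.
\<close>

lemma nonneg_if_laplace_moments_nonneg:
  assumes g: "laplace_integrable g" and cont: "isCont g t0" and t0: "t0 > 0"
    and moments: "\<And>n y. y > 0 \<Longrightarrow> laplace (\<lambda>t. t ^ Suc n * g t) y \<ge> 0"
  shows "g t0 \<ge> 0"
proof (rule ccontr)
  assume "\<not> g t0 \<ge> 0"
  then have neg: "g t0 < 0" by simp
  note [measurable] = laplace_integrableD(2)[OF g]
  \<comment> \<open>The factor \<open>exp 1\<close> normalises the maximum of \<open>k\<close> to \<open>1\<close>.\<close>
  define k where "k = (\<lambda>x::real. x * exp (1 - x))"
  have dk: "(k has_real_derivative (1 - x) * exp (1 - x)) (at x)" for x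
    unfolding k_def by (auto intro!: derivative_eq_intros simp: algebra_simps)
  have k_less1: "k x < 1" if "x \<noteq> 1" for x
  proof -
    have "exp (x - 1) > x" using exp_minus_greater[of "1 - x"] that by simp
    then have "x * exp (1 - x) < exp (x - 1) * exp (1 - x)" by simp
    then show ?thesis by (simp add: k_def mult_exp_exp)
  qed
  define \<epsilon> where "\<epsilon> = - g t0 / 2"
  have \<epsilon>: "\<epsilon> > 0" using neg by (simp add: \<epsilon>_def)
  have "\<exists>d>0. \<forall>t. \<bar>t - t0\<bar> < d \<longrightarrow> \<bar>g t - g t0\<bar> < \<epsilon>"
    using cont \<epsilon> unfolding continuous_at_eps_delta by (simp add: dist_real_def)
  then obtain d where d: "d > 0" "\<And>t. \<bar>t - t0\<bar> < d \<Longrightarrow> \<bar>g t - g t0\<bar> < \<epsilon>" by blast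
  define \<eta> where "\<eta> = min (1 / 2) (d / (2 * t0))"
  have \<eta>: "0 < \<eta>" "\<eta> < 1" using d t0 by (auto simp: \<eta>_def)
  have gneg: "g t < - \<epsilon>" if "\<bar>t / t0 - 1\<bar> \<le> \<eta>" for t
  proof -
    have "\<bar>t - t0\<bar> = t0 * \<bar>t / t0 - 1\<bar>" using t0 by (simp add: abs_mult_pos' right_diff_distrib)
    also have "\<dots> \<le> t0 * (d / (2 * t0))" using that t0 by (intro mult_left_mono) (auto simp: \<eta>_def)
    also have "\<dots> < d" using d t0 by simp
    finally have "\<bar>g t - g t0\<bar> < \<epsilon>" by (rule d(2))
    moreover have "g t0 = - 2 * \<epsilon>" by (simp add: \<epsilon>_def)
    ultimately show ?thesis by linarith
  qed
  define \<rho> where "\<rho> = max (k (1 - \<eta>)) (k (1 + \<eta>))"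
  have \<rho>: "0 < \<rho>" "\<rho> < 1"
  proof -
    have "k (1 - \<eta>) > 0" using \<eta> by (simp add: k_def)
    then show "0 < \<rho>" by (simp add: \<rho>_def)
    show "\<rho> < 1" using k_less1[of "1 - \<eta>"] k_less1[of "1 + \<eta>"] \<eta> by (simp add: \<rho>_def)
  qed
  have far: "k x \<le> \<rho>" if "x \<ge> 0" "\<bar>x - 1\<bar> > \<eta>" for x
  proof (cases "x < 1")
    case True
    have "k x \<le> k (1 - \<eta>)"
    proof (rule DERIV_nonneg_imp_nondecreasing[where f = k])
      show "x \<le> 1 - \<eta>" using that True by linarith
      show "\<exists>D. (k has_real_derivative D) (at u) \<and> D \<ge> 0" if "x \<le> u" "u \<le> 1 - \<eta>" for u
        by (intro exI[of _ "(1 - u) * exp (1 - u)"] conjI dk) (use that \<eta> in simp)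
    qed
    then show ?thesis by (simp add: \<rho>_def)
  next
    case False
    have "k x \<le> k (1 + \<eta>)"
    proof (rule DERIV_nonpos_imp_nonincreasing[where f = k])
      show "1 + \<eta> \<le> x" using that False by linarith
      show "\<exists>D. (k has_real_derivative D) (at u) \<and> D \<le> 0" if "1 + \<eta> \<le> u" "u \<le> x" for u
        by (intro exI[of _ "(1 - u) * exp (1 - u)"] conjI dk) (use that \<eta> in \<open>simp add: mult_nonpos_nonneg\<close>)
    qed
    then show ?thesis by (simp add: \<rho>_def)
  qed
  define \<rho>' where "\<rho>' = (1 + \<rho>) / 2"
  have \<rho>': "\<rho> < \<rho>'" "\<rho>' < 1" "0 < \<rho>'" using \<rho> by (auto simp: \<rho>'_def)
  have "isCont k 1" using dk DERIV_isCont by blast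
  moreover have "1 - \<rho>' > 0" using \<rho>' by simp
  ultimately have "\<exists>e>0. \<forall>x. \<bar>x - 1\<bar> < e \<longrightarrow> \<bar>k x - k 1\<bar> < 1 - \<rho>'"
    unfolding continuous_at_eps_delta by (simp add: dist_real_def)
  then obtain e where e: "e > 0" "\<And>x. \<bar>x - 1\<bar> < e \<Longrightarrow> \<bar>k x - k 1\<bar> < 1 - \<rho>'" by blast
  define \<delta> where "\<delta> = min \<eta> (e / 2)"
  have \<delta>: "0 < \<delta>" "\<delta> \<le> \<eta>" "\<delta> < e" using \<eta> e by (auto simp: \<delta>_def)
  have near: "k x \<ge> \<rho>'" if "\<bar>x - 1\<bar> \<le> \<delta>" for x
    using e(2)[of x] that \<delta> by (simp add: k_def)
  define I where "I = {t0 * (1 - \<delta>)..t0 * (1 + \<delta>)}"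
  have I_iff: "t \<in> I \<longleftrightarrow> \<bar>t / t0 - 1\<bar> \<le> \<delta>" for t
    using t0 by (auto simp: I_def abs_le_iff field_simps)
  have I_pos: "t \<ge> 0" if "t \<in> I" for t
  proof -
    have "0 \<le> t0 * (1 - \<delta>)" using t0 \<delta> \<eta> by simp
    then show ?thesis using that by (simp add: I_def)
  qed
  define J where "J = (\<lambda>t::real. indicator {0..} t * (k (t / t0) * \<bar>g t\<bar>))"
  have kn: "indicator {0..} t * (exp (- (real (Suc n) / t0 * t)) * (t ^ Suc n * g t))
      = (t0 / exp 1) ^ Suc n * (indicator {0..} t * (k (t / t0) ^ Suc n * g t))" for n t
  proof -
    have "k (t / t0) = t / t0 * (exp 1 * exp (- (t / t0)))"
      by (simp add: k_def mult_exp_exp)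
    then have "k (t / t0) = (exp 1 / t0) * (t * exp (- (t / t0)))" by simp
    then have "k (t / t0) ^ Suc n = (exp 1 / t0) ^ Suc n * (t ^ Suc n * exp (- (t / t0)) ^ Suc n)"
      by (simp only: power_mult_distrib)
    also have "exp (- (t / t0)) ^ Suc n = exp (- (real (Suc n) / t0 * t))"
      unfolding exp_of_nat_mult[symmetric] by simp
    finally have K: "k (t / t0) ^ Suc n = (exp 1 / t0) ^ Suc n * (t ^ Suc n * exp (- (real (Suc n) / t0 * t)))" .
    have PQ: "(t0 / exp 1) ^ Suc n * (exp 1 / t0) ^ Suc n = 1"
      unfolding power_mult_distrib[symmetric] using t0 by simp
    have "(t0 / exp 1) ^ Suc n * (indicator {0..} t * (k (t / t0) ^ Suc n * g t))
        = ((t0 / exp 1) ^ Suc n * (exp 1 / t0) ^ Suc n) * (indicator {0..} t * (exp (- (real (Suc n) / t0 * t)) * (t ^ Suc n * g t)))"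
      unfolding K by (simp only: mult_ac)
    then show ?thesis unfolding PQ by simp
  qed
  have int_k: "integrable lborel (\<lambda>t. indicator {0..} t * (k (t / t0) ^ Suc n * g t))"
    and nonneg_k: "(\<integral>t. indicator {0..} t * (k (t / t0) ^ Suc n * g t) \<partial>lborel) \<ge> 0" for n
  proof -
    have y: "real (Suc n) / t0 > 0" using t0 by simp
    have c: "(t0 / exp 1) ^ Suc n > 0" using t0 by simp
    have "laplace_integrable (\<lambda>t. (- 1) ^ Suc n * ((- t) ^ Suc n * g t))"
      using laplace_integrable_power[OF g, of "Suc n"] unfolding laplace_integrable_def
      by (auto simp: mult.left_commute[of _ "(- 1) ^ Suc n"] simp del: power_Suc)
    moreover have "(\<lambda>t. (- 1) ^ Suc n * ((- t) ^ Suc n * g t)) = (\<lambda>t. t ^ Suc n * g t)"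
      by (simp only: mult.assoc[symmetric] power_mult_distrib[symmetric]) simp
    ultimately have "laplace_integrable (\<lambda>t. t ^ Suc n * g t)" by simp
    from laplace_integrableD(1)[OF this y]
    have i: "integrable lborel (\<lambda>t. (t0 / exp 1) ^ Suc n * (indicator {0..} t * (k (t / t0) ^ Suc n * g t)))"
      by (simp only: kn)
    then show "integrable lborel (\<lambda>t. indicator {0..} t * (k (t / t0) ^ Suc n * g t))"
    proof -
      have "1 / P * (P * X) = X" if "P > 0" for P X :: real using that by simp
      with integrable_mult_right[OF i, of "1 / (t0 / exp 1) ^ Suc n"] c show ?thesis
        by (simp only:)
    qed
    have "laplace (\<lambda>t. t ^ Suc n * g t) (real (Suc n) / t0) = (t0 / exp 1) ^ Suc n * (\<integral>t. indicator {0..} t * (k (t / t0) ^ Suc n * g t) \<partial>lborel)"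
      unfolding laplace_def kn by (rule integral_mult_right_zero)
    with moments[OF y, of n] have "0 \<le> (t0 / exp 1) ^ Suc n * (\<integral>t. indicator {0..} t * (k (t / t0) ^ Suc n * g t) \<partial>lborel)"
      by simp
    then show "(\<integral>t. indicator {0..} t * (k (t / t0) ^ Suc n * g t) \<partial>lborel) \<ge> 0"
      using c by (simp only: zero_le_mult_iff) auto
  qed
  have kpos: "k (t / t0) \<ge> 0" if "t \<ge> 0" for t using that t0 by (simp add: k_def)
  have iJ: "integrable lborel J"
  proof -
    have "integrable lborel (\<lambda>t. \<bar>indicator {0..} t * (k (t / t0) ^ Suc 0 * g t)\<bar>)"
      by (rule integrable_abs[OF int_k])
    moreover have "(\<lambda>t. \<bar>indicator {0..} t * (k (t / t0) ^ Suc 0 * g t)\<bar>) = J"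
      using kpos by (auto simp: J_def fun_eq_iff abs_mult indicator_def)
    ultimately show ?thesis by simp
  qed
  have iI: "integrable lborel (indicator I :: real \<Rightarrow> real)"
    by (rule integrable_real_indicator) (simp_all add: I_def emeasure_lborel_Icc_eq)
  define Mi where "Mi = (\<integral>t. indicator I t \<partial>lborel :: real)"
  have Mi: "Mi = 2 * \<delta> * t0"
    using t0 \<delta> by (simp add: Mi_def I_def measure_def algebra_simps)
  have key: "0 \<le> \<rho> ^ n * integral\<^sup>L lborel J - \<epsilon> * \<rho>' ^ Suc n * Mi" for n
  proof -
    have "(\<integral>t. indicator {0..} t * (k (t / t0) ^ Suc n * g t) \<partial>lborel)
        \<le> (\<integral>t. \<rho> ^ n * J t - \<epsilon> * \<rho>' ^ Suc n * indicator I t \<partial>lborel)"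
    proof (rule Bochner_Integration.integral_mono[OF int_k])
      show "integrable lborel (\<lambda>t. \<rho> ^ n * J t - \<epsilon> * \<rho>' ^ Suc n * indicator I t)"
        by (intro Bochner_Integration.integrable_diff integrable_mult_right iJ iI)
      fix t :: real
      show "indicator {0..} t * (k (t / t0) ^ Suc n * g t) \<le> \<rho> ^ n * J t - \<epsilon> * \<rho>' ^ Suc n * indicator I t"
      proof (cases "t \<ge> 0")
        case False
        then have "t \<notin> I" using I_pos by blast
        with False show ?thesis by (simp add: J_def)
      next
        case t: True
        note kp = kpos[OF t]
        have Jp: "\<rho> ^ n * J t \<ge> 0" using \<rho> kp by (simp add: J_def)
        show ?thesis
        proof (cases "\<bar>t / t0 - 1\<bar> \<le> \<eta>")
          case False
          then have "t \<notin> I" using \<delta> by (simp add: I_iff)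
          have "k (t / t0) ^ n \<le> \<rho> ^ n"
            using far[of "t / t0"] False t t0 kp by (intro power_mono) auto
          then have "k (t / t0) ^ n * (k (t / t0) * \<bar>g t\<bar>) \<le> \<rho> ^ n * (k (t / t0) * \<bar>g t\<bar>)"
            using kp by (intro mult_right_mono) auto
          moreover have "k (t / t0) ^ n * (k (t / t0) * g t) \<le> k (t / t0) ^ n * (k (t / t0) * \<bar>g t\<bar>)"
            using kp by (intro mult_left_mono) auto
          ultimately show ?thesis using \<open>t \<notin> I\<close> t by (simp add: J_def mult_ac)
        next
          case True
          have gn: "g t < - \<epsilon>" by (rule gneg[OF True])
          have "k (t / t0) ^ Suc n * g t \<le> - (\<epsilon> * \<rho>' ^ Suc n * indicator I t)"
          proof (cases "t \<in> I")
            case True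
            then have "\<rho>' ^ Suc n \<le> k (t / t0) ^ Suc n"
              using near \<rho>' by (intro power_mono) (auto simp: I_iff)
            then have "\<epsilon> * \<rho>' ^ Suc n \<le> (- g t) * k (t / t0) ^ Suc n"
              using gn \<epsilon> \<rho>' by (intro mult_mono) auto
            then show ?thesis using True by (simp add: mult.commute)
          next
            case False
            have "k (t / t0) ^ Suc n * g t \<le> 0"
              using kp gn \<epsilon> by (intro mult_nonneg_nonpos) auto
            then show ?thesis using False by simp
          qed
          then show ?thesis using Jp t by simp
        qed
      qed
    qed
    also have "\<dots> = \<rho> ^ n * integral\<^sup>L lborel J - \<epsilon> * \<rho>' ^ Suc n * Mi"
      using iJ iI by (simp add: Mi_def)
    finally show ?thesis using nonneg_k[of n] by linarith
  qed
  have "(\<lambda>n. (\<rho> / \<rho>') ^ n) \<longlonglongrightarrow> 0"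
    using \<rho> \<rho>' by (intro LIMSEQ_power_zero) simp
  then have lim: "(\<lambda>n. (\<rho> / \<rho>') ^ n * integral\<^sup>L lborel J) \<longlonglongrightarrow> 0"
    by (rule tendsto_mult_left_zero)
  have le: "\<epsilon> * \<rho>' * Mi \<le> (\<rho> / \<rho>') ^ n * integral\<^sup>L lborel J" for n
  proof -
    have p: "\<rho>' ^ n > 0" using \<rho>' by simp
    have "\<rho>' ^ n * (\<rho> / \<rho>') ^ n = \<rho> ^ n"
      unfolding power_mult_distrib[symmetric] using \<rho>' by simp
    then have "\<rho>' ^ n * ((\<rho> / \<rho>') ^ n * integral\<^sup>L lborel J) = \<rho> ^ n * integral\<^sup>L lborel J"
      by (simp only: mult.assoc[symmetric])
    moreover have "\<rho>' ^ n * (\<epsilon> * \<rho>' * Mi) = \<epsilon> * \<rho>' ^ Suc n * Mi"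
      by (simp only: power_Suc mult_ac)
    ultimately have "\<rho>' ^ n * (\<epsilon> * \<rho>' * Mi) \<le> \<rho>' ^ n * ((\<rho> / \<rho>') ^ n * integral\<^sup>L lborel J)"
      using key[of n] by linarith
    then show ?thesis using p by (rule mult_left_le_imp_le)
  qed
  have "\<epsilon> * \<rho>' * Mi \<le> 0"
    by (rule LIMSEQ_le_const[OF lim], rule exI[of _ 0], intro allI impI, rule le)
  moreover have "\<epsilon> * \<rho>' * Mi > 0"
    unfolding Mi by (intro mult_pos_pos \<epsilon> \<rho>'(3) \<delta>(1) t0) simp
  ultimately show False by linarith
qed

lemma H_eq_laplace:
  assumes "y > 0"
  shows "H a c y = exp a + (- exp a) * laplace (m_series a c) y"
proof -
  have "exp a + (- exp a) * (1 - exp (- a) * H a c y) = (exp a * exp (- a)) * H a c y"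
    by (simp add: right_diff_distrib)
  also have "\<dots> = H a c y" unfolding exp_minus_inverse by (rule mult_1_left)
  finally show ?thesis unfolding laplace_m_series(2)[OF assms] by simp
qed

lemma iterated_deriv_H:
  assumes "y > 0"
  shows "((deriv ^^ n) (H a c) has_real_derivative - exp a * laplace (\<lambda>t. (- t) ^ Suc n * m_series a c t) y) (at y)"
  by (rule iterated_deriv_laplace[OF laplace_integrable_m_series H_eq_laplace assms])

lemma laplace_cmult: "laplace (\<lambda>t. k * g t) y = k * laplace g y"
proof -
  have "laplace (\<lambda>t. k * g t) y = (\<integral>t. k * (indicator {0..} t * (exp (- (y * t)) * g t)) \<partial>lborel)"
    unfolding laplace_def by (rule Bochner_Integration.integral_cong[OF refl]) (simp only: mult.left_commute)
  then show ?thesis unfolding laplace_def by (simp only: integral_mult_right_zero)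
qed

lemma deriv_sign_H:
  assumes "y > 0"
  shows "(- 1) ^ n * (deriv ^^ n) (deriv (H a c)) y = exp a * laplace (\<lambda>t. t ^ Suc n * m_series a c t) y"
proof -
  have 1: "(deriv ^^ n) (deriv (H a c)) y = deriv ((deriv ^^ n) (H a c)) y"
    by (subst funpow_swap1) (rule refl)
  have "(- t) ^ Suc n * m_series a c t = (- 1) ^ Suc n * (t ^ Suc n * m_series a c t)" for t
    by (subst power_minus) (rule mult.assoc)
  then have "(\<lambda>t. (- t) ^ Suc n * m_series a c t) = (\<lambda>t. (- 1) ^ Suc n * (t ^ Suc n * m_series a c t))"
    by (rule ext)
  then have "laplace (\<lambda>t. (- t) ^ Suc n * m_series a c t) y = (- 1) ^ Suc n * laplace (\<lambda>t. t ^ Suc n * m_series a c t) y"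
    by (rule ssubst) (rule laplace_cmult)
  moreover have "(- 1) ^ n * (- 1) ^ Suc n = (- 1 :: real)"
    by (simp add: minus_one_power_iff)
  moreover have "(- 1) ^ n * (- exp a * ((- 1) ^ Suc n * L)) = - ((- 1) ^ n * (- 1) ^ Suc n) * (exp a * L)" for L
    by (simp only: mult_minus_left mult_minus_right mult_ac)
  ultimately show ?thesis
    unfolding 1 DERIV_imp_deriv[OF iterated_deriv_H[OF assms]] by simp
qed

lemma smooth_on_pos_H: "smooth_on_pos (H a c)" "smooth_on_pos (deriv (H a c))"
proof -
  have d: "(deriv ^^ n) (H a c) differentiable_on {0<..}" for n
    unfolding differentiable_on_def
  proof
    fix x :: real assume "x \<in> {0<..}"
    then have "x > 0" by simp
    from iterated_deriv_H[OF this, unfolded has_field_derivative_def]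
    have "(deriv ^^ n) (H a c) differentiable (at x)" by (rule differentiableI)
    then show "(deriv ^^ n) (H a c) differentiable (at x within {0<..})"
      by (rule differentiable_at_withinI)
  qed
  then show "smooth_on_pos (H a c)" by (simp add: smooth_on_pos_def)
  show "smooth_on_pos (deriv (H a c))"
    unfolding smooth_on_pos_def
  proof
    show "(deriv ^^ n) (deriv (H a c)) differentiable_on {0<..}" for n
      using d[of "Suc n"] by (simp only: funpow_Suc_right comp_apply)
  qed
qed

text \<open>
Up to the factor \<open>exp a\<close>, the signed derivatives of \<open>deriv (H a c)\<close> are the moments
\<open>t ^ (n + 1)\<close> of \<open>m_series a c\<close>. They are nonnegative when \<open>D_series a c\<close> is; conversely the
inversion lemma recovers the sign of \<open>D_series a c\<close> from them.
\<close>

theorem bernstein_H_iff: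
  assumes "a \<ge> 0" "c \<ge> 0"
  shows "bernstein_function (H a c) \<longleftrightarrow> (\<forall>t\<ge>0. D_series a c t \<ge> 0)"
proof
  assume B: "bernstein_function (H a c)"
  show "\<forall>t\<ge>0. D_series a c t \<ge> 0"
  proof (intro allI impI)
    fix t :: real assume t: "t \<ge> 0"
    show "D_series a c t \<ge> 0"
    proof (cases "t = 0")
      case True then show ?thesis using assms by (simp add: D_series_0)
    next
      case False
      have "m_series a c t \<ge> 0"
      proof (rule nonneg_if_laplace_moments_nonneg[OF laplace_integrable_m_series])
        show "isCont (m_series a c) t"
          using continuous_m_series[of UNIV] by (simp add: continuous_on_eq_continuous_at)
        show "t > 0" using t False by simp
        fix n and y :: real assume "y > 0"
        then show "laplace (\<lambda>t. t ^ Suc n * m_series a c t) y \<ge> 0"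
          using B deriv_sign_H[of y n a c] unfolding bernstein_function_def completely_monotone_def
          by (metis exp_gt_zero zero_le_mult_iff linorder_not_le order_less_asym)
      qed
      then show ?thesis by (simp add: m_series_def zero_le_mult_iff)
    qed
  qed
next
  assume D: "\<forall>t\<ge>0. D_series a c t \<ge> 0"
  show "bernstein_function (H a c)"
    unfolding bernstein_function_def completely_monotone_def
  proof (intro conjI allI impI smooth_on_pos_H)
    show "H a c x \<ge> 0" for x by (simp add: H_def)
    fix n and x :: real assume x: "x > 0"
    have "laplace (\<lambda>t. t ^ Suc n * m_series a c t) x \<ge> 0"
      unfolding laplace_def by (rule Bochner_Integration.integral_nonneg) (use D in \<open>auto simp: indicator_def m_series_def\<close>)
    then show "(- 1) ^ n * (deriv ^^ n) (deriv (H a c)) x \<ge> 0"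
      unfolding deriv_sign_H[OF x] by simp
  qed
qed

section \<open>Moments of the weight by residues\<close>

text \<open>
This is \<open>exp ((a * s + c) * \<theta>) * (1 - s) ^ n * s * (1 - s)\<close> for \<open>s = 1 / (1 - exp (- \<theta>))\<close>,
written in terms of \<open>X = 1 - exp \<theta> = 1 / (1 - s)\<close>. The factor \<open>s * (1 - s)\<close> is \<open>ds / d\<theta>\<close>,
so that integration over \<open>\<theta>\<close> becomes integration over \<open>s\<close>.
\<close>

definition strip_form :: "real \<Rightarrow> real \<Rightarrow> nat \<Rightarrow> complex \<Rightarrow> complex" where
  "strip_form a c n \<theta> = - exp ((of_real a + of_real c - of_real a / (1 - exp \<theta>)) * \<theta>) * exp \<theta> / (1 - exp \<theta>) ^ (n + 2)"

lemma one_minus_exp_eq_0: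
  fixes \<theta> :: complex
  assumes "1 - exp \<theta> = 0" "\<bar>Im \<theta>\<bar> < 2 * pi"
  shows "\<theta> = 0"
proof -
  have "exp \<theta> = 1" using assms(1) by simp
  then obtain k :: int where k: "Re \<theta> = 0" "Im \<theta> = of_int (2 * k) * pi"
    unfolding exp_eq_1 by blast
  have "\<bar>real_of_int (2 * k)\<bar> * pi < 2 * pi"
    using assms(2) unfolding k(2) abs_mult by simp
  then have "\<bar>real_of_int (2 * k)\<bar> < 2" by (rule mult_right_less_imp_less) simp
  then have "k = 0" by linarith
  with k show ?thesis by (simp add: complex_eq_iff)
qed

lemma strip_form_holomorphic: "strip_form a c n holomorphic_on {\<theta>. \<bar>Im \<theta>\<bar> < 2 * pi} - {0}"
  unfolding strip_form_def[abs_def]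
  using one_minus_exp_eq_0 by (intro holomorphic_intros) auto

text \<open>
Near \<open>\<theta> = 0\<close> the integrand is \<open>exp a * G(X) * X' / X ^ (n + 2)\<close>. Splitting off the first
\<open>n + 2\<close> terms of \<open>G\<close>, each term \<open>X ^ k * X' / X ^ (n + 2)\<close> with \<open>k \<le> n\<close> has a primitive, the term
with \<open>k = n + 1\<close> is the logarithmic derivative of a function with a simple zero, and the rest is
holomorphic. Only \<open>k = n + 1\<close> contributes.
\<close>

lemma residue_of_integrand: "residue (strip_form a c n) 0 = of_real (exp a * gcoef a c (Suc n))"
proof -
  define g where "g = (\<lambda>k. complex_of_real (gcoef a c k))"
  define X where "X = (\<lambda>\<theta>::complex. 1 - exp \<theta>)"
  define U where "U = X -` ball 0 1 \<inter> {\<theta>. \<bar>Im \<theta>\<bar> < pi}"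
  have "open U"
    unfolding U_def X_def by (intro open_Int open_vimage open_Collect_less continuous_intros open_ball)
  moreover have "0 \<in> U" by (simp add: U_def X_def)
  ultimately obtain r2 where r2: "r2 > 0" "ball 0 r2 \<subseteq> U"
    unfolding open_contains_ball by blast
  define V where "V = ball (0::complex) r2"
  define r where "r = r2 / 2"
  have r: "0 < r" "cball 0 r \<subseteq> V" using r2 by (auto simp: r_def V_def)
  have V: "open V" "convex V" "connected V" "0 \<in> V" using r2 by (auto simp: V_def)
  have VU: "norm (X \<theta>) < 1" "\<bar>Im \<theta>\<bar> < pi" if "\<theta> \<in> V" for \<theta>
  proof -
    have "\<theta> \<in> U" by (rule subsetD[OF r2(2)]) (use that in \<open>simp only: V_def\<close>)
    then show "norm (X \<theta>) < 1" "\<bar>Im \<theta>\<bar> < pi" by (simp_all add: U_def)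
  qed
  have X0: "X \<theta> \<noteq> 0" if "\<theta> \<in> V - {0}" for \<theta>
  proof
    assume "X \<theta> = 0"
    then have z: "1 - exp \<theta> = 0" by (simp only: X_def)
    have "\<bar>Im \<theta>\<bar> < pi" by (rule VU(2)) (use that in simp)
    then have "\<bar>Im \<theta>\<bar> < 2 * pi" using pi_gt_zero by linarith
    then have "\<theta> = 0" by (rule one_minus_exp_eq_0[OF z])
    with that show False by simp
  qed
  have Xd: "(X has_field_derivative - exp \<theta>) (at \<theta>)" for \<theta>
    unfolding X_def by (auto intro!: derivative_eq_intros)
  define rest where "rest = (\<lambda>z. \<Sum>k. g (k + (n + 2)) * z ^ k)"
  have gs: "summable (\<lambda>k. g k * z ^ k)" if "norm z < 1" for z
    by (rule summable_norm_cancel)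
       (use summable_abs_gcoef[OF norm_ge_zero that] in \<open>simp add: g_def norm_mult norm_power\<close>)
  have rest: "(\<lambda>k. g (k + (n + 2)) * z ^ k) sums rest z" if z: "norm z < 1" for z
  proof (cases "z = 0")
    case True
    have "summable (\<lambda>k. g (k + (n + 2)) * 0 ^ k)" by (rule summable_0_powser)
    then show ?thesis unfolding rest_def True by (rule summable_sums)
  next
    case False
    have "summable (\<lambda>k. g (k + (n + 2)) * z ^ (k + (n + 2)))"
      by (rule summable_ignore_initial_segment[OF gs[OF z]])
    then have "summable (\<lambda>k. g (k + (n + 2)) * z ^ (k + (n + 2)) / z ^ (n + 2))"
      by (rule summable_divide)
    moreover have "g (k + (n + 2)) * z ^ (k + (n + 2)) / z ^ (n + 2) = g (k + (n + 2)) * z ^ k" for k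
      unfolding power_add[of z k] mult.assoc[symmetric] by (rule nonzero_mult_div_cancel_right) (use False in simp)
    ultimately have "summable (\<lambda>k. g (k + (n + 2)) * z ^ k)" by (simp only:)
    then show ?thesis unfolding rest_def by (rule summable_sums)
  qed
  have rest_hol: "rest holomorphic_on ball 0 1"
    by (rule power_series_holomorphic) (use rest in simp)
  have split: "strip_form a c n \<theta> = of_real (exp a) * ((\<Sum>k<n + 2. g k * (X \<theta> ^ k / X \<theta> ^ (n + 2) * - exp \<theta>)) + rest (X \<theta>) * - exp \<theta>)"
    if \<theta>: "\<theta> \<in> V - {0}" for \<theta>
  proof -
    have \<theta>V: "\<theta> \<in> V" using \<theta> by simp
    have "Ln (1 - X \<theta>) = \<theta>"
      unfolding X_def using VU(2)[OF \<theta>V] by (simp add: Ln_exp)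
    then have "(\<lambda>k. g k * X \<theta> ^ k) sums exp (- of_real a + (of_real a + of_real c - of_real a / X \<theta>) * \<theta>)"
      using gcoef_generating_function[OF VU(1)[OF \<theta>V] X0[OF \<theta>], of a c] by (simp add: g_def)
    then have S: "exp (- of_real a + (of_real a + of_real c - of_real a / X \<theta>) * \<theta>) = (\<Sum>k. g k * X \<theta> ^ k)"
      by (simp add: sums_iff)
    also have "\<dots> = (\<Sum>k. g (k + (n + 2)) * X \<theta> ^ (k + (n + 2))) + (\<Sum>k<n + 2. g k * X \<theta> ^ k)"
      by (rule suminf_split_initial_segment[OF gs[OF VU(1)[OF \<theta>V]]])
    also have "(\<Sum>k. g (k + (n + 2)) * X \<theta> ^ (k + (n + 2))) = rest (X \<theta>) * X \<theta> ^ (n + 2)"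
    proof -
      have "(\<lambda>k. g (k + (n + 2)) * X \<theta> ^ k * X \<theta> ^ (n + 2)) sums (rest (X \<theta>) * X \<theta> ^ (n + 2))"
        by (rule sums_mult2[OF rest[OF VU(1)[OF \<theta>V]]])
      then show ?thesis by (simp only: power_add mult.assoc sums_iff)
    qed
    finally have E: "exp (- of_real a + (of_real a + of_real c - of_real a / X \<theta>) * \<theta>)
        = rest (X \<theta>) * X \<theta> ^ (n + 2) + (\<Sum>k<n + 2. g k * X \<theta> ^ k)" .
    have "exp ((of_real a + of_real c - of_real a / X \<theta>) * \<theta>)
        = of_real (exp a) * exp (- of_real a + (of_real a + of_real c - of_real a / X \<theta>) * \<theta>)"
      unfolding exp_of_real[symmetric] exp_add[symmetric] by simp
    note ex = this
    have X\<theta>: "1 - exp \<theta> = X \<theta>" by (simp only: X_def)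
    have "strip_form a c n \<theta> = - (of_real (exp a) * (rest (X \<theta>) * X \<theta> ^ (n + 2) + (\<Sum>k<n + 2. g k * X \<theta> ^ k))) * exp \<theta> / X \<theta> ^ (n + 2)"
      unfolding strip_form_def X\<theta> ex E by (rule refl)
    also have "\<dots> = of_real (exp a) * ((\<Sum>k<n + 2. g k * X \<theta> ^ k) / X \<theta> ^ (n + 2) * - exp \<theta> + rest (X \<theta>) * - exp \<theta>)"
      using X0[OF \<theta>] by (simp add: divide_simps del: power_Suc) (simp add: algebra_simps del: power_Suc)
    also have "(\<Sum>k<n + 2. g k * X \<theta> ^ k) / X \<theta> ^ (n + 2) * - exp \<theta> = (\<Sum>k<n + 2. g k * (X \<theta> ^ k / X \<theta> ^ (n + 2) * - exp \<theta>))"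
      unfolding sum_divide_distrib sum_distrib_right by (intro sum.cong) simp_all
    finally show ?thesis .
  qed
  have path: "path_image (circlepath 0 r) \<subseteq> V - {0}"
    using r by (auto simp: sphere_def cball_def)
  have lower: "((\<lambda>\<theta>. X \<theta> ^ k / X \<theta> ^ (n + 2) * - exp \<theta>) has_contour_integral 0) (circlepath 0 r)" if k: "k < n + 1" for k
  proof -
    define j where "j = n - k"
    have n2: "n + 2 = k + (j + 2)" using k by (simp add: j_def)
    have "((\<lambda>\<theta>. X \<theta> ^ k / X \<theta> ^ (n + 2) * - exp \<theta>) has_contour_integral
       ((\<lambda>\<theta>. - 1 / (of_nat (j + 1) * X \<theta> ^ (j + 1))) (pathfinish (circlepath 0 r)) - (\<lambda>\<theta>. - 1 / (of_nat (j + 1) * X \<theta> ^ (j + 1))) (pathstart (circlepath 0 r)))) (circlepath 0 r)"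
    proof (rule contour_integral_primitive[OF _ valid_path_circlepath path])
      fix \<theta> assume \<theta>: "\<theta> \<in> V - {0}"
      have nz: "of_nat (j + 1) * X \<theta> ^ (j + 1) \<noteq> 0" using X0[OF \<theta>] by (simp del: of_nat_Suc)
      have "((\<lambda>\<theta>. of_nat (j + 1) * X \<theta> ^ (j + 1)) has_field_derivative of_nat (j + 1) * (of_nat (j + 1) * X \<theta> ^ j * - exp \<theta>)) (at \<theta>)"
        using DERIV_cmult[OF DERIV_power[OF Xd[of \<theta>], of "j + 1"], of "of_nat (j + 1)"] by (simp add: mult_ac)
      from DERIV_divide[OF DERIV_const[of "- 1"] this nz]
      have "((\<lambda>\<theta>. - 1 / (of_nat (j + 1) * X \<theta> ^ (j + 1))) has_field_derivative
          (of_nat (j + 1) * (of_nat (j + 1) * X \<theta> ^ j * - exp \<theta>)) / ((of_nat (j + 1) * X \<theta> ^ (j + 1)) * (of_nat (j + 1) * X \<theta> ^ (j + 1)))) (at \<theta>)"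
        by simp
      moreover have "(of_nat (j + 1) * (of_nat (j + 1) * X \<theta> ^ j * - exp \<theta>)) / ((of_nat (j + 1) * X \<theta> ^ (j + 1)) * (of_nat (j + 1) * X \<theta> ^ (j + 1)))
          = X \<theta> ^ k / X \<theta> ^ (n + 2) * - exp \<theta>"
      proof -
        have N: "(N * (N * P * e)) / ((N * (Q * P)) * (N * (Q * P))) = R / (R * (P * (Q * Q))) * e"
          if "N \<noteq> 0" "P \<noteq> 0" "Q \<noteq> 0" "R \<noteq> 0" for N P Q R e :: complex
          using that by (simp add: divide_simps)
        have "X \<theta> ^ (j + 1) = X \<theta> * X \<theta> ^ j" "X \<theta> ^ (n + 2) = X \<theta> ^ k * (X \<theta> ^ j * (X \<theta> * X \<theta>))"
          unfolding n2 power_add by (simp_all add: power2_eq_square)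
        then show ?thesis
          using N[of "of_nat (j + 1)" "X \<theta> ^ j" "X \<theta>" "X \<theta> ^ k" "- exp \<theta>"] X0[OF \<theta>] by (simp only:) (simp del: of_nat_Suc of_nat_add)
      qed
      ultimately show "((\<lambda>\<theta>. - 1 / (of_nat (j + 1) * X \<theta> ^ (j + 1))) has_field_derivative X \<theta> ^ k / X \<theta> ^ (n + 2) * - exp \<theta>) (at \<theta> within V - {0})"
        by (simp only: has_field_derivative_at_within)
    qed
    then show ?thesis by simp
  qed
  have simple: "((\<lambda>\<theta>. X \<theta> ^ (n + 1) / X \<theta> ^ (n + 2) * - exp \<theta>) has_contour_integral 2 * pi * \<i>) (circlepath 0 r)"
  proof -
    have h1: "(\<lambda>\<theta>. - exp \<theta>) holomorphic_on V" "X holomorphic_on V"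
      unfolding X_def by (intro holomorphic_intros)+
    have "residue (\<lambda>\<theta>. - exp \<theta> / X \<theta>) 0 = - exp 0 / (- exp 0)"
      by (rule residue_simple_pole_deriv[OF h1 V(1,3,4) Xd]) (simp_all add: X_def)
    then have res: "residue (\<lambda>\<theta>. - exp \<theta> / X \<theta>) 0 = 1" by simp
    have "(\<lambda>\<theta>. - exp \<theta> / X \<theta>) holomorphic_on V - {0}"
      by (intro holomorphic_on_divide holomorphic_on_subset[OF h1(1)] holomorphic_on_subset[OF h1(2)]) (use X0 in auto)
    from base_residue[OF V(1,4) r(1) this r(2)]
    have "((\<lambda>\<theta>. - exp \<theta> / X \<theta>) has_contour_integral 2 * pi * \<i>) (circlepath 0 r)"
      unfolding res mult_1_right .
    then show ?thesis
    proof (rule has_contour_integral_eq)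
      fix \<theta> assume "\<theta> \<in> path_image (circlepath 0 r)"
      then have "X \<theta> \<noteq> 0" by (intro X0 subsetD[OF path])
      then show "- exp \<theta> / X \<theta> = X \<theta> ^ (n + 1) / X \<theta> ^ (n + 2) * - exp \<theta>" by simp
    qed
  qed
  have regular: "((\<lambda>\<theta>. rest (X \<theta>) * - exp \<theta>) has_contour_integral 0) (circlepath 0 r)"
  proof (rule Cauchy_theorem_convex_simple[OF _ V(2)])
    have "(rest \<circ> X) holomorphic_on V"
      by (rule holomorphic_on_compose_gen[OF _ rest_hol]) (use VU in \<open>auto simp: X_def intro!: holomorphic_intros\<close>)
    then show "(\<lambda>\<theta>. rest (X \<theta>) * - exp \<theta>) holomorphic_on V"
      unfolding o_def by (intro holomorphic_intros)
  qed (use path in auto)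
  have tk: "((\<lambda>\<theta>. X \<theta> ^ k / X \<theta> ^ (n + 2) * - exp \<theta>) has_contour_integral (if k = n + 1 then 2 * pi * \<i> else 0)) (circlepath 0 r)"
    if k: "k \<in> {..<n + 2}" for k
  proof (cases "k = n + 1")
    case True
    show ?thesis unfolding if_P[OF True] unfolding True by (rule simple)
  next
    case False
    then have "k < n + 1" using k by simp
    from lower[OF this] show ?thesis unfolding if_not_P[OF False] .
  qed
  have S: "((\<lambda>\<theta>. \<Sum>k<n + 2. g k * (X \<theta> ^ k / X \<theta> ^ (n + 2) * - exp \<theta>)) has_contour_integral
      (\<Sum>k<n + 2. g k * (if k = n + 1 then 2 * pi * \<i> else 0))) (circlepath 0 r)"
    by (rule has_contour_integral_sum[OF finite_lessThan has_contour_integral_lmul[OF tk]])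
  have "(\<Sum>k<n + 2. g k * (if k = n + 1 then 2 * pi * \<i> else 0)) = (\<Sum>k<n + 2. if k = n + 1 then g k * (2 * pi * \<i>) else 0)"
    by (intro sum.cong refl) (simp only: if_distrib[of "(*) _"] mult_zero_right)
  also have "\<dots> = g (n + 1) * (2 * pi * \<i>)"
    by (subst sum.delta) simp_all
  finally have v: "(\<Sum>k<n + 2. g k * (if k = n + 1 then 2 * pi * \<i> else 0)) = g (n + 1) * (2 * pi * \<i>)" .
  have "((\<lambda>\<theta>. of_real (exp a) * ((\<Sum>k<n + 2. g k * (X \<theta> ^ k / X \<theta> ^ (n + 2) * - exp \<theta>)) + rest (X \<theta>) * - exp \<theta>))
      has_contour_integral of_real (exp a) * (g (n + 1) * (2 * pi * \<i>) + 0)) (circlepath 0 r)"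
    by (rule has_contour_integral_lmul[OF has_contour_integral_add[OF S[unfolded v] regular]])
  then have 1: "(strip_form a c n has_contour_integral of_real (exp a) * (g (n + 1) * (2 * pi * \<i>) + 0)) (circlepath 0 r)"
  proof (rule has_contour_integral_eq)
    fix \<theta> assume "\<theta> \<in> path_image (circlepath 0 r)"
    then have "\<theta> \<in> V - {0}" by (rule subsetD[OF path])
    from split[OF this, symmetric] show "of_real (exp a) * ((\<Sum>k<n + 2. g k * (X \<theta> ^ k / X \<theta> ^ (n + 2) * - exp \<theta>)) + rest (X \<theta>) * - exp \<theta>) = strip_form a c n \<theta>" .
  qed
  have "strip_form a c n holomorphic_on V - {0}"
  proof (rule holomorphic_on_subset[OF strip_form_holomorphic], rule subsetI)
    fix \<theta> assume \<theta>: "\<theta> \<in> V - {0}"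
    have "\<bar>Im \<theta>\<bar> < pi" by (rule VU(2)) (use \<theta> in simp)
    then have "\<bar>Im \<theta>\<bar> < 2 * pi" using pi_gt_zero by linarith
    with \<theta> show "\<theta> \<in> {\<theta>. \<bar>Im \<theta>\<bar> < 2 * pi} - {0}" by simp
  qed
  from base_residue[OF V(1,4) r(1) this r(2)]
  have "2 * pi * \<i> * residue (strip_form a c n) 0 = of_real (exp a) * (g (n + 1) * (2 * pi * \<i>) + 0)"
    by (rule has_contour_integral_unique[OF _ 1])
  then have "(2 * pi * \<i>) * residue (strip_form a c n) 0 = (2 * pi * \<i>) * (of_real (exp a) * g (n + 1))"
    by (simp only: add_0_right mult_ac)
  then have "residue (strip_form a c n) 0 = of_real (exp a) * g (n + 1)"
    by (rule mult_left_cancel[THEN iffD1, rotated]) simp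
  then show ?thesis by (simp add: g_def)
qed

text \<open>
On the lines \<open>Im \<theta> = \<pi>\<close> and \<open>Im \<theta> = - \<pi>\<close> the value of \<open>exp \<theta>\<close> is negative, so \<open>s\<close> runs through
\<open>(0, 1)\<close> with \<open>Re \<theta> = ln (s / (1 - s))\<close>; the end points \<open>Re \<theta> = - ln E\<close> and \<open>Re \<theta> = ln E\<close>
correspond to \<open>s = p\<close> and \<open>s = 1 - p\<close>.
\<close>

lemma strip_form_on_line:
  fixes a c \<sigma> E :: real
  assumes E: "E \<ge> 2" and \<sigma>: "\<sigma> = 1 \<or> \<sigma> = -1"
  defines "p \<equiv> 1 / (E + 1)"
  shows "((\<lambda>s. of_real ((s / (1 - s)) powr (a * s + c) * (1 - s) ^ n) * cis (\<sigma> * pi * (a * s + c)))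
           has_integral contour_integral (linepath (Complex (- ln E) (\<sigma> * pi)) (Complex (ln E) (\<sigma> * pi))) (strip_form a c n)) {p..1 - p}"
proof -
  define R where "R = ln E"
  define A B where "A = Complex (- R) (\<sigma> * pi)" and "B = Complex R (\<sigma> * pi)"
  have R: "R > 0" using E by (simp add: R_def)
  have p: "0 < p" "p \<le> 1 - p" "p < 1" using E by (auto simp: p_def field_simps)
  have pE: "p / (1 - p) = 1 / E" "(1 - p) / p = E" using E by (auto simp: p_def field_simps)
  have BA: "B - A = of_real (2 * R)" by (simp add: A_def B_def complex_eq_iff)
  define h where "h = (\<lambda>u. strip_form a c n (linepath A B u) * (B - A))"
  have seg: "\<bar>Im z\<bar> = pi" if z: "z \<in> closed_segment A B" for z
  proof -
    obtain u where "z = (1 - u) *\<^sub>R A + u *\<^sub>R B" using z unfolding closed_segment_def by blast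
    then have "Im z = (1 - u) * (\<sigma> * pi) + u * (\<sigma> * pi)" by (simp add: A_def B_def)
    also have "\<dots> = \<sigma> * pi" by (simp add: left_diff_distrib)
    finally have "Im z = \<sigma> * pi" .
    then show ?thesis using \<sigma> by auto
  qed
  have cont: "continuous_on (closed_segment A B) (strip_form a c n)"
  proof (rule continuous_on_subset[OF holomorphic_on_imp_continuous_on[OF strip_form_holomorphic]])
    show "closed_segment A B \<subseteq> {\<theta>. \<bar>Im \<theta>\<bar> < 2 * pi} - {0}"
    proof
      fix z assume "z \<in> closed_segment A B"
      from seg[OF this] show "z \<in> {\<theta>. \<bar>Im \<theta>\<bar> < 2 * pi} - {0}" using pi_gt_zero by auto
    qed
  qed
  have "strip_form a c n contour_integrable_on linepath A B"
    by (rule contour_integrable_continuous_linepath[OF cont])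
  then have "(strip_form a c n has_contour_integral contour_integral (linepath A B) (strip_form a c n)) (linepath A B)"
    by (rule has_contour_integral_integral)
  then have hI: "(h has_integral contour_integral (linepath A B) (strip_form a c n)) {0..1}"
    unfolding h_def has_contour_integral_linepath .
  have hc: "continuous_on {0..1} h"
    unfolding h_def
    by (intro continuous_on_mult continuous_on_const continuous_on_compose2[OF cont continuous_on_linepath])
       (auto simp: linepath_image_01)
  define g where "g = (\<lambda>s. (ln (s / (1 - s)) + R) / (2 * R))"
  define g' where "g' = (\<lambda>s. 1 / (s * (1 - s)) / (2 * R))"
  have gp: "g p = 0" "g (1 - p) = 1"
  proof -
    have "ln (p / (1 - p)) = - R" unfolding pE(1) R_def using E by (simp add: ln_div)
    then show "g p = 0" by (simp add: g_def)
    have "ln ((1 - p) / (1 - (1 - p))) = R" using pE(2) by (simp add: R_def)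
    then show "g (1 - p) = 1" using R by (simp add: g_def)
  qed
  have "((\<lambda>s. g' s *\<^sub>R h (g s)) has_integral (integral {g p..g (1 - p)} h)) {p..1 - p}"
  proof (rule has_integral_substitution[of p "1 - p" g 0 1 h g'])
    show "p \<le> 1 - p" by fact
    show "g p \<le> g (1 - p)" by (simp add: gp)
    show "g ` {p..1 - p} \<subseteq> {0..1}"
    proof (rule image_subsetI)
      fix s assume s: "s \<in> {p..1 - p}"
      then have s01: "0 < s" "s < 1" using p by auto
      have "p / (1 - p) \<le> s / (1 - s)" using s s01 p by (intro frac_le) auto
      then have "ln (1 / E) \<le> ln (s / (1 - s))" using pE E s01 by simp
      moreover have "s / (1 - s) \<le> (1 - p) / p" using s s01 p by (intro frac_le) auto
      then have "ln (s / (1 - s)) \<le> ln E" using pE E s01 by simp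
      moreover have "ln (1 / E) = - R" using E by (simp add: R_def ln_div)
      ultimately show "g s \<in> {0..1}" using R by (auto simp: g_def R_def)
    qed
    show "continuous_on {0..1} h" by fact
    fix s assume s: "s \<in> {p..1 - p}"
    then have s01: "0 < s" "s < 1" using p by auto
    have "((\<lambda>s. s / (1 - s)) has_real_derivative 1 / ((1 - s) * (1 - s))) (at s)"
      by (rule DERIV_cong[OF DERIV_divide[OF DERIV_ident DERIV_diff[OF DERIV_const DERIV_ident]]]) (use s01 in simp_all)
    then have "((\<lambda>s. ln (s / (1 - s))) has_real_derivative 1 / (s / (1 - s)) * (1 / ((1 - s) * (1 - s)))) (at s)"
      using s01 by (intro DERIV_chain2[OF DERIV_ln_divide]) auto
    moreover have "1 / (x / q) * (1 / (q * q)) = 1 / (x * q)" if "x \<noteq> 0" "q \<noteq> 0" for x q :: real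
      using that by (simp add: field_simps)
    then have "1 / (s / (1 - s)) * (1 / ((1 - s) * (1 - s))) = 1 / (s * (1 - s))"
      using s01 by simp
    ultimately have "((\<lambda>s. ln (s / (1 - s))) has_real_derivative 1 / (s * (1 - s))) (at s)" by simp
    from DERIV_cdivide[OF DERIV_add[OF this DERIV_const[of R]], of "2 * R"]
    have "(g has_real_derivative g' s) (at s)" unfolding g_def g'_def by simp
    then show "(g has_real_derivative g' s) (at s within {p..1 - p})" by (rule has_field_derivative_at_within)
  qed
  then have "((\<lambda>s. g' s *\<^sub>R h (g s)) has_integral contour_integral (linepath A B) (strip_form a c n)) {p..1 - p}"
    unfolding gp using hI by (simp add: integral_unique)
  then have "((\<lambda>s. of_real ((s / (1 - s)) powr (a * s + c) * (1 - s) ^ n) * cis (\<sigma> * pi * (a * s + c)))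
           has_integral contour_integral (linepath A B) (strip_form a c n)) {p..1 - p}"
  proof (rule has_integral_eq[rotated])
    fix s assume s: "s \<in> {p..1 - p}"
    then have s01: "0 < s" "s < 1" using p by auto
    define x where "x = ln (s / (1 - s))"
    define \<theta> where "\<theta> = Complex x (\<sigma> * pi)"
    have lp: "linepath A B (g s) = \<theta>"
    proof -
      have "Re (linepath A B (g s)) = - R + g s * (2 * R)" "Im (linepath A B (g s)) = (1 - g s) * (\<sigma> * pi) + g s * (\<sigma> * pi)"
        by (simp_all add: linepath_def A_def B_def algebra_simps)
      moreover have "g s * (2 * R) = x + R" using R by (simp add: g_def x_def)
      moreover have "(1 - g s) * (\<sigma> * pi) + g s * (\<sigma> * pi) = \<sigma> * pi" by (simp add: left_diff_distrib)
      ultimately show ?thesis by (simp add: \<theta>_def complex_eq_iff)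
    qed
    have "exp \<theta> = of_real (exp x) * cis (\<sigma> * pi)" by (simp add: exp_eq_polar \<theta>_def)
    moreover have "cis (\<sigma> * pi) = -1" using \<sigma> by (auto simp: complex_eq_iff)
    moreover have "exp x = s / (1 - s)" using s01 by (simp add: x_def)
    ultimately have e: "exp \<theta> = - of_real (s / (1 - s))" by simp
    have X: "1 - exp \<theta> = of_real (1 / (1 - s))"
    proof -
      have "1 - exp \<theta> = of_real (1 + s / (1 - s))" unfolding e by simp
      also have "1 + s / (1 - s) = 1 / (1 - s)" using s01 by (simp add: field_simps)
      finally show ?thesis .
    qed
    have co: "of_real a + of_real c - of_real a / complex_of_real (1 / (1 - s)) = of_real (a * s + c)"
      unfolding of_real_add[symmetric] of_real_divide[symmetric] of_real_diff[symmetric]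
      by (simp only: of_real_eq_iff) (simp add: algebra_simps)
    have "of_real (a * s + c) * \<theta> = Complex ((a * s + c) * x) (\<sigma> * pi * (a * s + c))"
      by (simp add: \<theta>_def complex_eq_iff)
    then have "exp (of_real (a * s + c) * \<theta>) = of_real (exp ((a * s + c) * x)) * cis (\<sigma> * pi * (a * s + c))"
      by (simp add: exp_eq_polar)
    moreover have "exp ((a * s + c) * x) = (s / (1 - s)) powr (a * s + c)"
      using s01 by (simp add: powr_def x_def)
    ultimately have ex: "exp (of_real (a * s + c) * \<theta>) = of_real ((s / (1 - s)) powr (a * s + c)) * cis (\<sigma> * pi * (a * s + c))"
      by simp
    define Q where "Q = (s / (1 - s)) powr (a * s + c)"
    define C where "C = cis (\<sigma> * pi * (a * s + c))"
    have "g' s *\<^sub>R h (g s) = of_real (g' s * (2 * R)) * strip_form a c n \<theta>"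
      unfolding h_def lp BA scaleR_conv_of_real of_real_mult by (simp only: mult_ac)
    also have "g' s * (2 * R) = 1 / (s * (1 - s))" using R by (simp add: g'_def)
    also have "strip_form a c n \<theta> = - (of_real Q * C) * - of_real (s / (1 - s)) / of_real (1 / (1 - s)) ^ (n + 2)"
      unfolding strip_form_def X co ex Q_def C_def unfolding e by (rule refl)
    also have "of_real (1 / (s * (1 - s))) * (- (of_real Q * C) * - of_real (s / (1 - s)) / of_real (1 / (1 - s)) ^ (n + 2))
        = of_real (1 / (s * (1 - s)) * (Q * (s / (1 - s)) / (1 / (1 - s)) ^ (n + 2))) * C"
      by (simp add: mult_ac)
    also have "1 / (s * (1 - s)) * (Q * (s / (1 - s)) / (1 / (1 - s)) ^ (n + 2)) = Q * (1 - s) ^ n"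
    proof -
      have L: "1 / (x * q) * (Q * (x / q) / (1 / q) ^ (n + 2)) = Q * q ^ n" if "x \<noteq> 0" "q \<noteq> 0" for x q :: real
        using that by (simp add: power_add power2_eq_square power_one_over field_simps)
      show ?thesis by (rule L) (use s01 in simp_all)
    qed
    finally show "g' s *\<^sub>R h (g s) = of_real ((s / (1 - s)) powr (a * s + c) * (1 - s) ^ n) * cis (\<sigma> * pi * (a * s + c))"
      unfolding Q_def C_def .
  qed
  then show ?thesis by (simp only: A_def B_def R_def)
qed

lemma norm_strip_form:
  "norm (strip_form a c n \<theta>) = exp (Re ((of_real a + of_real c - of_real a / (1 - exp \<theta>)) * \<theta>)) * exp (Re \<theta>) / norm (1 - exp \<theta>) ^ (n + 2)"
  unfolding strip_form_def by (simp add: norm_mult norm_divide norm_power)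

text \<open>
Both vertical sides use this: there \<open>a / X\<close>, respectively \<open>a - a / X\<close>, is of order \<open>1 / E\<close>, which
absorbs the factor \<open>\<theta>\<close> in the exponent.
\<close>

lemma norm_strip_le:
  assumes E: "E \<ge> 2" and R: "\<bar>Re \<theta>\<bar> = ln E" and I: "\<bar>Im \<theta>\<bar> \<le> pi" and a: "a \<ge> 0"
  shows "a * norm \<theta> / (E / 2) \<le> 2 * a * (1 + pi)"
proof -
  have "norm \<theta> \<le> ln E + pi" using cmod_le[of \<theta>] R I by linarith
  also have "\<dots> \<le> E + pi * E"
  proof (rule add_mono)
    show "ln E \<le> E" using ln_bound[of E] E by simp
    show "pi \<le> pi * E" using E by simp
  qed
  finally have "norm \<theta> \<le> (1 + pi) * E" by (simp add: algebra_simps)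
  then have "a * norm \<theta> \<le> a * ((1 + pi) * E)" using a by (rule mult_left_mono)
  then have "a * norm \<theta> / (E / 2) \<le> a * ((1 + pi) * E) / (E / 2)"
    using E by (intro divide_right_mono) auto
  also have "\<dots> = 2 * a * (1 + pi)" using E by simp
  finally show ?thesis .
qed

lemma strip_form_right_bound:
  assumes E: "E \<ge> 2" and R: "Re \<theta> = ln E" and I: "\<bar>Im \<theta>\<bar> \<le> pi" and a: "a \<ge> 0"
  shows "norm (strip_form a c n \<theta>) \<le> exp (2 * a * (1 + pi)) * 2 ^ (n + 2) * E powr (a + c - real (n + 1))"
proof -
  define X where "X = 1 - exp \<theta>"
  have ne: "norm (exp \<theta>) = E" using E R by simp
  have X: "E / 2 \<le> norm X"
    using norm_triangle_ineq2[of "exp \<theta>" 1] E unfolding ne X_def by (simp add: norm_minus_commute)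
  have X0: "X \<noteq> 0" using X E by auto
  have "Re ((of_real a + of_real c - of_real a / X) * \<theta>) = (a + c) * ln E - Re (of_real a / X * \<theta>)"
    using R by (simp add: algebra_simps)
  also have "\<dots> \<le> (a + c) * ln E + norm (of_real a / X * \<theta>)"
    using abs_Re_le_cmod[of "of_real a / X * \<theta>"] by linarith
  also have "norm (of_real a / X * \<theta>) = a * norm \<theta> / norm X" using a by (simp add: norm_mult norm_divide)
  also have "\<dots> \<le> a * norm \<theta> / (E / 2)" using X E a by (intro divide_left_mono mult_pos_pos) auto
  also have "\<dots> \<le> 2 * a * (1 + pi)" by (rule norm_strip_le) (use assms in auto)
  finally have "exp (Re ((of_real a + of_real c - of_real a / X) * \<theta>)) \<le> exp ((a + c) * ln E + 2 * a * (1 + pi))"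
    by simp
  also have "\<dots> = E powr (a + c) * exp (2 * a * (1 + pi))"
    using E by (simp add: exp_add powr_def)
  finally have 1: "exp (Re ((of_real a + of_real c - of_real a / X) * \<theta>)) \<le> E powr (a + c) * exp (2 * a * (1 + pi))" .
  have 2: "(E / 2) ^ (n + 2) \<le> norm X ^ (n + 2)" using X E by (intro power_mono) auto
  have "norm (strip_form a c n \<theta>) = exp (Re ((of_real a + of_real c - of_real a / X) * \<theta>)) * E / norm X ^ (n + 2)"
    unfolding norm_strip_form X_def R using E by simp
  also have "\<dots> \<le> (E powr (a + c) * exp (2 * a * (1 + pi))) * E / (E / 2) ^ (n + 2)"
    using 1 2 E X0 by (intro frac_le mult_right_mono) auto
  also have "\<dots> = exp (2 * a * (1 + pi)) * 2 ^ (n + 2) * (E powr (a + c) * E / E ^ (n + 2))"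
    by (simp add: power_divide mult_ac)
  also have "E powr (a + c) * E / E ^ (n + 2) = E powr (a + c - real (n + 1))"
  proof -
    have "E powr (a + c - real (n + 1)) = E powr (a + c) / E ^ (n + 1)"
      using E by (simp add: powr_diff powr_realpow[symmetric] del: power_Suc)
    also have "\<dots> = E powr (a + c) * E / E ^ (n + 2)" using E by simp
    finally show ?thesis by (rule sym)
  qed
  finally show ?thesis .
qed

lemma strip_form_left_bound:
  assumes E: "E \<ge> 2" and R: "Re \<theta> = - ln E" and I: "\<bar>Im \<theta>\<bar> \<le> pi" and a: "a \<ge> 0" and c: "c \<ge> 0"
  shows "norm (strip_form a c n \<theta>) \<le> exp (2 * a * (1 + pi)) * 2 ^ (n + 2) * (1 / E)"
proof -
  define X where "X = 1 - exp \<theta>"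
  have re: "exp (Re \<theta>) = 1 / E" using E R by (simp add: exp_minus divide_inverse)
  then have ne: "norm (exp \<theta>) = 1 / E" by simp
  have "1 / E \<le> 1 / 2" using E by simp
  then have X: "1 / 2 \<le> norm X"
    using norm_triangle_ineq2[of 1 "exp \<theta>"] unfolding ne X_def by simp
  have X0: "X \<noteq> 0" using X by auto
  have "of_real a + of_real c - of_real a / X = of_real c - of_real a * exp \<theta> / X"
    using X0 by (simp add: X_def field_simps)
  then have "Re ((of_real a + of_real c - of_real a / X) * \<theta>) = Re (of_real c * \<theta> - of_real a * exp \<theta> / X * \<theta>)"
    by (simp only: left_diff_distrib)
  also have "\<dots> = - (c * ln E) - Re (of_real a * exp \<theta> / X * \<theta>)"
    using R by simp
  also have "\<dots> \<le> norm (of_real a * exp \<theta> / X * \<theta>)"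
    using abs_Re_le_cmod[of "of_real a * exp \<theta> / X * \<theta>"] mult_nonneg_nonneg[OF c, of "ln E"] E by simp
  also have "\<dots> = a * (1 / E) / norm X * norm \<theta>" unfolding norm_mult norm_divide ne using a by simp
  also have "\<dots> \<le> a * (1 / E) / (1 / 2) * norm \<theta>" using X E a X0 by (intro mult_right_mono divide_left_mono) auto
  also have "\<dots> = a * norm \<theta> / (E / 2)" by simp
  also have "\<dots> \<le> 2 * a * (1 + pi)" by (rule norm_strip_le) (use assms ln_ge_zero[of E] in auto)
  finally have 1: "exp (Re ((of_real a + of_real c - of_real a / X) * \<theta>)) \<le> exp (2 * a * (1 + pi))" by simp
  have 2: "(1 / 2) ^ (n + 2) \<le> norm X ^ (n + 2)" using X by (intro power_mono) auto
  have "norm (strip_form a c n \<theta>) = exp (Re ((of_real a + of_real c - of_real a / X) * \<theta>)) * (1 / E) / norm X ^ (n + 2)"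
    unfolding norm_strip_form X_def re ..
  also have "\<dots> \<le> exp (2 * a * (1 + pi)) * (1 / E) / (1 / 2) ^ (n + 2)"
    using 1 2 E X0 by (intro frac_le mult_right_mono) auto
  also have "\<dots> = exp (2 * a * (1 + pi)) * 2 ^ (n + 2) * (1 / E)"
    by (simp add: power_one_over)
  finally show ?thesis .
qed

lemma abs_w_moment_le:
  assumes a: "a \<ge> 0" and c: "c \<ge> 0" and s: "0 < s" "s < 1"
  shows "\<bar>w a c s * (1 - s) ^ n\<bar> \<le> (1 - s) powr (real n - (a + c))"
proof -
  have "(s / (1 - s)) powr (a * s + c) = s powr (a * s + c) * (1 - s) powr (- (a * s + c))"
  proof -
    have "(s / (1 - s)) powr (a * s + c) = s powr (a * s + c) / (1 - s) powr (a * s + c)"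
      by (rule powr_divide)
    then show ?thesis by (simp only: powr_minus divide_inverse)
  qed
  also have "\<dots> \<le> 1 * (1 - s) powr (- (a + c))"
  proof (rule mult_mono)
    show "s powr (a * s + c) \<le> 1"
      using powr_mono2[of "a * s + c" s 1] s a c by simp
    show "(1 - s) powr (- (a * s + c)) \<le> (1 - s) powr (- (a + c))"
      using s a by (intro powr_mono') (auto intro: mult_left_le)
  qed auto
  finally have 1: "(s / (1 - s)) powr (a * s + c) \<le> (1 - s) powr (- (a + c))" by simp
  have "\<bar>1 / pi * sin (pi * (a * s + c))\<bar> \<le> 1"
  proof -
    have "\<bar>sin (pi * (a * s + c))\<bar> \<le> pi"
      using pi_ge_two abs_sin_le_one[of "pi * (a * s + c)"] by linarith
    then show ?thesis by (simp add: abs_mult)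
  qed
  then have "\<bar>1 / pi * sin (pi * (a * s + c))\<bar> * ((s / (1 - s)) powr (a * s + c) * (1 - s) ^ n)
      \<le> 1 * ((1 - s) powr (- (a + c)) * (1 - s) ^ n)"
    using 1 s by (intro mult_mono) auto
  also have "\<dots> = (1 - s) powr (real n - (a + c))"
    using s by (simp add: powr_realpow[symmetric] powr_add[symmetric]) (simp add: algebra_simps)
  also have "\<bar>1 / pi * sin (pi * (a * s + c))\<bar> * ((s / (1 - s)) powr (a * s + c) * (1 - s) ^ n) = \<bar>w a c s * (1 - s) ^ n\<bar>"
    using s unfolding w_def by (simp add: abs_mult)
  finally show ?thesis .
qed

lemma w_measurable [measurable]: "w a c \<in> borel_measurable borel"
  unfolding w_def[abs_def] by measurable

lemma w_moment_integrable:
  assumes a: "a \<ge> 0" and c: "c \<ge> 0" and n: "a + c < real n + 1"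
  shows "set_integrable lborel {0<..<1} (\<lambda>s. w a c s * (1 - s) ^ n)"
proof -
  have "set_integrable lborel {0..1} (\<lambda>s. s powr (1 - 1) * (1 - s) powr ((real n - (a + c) + 1) - 1))"
    by (rule integrable_Beta) (use n in auto)
  then have "set_integrable lborel {0<..<1} (\<lambda>s. s powr (1 - 1) * (1 - s) powr ((real n - (a + c) + 1) - 1))"
    by (rule set_integrable_subset) auto
  then show ?thesis
  proof (rule set_integrable_bound)
    show "set_borel_measurable lborel {0<..<1} (\<lambda>s. w a c s * (1 - s) ^ n)"
      unfolding set_borel_measurable_def by measurable
    show "AE s in lborel. s \<in> {0<..<1} \<longrightarrow> norm (w a c s * (1 - s) ^ n) \<le> norm (s powr (1 - 1) * (1 - s) powr ((real n - (a + c) + 1) - 1))"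
    proof (intro AE_I2 impI)
      fix s :: real assume "s \<in> {0<..<1}"
      then show "norm (w a c s * (1 - s) ^ n) \<le> norm (s powr (1 - 1) * (1 - s) powr ((real n - (a + c) + 1) - 1))"
        using abs_w_moment_le[OF a c, of s n] by simp
    qed
  qed
qed

text \<open>
The residue theorem on the rectangle with corners \<open>- ln E - \<pi> * \<i>\<close> and \<open>ln E + \<pi> * \<i>\<close>. The two
horizontal sides are complex conjugate to each other, and their difference is \<open>- 2 * \<pi> * \<i>\<close> times
the truncated moment; the vertical sides are the error.
\<close>

lemma truncated_w_moment:
  assumes a: "a \<ge> 0" and c: "c \<ge> 0" and E: "E \<ge> 2"
  defines "p \<equiv> 1 / (E + 1)"
  shows "\<exists>W. ((\<lambda>s. w a c s * (1 - s) ^ n) has_integral W) {p..1 - p} \<and>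
     \<bar>W - exp a * dcoef a c n\<bar> \<le> exp (2 * a * (1 + pi)) * 2 ^ (n + 2) * E powr (a + c - real (n + 1))
        + exp (2 * a * (1 + pi)) * 2 ^ (n + 2) * (1 / E)"
proof -
  define a1 a2 a3 a4 where "a1 = Complex (- ln E) (- pi)" and "a2 = Complex (ln E) (- pi)"
    and "a3 = Complex (ln E) pi" and "a4 = Complex (- ln E) pi"
  define f where "f = strip_form a c n"
  define S where "S = {\<theta>. \<bar>Im \<theta>\<bar> < 2 * pi}"
  define M1 where "M1 = exp (2 * a * (1 + pi)) * 2 ^ (n + 2) * E powr (a + c - real (n + 1))"
  define M2 where "M2 = exp (2 * a * (1 + pi)) * 2 ^ (n + 2) * (1 / E)"
  have lnE: "ln E > 0" using E by simp
  have Sbox: "cbox a1 a3 \<subseteq> S"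
  proof
    fix z assume "z \<in> cbox a1 a3"
    then have "- pi \<le> Im z" "Im z \<le> pi" by (auto simp: in_cbox_complex_iff a1_def a3_def)
    then have "\<bar>Im z\<bar> < 2 * pi" using pi_gt_zero by linarith
    then show "z \<in> S" by (simp add: S_def)
  qed
  have rp: "rectpath a1 a3 = linepath a1 a2 +++ linepath a2 a3 +++ linepath a3 a4 +++ linepath a4 a1"
    by (simp add: rectpath_def Let_def a1_def a2_def a3_def a4_def)
  have zero_in: "0 \<in> box a1 a3"
    using lnE pi_gt_zero by (simp add: in_box_complex_iff a1_def a3_def)
  have img: "path_image (rectpath a1 a3) = cbox a1 a3 - box a1 a3"
    by (rule path_image_rectpath_cbox_minus_box) (use lnE in \<open>auto simp: a1_def a3_def\<close>)
  have imgS: "path_image (rectpath a1 a3) \<subseteq> S - {0}"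
    unfolding img using Sbox zero_in by blast
  have S_alt: "S = {\<theta>. Im \<theta> < 2 * pi} \<inter> {\<theta>. Im \<theta> > - (2 * pi)}"
    by (auto simp: S_def)
  have Sopen: "open S" unfolding S_alt by (intro open_Int open_halfspace_Im_lt open_halfspace_Im_gt)
  have Sconv: "convex S" unfolding S_alt by (intro convex_Int convex_halfspace_Im_lt convex_halfspace_Im_gt)
  have "contour_integral (rectpath a1 a3) f = 2 * pi * \<i> * (\<Sum>q\<in>{0}. winding_number (rectpath a1 a3) q * residue f q)"
  proof (rule Residue_theorem[OF Sopen convex_connected[OF Sconv]])
    show "f holomorphic_on S - {0}" unfolding f_def S_def by (rule strip_form_holomorphic)
    show "\<forall>z. z \<notin> S \<longrightarrow> winding_number (rectpath a1 a3) z = 0"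
    proof (intro allI impI)
      fix z assume "z \<notin> S"
      then have "z \<notin> cbox a1 a3" using Sbox by blast
      then show "winding_number (rectpath a1 a3) z = 0"
        by (rule winding_number_rectpath_outside[rotated 2]) (use lnE in \<open>auto simp: a1_def a3_def\<close>)
    qed
  qed (use imgS in auto)
  also have "\<dots> = 2 * pi * \<i> * of_real (exp a * gcoef a c (Suc n))"
    using winding_number_rectpath[OF zero_in] by (simp add: f_def residue_of_integrand)
  finally have res: "contour_integral (rectpath a1 a3) f = 2 * pi * \<i> * of_real (exp a * gcoef a c (Suc n))" .
  have fcont: "continuous_on (S - {0}) f"
    unfolding f_def S_def by (rule holomorphic_on_imp_continuous_on[OF strip_form_holomorphic])
  have pieces: "closed_segment a1 a2 \<subseteq> S - {0}" "closed_segment a2 a3 \<subseteq> S - {0}" "closed_segment a3 a4 \<subseteq> S - {0}" "closed_segment a4 a1 \<subseteq> S - {0}"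
    using imgS unfolding rp by (simp_all add: path_image_join)
  note cs = continuous_on_subset[OF fcont]
  note ci = contour_integrable_continuous_linepath[OF cs]
  have sum: "contour_integral (rectpath a1 a3) f = contour_integral (linepath a1 a2) f
      + (contour_integral (linepath a2 a3) f + (contour_integral (linepath a3 a4) f + contour_integral (linepath a4 a1) f))"
    unfolding rp using ci[OF pieces(1)] ci[OF pieces(2)] ci[OF pieces(3)] ci[OF pieces(4)]
    by (simp add: contour_integrable_joinI valid_path_join)
  define Ib It where "Ib = contour_integral (linepath a1 a2) f" and "It = contour_integral (linepath a4 a3) f"
  define Ir Il where "Ir = contour_integral (linepath a2 a3) f" and "Il = contour_integral (linepath a4 a1) f"
  have top: "contour_integral (linepath a3 a4) f = - It"
    unfolding It_def by (rule contour_integral_reverse_linepath[OF cs[OF pieces(3)]])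
  have total: "Ib - It = 2 * pi * \<i> * of_real (exp a * gcoef a c (Suc n)) - Ir - Il"
    using sum res top by (simp add: Ib_def Ir_def Il_def)
  have len: "norm (a3 - a2) = 2 * pi" "norm (a1 - a4) = 2 * pi"
  proof -
    have "a3 - a2 = of_real (2 * pi) * \<i>" "a1 - a4 = - (of_real (2 * pi) * \<i>)"
      by (simp_all add: a1_def a2_def a3_def a4_def complex_eq_iff)
    then show "norm (a3 - a2) = 2 * pi" "norm (a1 - a4) = 2 * pi" by (simp_all add: norm_mult)
  qed
  have Ir: "norm Ir \<le> M1 * (2 * pi)"
    unfolding Ir_def len(1)[symmetric]
  proof (rule has_contour_integral_bound_linepath[OF has_contour_integral_integral[OF ci[OF pieces(2)]]])
    show "0 \<le> M1" by (simp add: M1_def)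
    fix z assume "z \<in> closed_segment a2 a3"
    then have "Re z = ln E" "\<bar>Im z\<bar> \<le> pi"
      using closed_segment_same_Re[of a2 a3] pi_gt_zero by (auto simp: a2_def a3_def closed_segment_eq_real_ivl)
    then show "norm (f z) \<le> M1" unfolding f_def M1_def by (rule strip_form_right_bound[OF E _ _ a])
  qed
  have Il: "norm Il \<le> M2 * (2 * pi)"
    unfolding Il_def len(2)[symmetric]
  proof (rule has_contour_integral_bound_linepath[OF has_contour_integral_integral[OF ci[OF pieces(4)]]])
    show "0 \<le> M2" using E by (simp add: M2_def)
    fix z assume "z \<in> closed_segment a4 a1"
    then have "Re z = - ln E" "\<bar>Im z\<bar> \<le> pi"
      using closed_segment_same_Re[of a4 a1] pi_gt_zero by (auto simp: a1_def a4_def closed_segment_eq_real_ivl)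
    then show "norm (f z) \<le> M2" unfolding f_def M2_def by (rule strip_form_left_bound[OF E _ _ a c])
  qed
  define q where "q = (\<lambda>s. (s / (1 - s)) powr (a * s + c) * (1 - s) ^ n)"
  have b: "((\<lambda>s. of_real (q s) * cis (- 1 * pi * (a * s + c))) has_integral Ib) {p..1 - p}"
    using strip_form_on_line[OF E, of "- 1" a c n] by (simp add: p_def q_def Ib_def f_def a1_def a2_def)
  have t: "((\<lambda>s. of_real (q s) * cis (1 * pi * (a * s + c))) has_integral It) {p..1 - p}"
    using strip_form_on_line[OF E, of 1 a c n] by (simp add: p_def q_def It_def f_def a3_def a4_def)
  have pt: "Re (\<i> / of_real (2 * pi) * (of_real (q s) * cis (- 1 * pi * (a * s + c)) - of_real (q s) * cis (1 * pi * (a * s + c)))) = w a c s * (1 - s) ^ n" for s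
    by (simp add: q_def w_def Re_divide complex_eq_iff) (simp add: field_simps power2_eq_square)
  define W where "W = Re (\<i> / of_real (2 * pi) * (Ib - It))"
  have "((\<lambda>s. Re (\<i> / of_real (2 * pi) * (of_real (q s) * cis (- 1 * pi * (a * s + c)) - of_real (q s) * cis (1 * pi * (a * s + c))))) has_integral W) {p..1 - p}"
    unfolding W_def
    using has_integral_linear[OF has_integral_mult_right[OF has_integral_diff[OF b t]] bounded_linear_Re] by (simp only: o_def)
  then have WI: "((\<lambda>s. w a c s * (1 - s) ^ n) has_integral W) {p..1 - p}" unfolding pt .
  have "\<i> / of_real (2 * pi) * (Ib - It) = - of_real (exp a * gcoef a c (Suc n)) - \<i> / of_real (2 * pi) * (Ir + Il)"
    unfolding total by (simp add: field_simps)
  then have "W - exp a * dcoef a c n = - Re (\<i> / of_real (2 * pi) * (Ir + Il))"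
    unfolding W_def by (simp add: dcoef_def)
  then have "\<bar>W - exp a * dcoef a c n\<bar> \<le> norm (\<i> / of_real (2 * pi) * (Ir + Il))"
    using abs_Re_le_cmod[of "\<i> / of_real (2 * pi) * (Ir + Il)"] by simp
  also have "\<dots> = norm (Ir + Il) / (2 * pi)"
    by (simp add: norm_mult norm_divide)
  also have "\<dots> \<le> (M1 * (2 * pi) + M2 * (2 * pi)) / (2 * pi)"
    using Ir Il norm_triangle_ineq[of Ir Il] pi_gt_zero by (intro divide_right_mono) linarith+
  also have "\<dots> = M1 + M2" using pi_gt_zero by (simp add: field_simps)
  finally show ?thesis using WI unfolding M1_def M2_def by blast
qed

text \<open>
The error of the truncated moment is a sum of a multiple of \<open>E powr (a + c - (n + 1))\<close> and a
multiple of \<open>1 / E\<close>; both vanish as \<open>E\<close> grows, the first one because \<open>a + c < n + 1\<close>.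
\<close>

theorem w_moment_eq_dcoef:
  assumes a: "a \<ge> 0" and c: "c \<ge> 0" and n: "a + c < real n + 1"
  shows "(LINT s:{0<..<1}|lborel. w a c s * (1 - s) ^ n) = exp a * dcoef a c n"
proof -
  define f where "f = (\<lambda>s. w a c s * (1 - s) ^ n)"
  \<comment> \<open>Any sequence tending to infinity would do; the bounds on the vertical sides need \<open>E \<ge> 2\<close>.\<close>
  define E where "E = (\<lambda>k::nat. real k + 2)"
  define p where "p = (\<lambda>k. 1 / (E k + 1))"
  have E2: "E k \<ge> 2" for k by (simp add: E_def)
  have p0: "0 < p k" "p k < 1" for k using E2[of k] by (auto simp: p_def)
  have Elim: "filterlim E at_top sequentially"
    unfolding E_def by (rule filterlim_at_top_mono[OF filterlim_real_sequentially]) simp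
  have plim: "p \<longlonglongrightarrow> 0"
    unfolding p_def
    by (intro tendsto_divide_0[OF tendsto_const] filterlim_at_top_imp_at_infinity filterlim_at_top_mono[OF Elim]) simp
  note fi = w_moment_integrable[OF a c n, folded f_def]
  have sub: "{p k..1 - p k} \<subseteq> {0<..<1}" for k using p0[of k] by auto
  define W where "W = (\<lambda>k. LINT s:{p k..1 - p k}|lborel. f s)"
  define M where "M = (\<lambda>k. exp (2 * a * (1 + pi)) * 2 ^ (n + 2) * E k powr (a + c - real (n + 1))
        + exp (2 * a * (1 + pi)) * 2 ^ (n + 2) * (1 / E k))"
  have WM: "norm (W k - exp a * dcoef a c n) \<le> M k" for k
  proof -
    from truncated_w_moment[OF a c E2[of k], of n] obtain V
      where V: "(f has_integral V) {p k..1 - p k}" "\<bar>V - exp a * dcoef a c n\<bar> \<le> M k"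
      unfolding f_def p_def M_def by blast
    have "set_integrable lborel {p k..1 - p k} f"
      by (rule set_integrable_subset[OF fi _ sub]) simp
    from set_borel_integral_eq_integral(2)[OF this] have "W k = V"
      unfolding W_def using integral_unique[OF V(1)] by simp
    with V(2) show ?thesis by simp
  qed
  have "M \<longlonglongrightarrow> exp (2 * a * (1 + pi)) * 2 ^ (n + 2) * 0 + exp (2 * a * (1 + pi)) * 2 ^ (n + 2) * 0"
    unfolding M_def
  proof (intro tendsto_add tendsto_mult tendsto_const)
    show "(\<lambda>k. E k powr (a + c - real (n + 1))) \<longlonglongrightarrow> 0"
      by (rule tendsto_neg_powr[OF _ Elim]) (use n in simp)
    show "(\<lambda>k. 1 / E k) \<longlonglongrightarrow> 0"
      by (intro tendsto_divide_0[OF tendsto_const] filterlim_at_top_imp_at_infinity Elim)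
  qed
  then have M0: "M \<longlonglongrightarrow> 0" by simp
  have "(\<lambda>k. W k - exp a * dcoef a c n) \<longlonglongrightarrow> 0"
    by (rule Lim_null_comparison[OF always_eventually[OF allI[OF WM]] M0])
  then have lim1: "W \<longlonglongrightarrow> exp a * dcoef a c n"
    by (rule Lim_null[THEN iffD2])
  have lim2: "W \<longlonglongrightarrow> (LINT s:{0<..<1}|lborel. f s)"
    unfolding W_def set_lebesgue_integral_def
  proof (rule integral_dominated_convergence[where w = "\<lambda>s. norm (indicator {0<..<1} s *\<^sub>R f s)"])
    show "(\<lambda>s. indicator {0<..<1} s *\<^sub>R f s) \<in> borel_measurable lborel"
      using fi unfolding set_integrable_def by (rule borel_measurable_integrable)
    show "(\<lambda>s. indicator {p k..1 - p k} s *\<^sub>R f s) \<in> borel_measurable lborel" for k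
      unfolding f_def by measurable
    show "integrable lborel (\<lambda>s. norm (indicator {0<..<1} s *\<^sub>R f s))"
      using fi unfolding set_integrable_def by (rule integrable_norm)
    show "AE s in lborel. (\<lambda>k. indicator {p k..1 - p k} s *\<^sub>R f s) \<longlonglongrightarrow> indicator {0<..<1} s *\<^sub>R f s"
    proof (intro AE_I2)
      fix s :: real
      show "(\<lambda>k. indicator {p k..1 - p k} s *\<^sub>R f s) \<longlonglongrightarrow> indicator {0<..<1} s *\<^sub>R f s"
      proof (cases "s \<in> {0<..<1}")
        case True
        then have "min s (1 - s) > 0" by simp
        then have "eventually (\<lambda>k. p k < min s (1 - s)) sequentially"
          by (rule order_tendstoD(2)[OF plim])
        then have "eventually (\<lambda>k. indicator {p k..1 - p k} s *\<^sub>R f s = indicator {0<..<1} s *\<^sub>R f s) sequentially"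
          by eventually_elim (use True in auto)
        then show ?thesis by (rule tendsto_eventually)
      next
        case False
        then have "s \<notin> {p k..1 - p k}" for k using sub[of k] by blast
        with False show ?thesis by simp
      qed
    qed
    show "AE s in lborel. norm (indicator {p k..1 - p k} s *\<^sub>R f s) \<le> norm (indicator {0<..<1} s *\<^sub>R f s)" for k
    proof (intro AE_I2)
      fix s :: real
      show "norm (indicator {p k..1 - p k} s *\<^sub>R f s) \<le> norm (indicator {0<..<1} s *\<^sub>R f s)"
        using sub[of k] by (cases "s \<in> {p k..1 - p k}") (auto simp: subset_iff)
    qed
  qed
  show ?thesis using LIMSEQ_unique[OF lim2 lim1] unfolding f_def .
qed

text \<open>
Expanding the bracket under the integral, the terms of order \<open>n \<ge> 2\<close> are moments of the weight; the
two remaining coefficients of the series are \<open>q1\<close> and \<open>q1 - q2\<close>. The series may be integrated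
termwise because every \<open>(1 - s) ^ n\<close> with \<open>n \<ge> 2\<close> is dominated by \<open>(1 - s) ^ 2\<close>.
\<close>

theorem D_eq_D_series:
  assumes a: "a \<ge> 0" and c: "c \<ge> 0" and ac: "a + c < 3"
  shows "D a c t = D_series a c t"
proof -
  define f where "f = (\<lambda>k s. (t ^ (k + 2) / fact (k + 2)) * (indicator {0<..<1} s * (w a c s * (1 - s) ^ (k + 2))))"
  have si: "integrable lborel (\<lambda>s. indicator {0<..<1} s * (w a c s * (1 - s) ^ (k + 2)))" for k
    using w_moment_integrable[OF a c, of "k + 2"] ac unfolding set_integrable_def by simp
  have ii: "integrable lborel (f k)" for k
    unfolding f_def by (rule integrable_mult_right[OF si])
  have ie: "integral\<^sup>L lborel (f k) = exp a * (dcoef a c (k + 2) * t ^ (k + 2) / fact (k + 2))" for k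
  proof -
    have "(\<integral>s. indicator {0<..<1} s * (w a c s * (1 - s) ^ (k + 2)) \<partial>lborel) = exp a * dcoef a c (k + 2)"
      using w_moment_eq_dcoef[OF a c, of "k + 2"] ac unfolding set_lebesgue_integral_def by simp
    then show ?thesis unfolding f_def by (simp del: power_Suc)
  qed
  define g where "g = (\<lambda>s. indicator {0<..<1} s * (w a c s * (exp ((1 - s) * t) - 1 - (1 - s) * t)))"
  have fs: "(\<lambda>k. f k s) sums g s" for s
  proof -
    have "(\<lambda>k. ((1 - s) * t) ^ k / fact k) sums exp ((1 - s) * t)"
      using exp_converges[of "(1 - s) * t"] by (simp add: divide_inverse mult.commute)
    then have "(\<lambda>k. ((1 - s) * t) ^ (k + 2) / fact (k + 2)) sums (exp ((1 - s) * t) - (\<Sum>k<2. ((1 - s) * t) ^ k / fact k))"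
      by (rule sums_split_initial_segment)
    also have "exp ((1 - s) * t) - (\<Sum>k<2. ((1 - s) * t) ^ k / fact k) = exp ((1 - s) * t) - 1 - (1 - s) * t"
      by (simp add: numeral_2_eq_2)
    finally have "(\<lambda>k. (indicator {0<..<1} s * w a c s) * (((1 - s) * t) ^ (k + 2) / fact (k + 2))) sums
        ((indicator {0<..<1} s * w a c s) * (exp ((1 - s) * t) - 1 - (1 - s) * t))"
      by (rule sums_mult)
    moreover have "(indicator {0<..<1} s * w a c s) * (((1 - s) * t) ^ (k + 2) / fact (k + 2)) = f k s" for k
      unfolding f_def power_mult_distrib by (simp only: times_divide_eq_left times_divide_eq_right mult_ac)
    ultimately show ?thesis by (simp only: g_def mult.assoc)
  qed
  define N where "N = (\<integral>s. norm (indicator {0<..<1} s * (w a c s * (1 - s) ^ (0 + 2))) \<partial>lborel)"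
  have nf: "norm (f k s) \<le> \<bar>t\<bar> ^ (k + 2) / fact (k + 2) * norm (indicator {0<..<1} s * (w a c s * (1 - s) ^ (0 + 2)))" for k s
  proof (cases "s \<in> {0<..<1}")
    case True
    have "\<bar>(1 - s) ^ (k + 2)\<bar> \<le> \<bar>(1 - s) ^ (0 + 2)\<bar>"
      using True by (simp only: power_abs) (intro power_decreasing, auto)
    then have "\<bar>w a c s\<bar> * \<bar>(1 - s) ^ (k + 2)\<bar> \<le> \<bar>w a c s\<bar> * \<bar>(1 - s) ^ (0 + 2)\<bar>"
      by (rule mult_left_mono) simp
    then have "\<bar>t\<bar> ^ (k + 2) / fact (k + 2) * (\<bar>w a c s\<bar> * \<bar>(1 - s) ^ (k + 2)\<bar>) \<le> \<bar>t\<bar> ^ (k + 2) / fact (k + 2) * (\<bar>w a c s\<bar> * \<bar>(1 - s) ^ (0 + 2)\<bar>)"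
      by (rule mult_left_mono) simp
    then show ?thesis using True unfolding f_def real_norm_def abs_mult abs_divide power_abs by simp
  qed (simp add: f_def)
  have e: "summable (\<lambda>k. \<bar>t\<bar> ^ (k + 2) / fact (k + 2))"
  proof -
    have "summable (\<lambda>k. \<bar>t\<bar> ^ k / fact k)"
      using summable_exp[of "\<bar>t\<bar>"] by (simp add: divide_inverse mult.commute)
    then show ?thesis by (rule summable_ignore_initial_segment)
  qed
  have fsum: "summable (\<lambda>k. norm (f k s))" for s
  proof (rule summable_comparison_test'[where N = 0])
    show "summable (\<lambda>k. \<bar>t\<bar> ^ (k + 2) / fact (k + 2) * norm (indicator {0<..<1} s * (w a c s * (1 - s) ^ (0 + 2))))"
      by (rule summable_mult2[OF e])
    show "norm (norm (f k s)) \<le> \<bar>t\<bar> ^ (k + 2) / fact (k + 2) * norm (indicator {0<..<1} s * (w a c s * (1 - s) ^ (0 + 2)))" for k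
      using nf[of k s] by (simp only: real_norm_def abs_idempotent)
  qed
  have ae: "AE s in lborel. summable (\<lambda>k. norm (f k s))"
    by (rule AE_I2) (rule fsum)
  have su: "summable (\<lambda>k. \<integral>s. norm (f k s) \<partial>lborel)"
  proof (rule summable_comparison_test'[where N = 0])
    show "summable (\<lambda>k. \<bar>t\<bar> ^ (k + 2) / fact (k + 2) * N)" by (rule summable_mult2[OF e])
    show "norm (\<integral>s. norm (f k s) \<partial>lborel) \<le> \<bar>t\<bar> ^ (k + 2) / fact (k + 2) * N" for k
    proof -
      have "(\<integral>s. norm (f k s) \<partial>lborel) \<le> (\<integral>s. \<bar>t\<bar> ^ (k + 2) / fact (k + 2) * norm (indicator {0<..<1} s * (w a c s * (1 - s) ^ (0 + 2))) \<partial>lborel)"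
        by (rule Bochner_Integration.integral_mono[OF integrable_norm[OF ii] integrable_mult_right[OF integrable_norm[OF si]] nf])
      moreover have "(\<integral>s. norm (f k s) \<partial>lborel) \<ge> 0" by (rule Bochner_Integration.integral_nonneg) simp
      ultimately show ?thesis unfolding N_def by (simp only: real_norm_def abs_of_nonneg integral_mult_right_zero)
    qed
  qed
  have "(\<lambda>k. integral\<^sup>L lborel (f k)) sums (\<integral>s. (\<Sum>k. f k s) \<partial>lborel)" by (rule sums_integral[OF ii ae su])
  moreover have "(\<Sum>k. f k s) = g s" for s using sums_unique[OF fs[of s]] by (rule sym)
  ultimately have 1: "(\<lambda>k. exp a * (dcoef a c (k + 2) * t ^ (k + 2) / fact (k + 2))) sums (integral\<^sup>L lborel g)"
    by (simp only: ie)
  obtain C where C: "\<And>n. \<bar>dcoef a c n\<bar> \<le> C * 2 ^ n" using dcoef_bounded[of a c] by blast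
  have "(\<lambda>k. dcoef a c (k + 2) * t ^ (k + 2) / fact (k + 2)) sums (D_series a c t - (\<Sum>k<2. dcoef a c k * t ^ k / fact k))"
    unfolding D_series_def by (rule sums_split_initial_segment[OF egf_sums[OF C]])
  then have "(\<lambda>k. exp a * (dcoef a c (k + 2) * t ^ (k + 2) / fact (k + 2))) sums (exp a * (D_series a c t - (\<Sum>k<2. dcoef a c k * t ^ k / fact k)))"
    by (rule sums_mult)
  from sums_unique2[OF 1 this] have "integral\<^sup>L lborel g = exp a * (D_series a c t - (\<Sum>k<2. dcoef a c k * t ^ k / fact k))" .
  then have "exp (- a) * integral\<^sup>L lborel g = (exp (- a) * exp a) * (D_series a c t - (\<Sum>k<2. dcoef a c k * t ^ k / fact k))"
    by (simp only: mult.assoc)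
  also have "exp (- a) * exp a = 1" by (simp add: exp_minus_inverse mult.commute)
  finally have "exp (- a) * integral\<^sup>L lborel g = D_series a c t - (dcoef a c 0 + dcoef a c 1 * t)"
    by (simp add: numeral_2_eq_2)
  moreover have "dcoef a c 0 = q1 a c" "dcoef a c 1 = q1 a c - q2 a c"
  proof -
    show d0: "dcoef a c 0 = q1 a c"
      using gcoef_rec[of 0 a c] by (simp add: dcoef_def q1_def kern_def)
    have k: "kern a c 1 = a / 2 + c" "kern a c 2 = a / 3 + c" by (simp_all add: kern_def)
    have "2 * gcoef a c (Suc 1) = - (kern a c 1 * gcoef a c 1 + kern a c 2)"
      using gcoef_rec[of 1 a c] by (simp add: numeral_2_eq_2)
    moreover have "gcoef a c 1 = - (a / 2 + c)" using d0 by (simp add: dcoef_def q1_def)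
    moreover have "y = (K * K - L) / 2" if "2 * y = - (K * x + L)" "x = - K" for x y K L :: real
      using that by simp
    ultimately have "gcoef a c (Suc 1) = ((a / 2 + c) * (a / 2 + c) - (a / 3 + c)) / 2"
      unfolding k by blast
    then have "dcoef a c 1 = - (((a / 2 + c) * (a / 2 + c) - (a / 3 + c)) / 2)" by (simp only: dcoef_def)
    also have "\<dots> = q1 a c - q2 a c"
      unfolding q1_def q2_def power2_eq_square by (simp add: diff_divide_distrib)
    finally show "dcoef a c 1 = q1 a c - q2 a c" .
  qed
  moreover have "D a c t = q1 a c + (q1 a c - q2 a c) * t + exp (- a) * integral\<^sup>L lborel g"
    unfolding D_def set_lebesgue_integral_def g_def by simp
  ultimately show ?thesis by simp
qed

section \<open>Two parameter pairs without the Bernstein property\<close>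

lemma pochhammer_2_over_fact: "pochhammer 2 n / fact n = real n + 1"
proof -
  have "pochhammer 2 n = (fact (Suc n) :: real)"
  proof (induction n)
    case (Suc n)
    then show ?case by (simp add: pochhammer_Suc algebra_simps)
  qed simp
  then show ?thesis by (simp add: add.commute)
qed

lemma abs_dcoef_le_linear:
  assumes "0 \<le> a" "0 \<le> c" "a / 2 + c \<le> 2"
  shows "\<bar>dcoef a c n\<bar> \<le> real n + 2"
proof -
  have "\<bar>kern a c (Suc k)\<bar> \<le> 2" for k
    using abs_kern_le[OF assms(1,2), of k] assms(3) by linarith
  from abs_gcoef_le[OF this, of "Suc n"] show ?thesis
    unfolding dcoef_def pochhammer_2_over_fact by simp
qed

text \<open>
The majorants \<open>(n + 2) * t ^ n / n!\<close> at least halve from one index to the next once \<open>n \<ge> 2 * t\<close>, so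
the tail is at most twice its first majorant.
\<close>

lemma D_series_le_partial_sum:
  assumes d: "\<And>n. \<bar>dcoef a c n\<bar> \<le> real n + 2" and t: "t \<ge> 0" and N: "2 * t \<le> real N"
  shows "D_series a c t \<le> (\<Sum>n<N. dcoef a c n * t ^ n / fact n) + 2 * ((real N + 2) * t ^ N / fact N)"
proof -
  obtain C where C: "\<And>n. \<bar>dcoef a c n\<bar> \<le> C * 2 ^ n" using dcoef_bounded[of a c] by blast
  define T where "T = (\<lambda>k. (real (k + N) + 2) * t ^ (k + N) / fact (k + N))"
  have step: "T (Suc k) \<le> T k / 2" for k
  proof -
    define M where "M = real (k + N)"
    have M: "M \<ge> 2 * t" "M \<ge> 0" using N by (auto simp: M_def)
    have "2 * t * (M + 3) \<le> M * (M + 3)" using M by (intro mult_right_mono) auto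
    also have "\<dots> \<le> (M + 1) * (M + 2)" using M by (simp add: algebra_simps)
    finally have le: "2 * t * (M + 3) \<le> (M + 1) * (M + 2)" .
    have "T (Suc k) = (t * (M + 3) / (M + 1)) * (t ^ (k + N) / fact (k + N))"
      by (simp add: T_def M_def add_ac)
    also have "t * (M + 3) / (M + 1) \<le> (M + 2) / 2"
      using le M by (simp add: field_simps)
    then have "(t * (M + 3) / (M + 1)) * (t ^ (k + N) / fact (k + N)) \<le> (M + 2) / 2 * (t ^ (k + N) / fact (k + N))"
      using t by (intro mult_right_mono) auto
    also have "(M + 2) / 2 * (t ^ (k + N) / fact (k + N)) = T k / 2"
      by (simp add: T_def M_def)
    finally show ?thesis .
  qed
  have Tle: "T k \<le> T 0 * (1 / 2) ^ k" for k
  proof (induction k)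
    case (Suc k)
    then show ?case using step[of k] by simp
  qed simp
  have geo: "(\<lambda>k. T 0 * (1 / 2) ^ k) sums (T 0 * 2)"
    using sums_mult[OF geometric_sums[of "1 / 2 :: real"], of "T 0"] by simp
  have tail: "(\<lambda>k. dcoef a c (k + N) * t ^ (k + N) / fact (k + N)) sums (D_series a c t - (\<Sum>n<N. dcoef a c n * t ^ n / fact n))"
    unfolding D_series_def by (rule sums_split_initial_segment[OF egf_sums[OF C]])
  have "D_series a c t - (\<Sum>n<N. dcoef a c n * t ^ n / fact n) \<le> T 0 * 2"
  proof (rule sums_le[OF _ tail geo])
    fix k
    have "dcoef a c (k + N) * t ^ (k + N) / fact (k + N) \<le> T k"
      unfolding T_def using d[of "k + N"] t by (intro divide_right_mono mult_right_mono) auto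
    with Tle[of k] show "dcoef a c (k + N) * t ^ (k + N) / fact (k + N) \<le> T 0 * (1 / 2) ^ k" by linarith
  qed
  moreover have "T 0 * 2 = 2 * ((real N + 2) * t ^ N / fact N)" by (simp add: T_def)
  ultimately show ?thesis by linarith
qed

text \<open>
The first fourteen terms give about \<open>- 0.489\<close> and the tail is below \<open>0.099\<close>.
\<close>

lemma D_series_neg_two_half: "D_series 2 (1 / 2) 4 < 0"
proof -
  have g1: "gcoef 2 (1 / 2) (Suc 0) = - (3 / 2)"
    using gcoef_rec[of 0 "2" "(1 / 2)"] by (simp add: kern_def atMost_nat_numeral atMost_Suc)
  have g2: "gcoef 2 (1 / 2) 2 = 13 / 24"
    using gcoef_rec[of 1 "2" "(1 / 2)"] by (simp add: kern_def atMost_nat_numeral atMost_Suc g1 numeral_2_eq_2)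
  have g3: "gcoef 2 (1 / 2) 3 = - (1 / 48)"
    using gcoef_rec[of 2 "2" "(1 / 2)"] by (simp add: kern_def atMost_nat_numeral atMost_Suc g1 g2)
  have g4: "gcoef 2 (1 / 2) 4 = - (1 / 5760)"
    using gcoef_rec[of 3 "2" "(1 / 2)"] by (simp add: kern_def atMost_nat_numeral atMost_Suc g1 g2 g3)
  have g5: "gcoef 2 (1 / 2) 5 = - (1 / 11520)"
    using gcoef_rec[of 4 "2" "(1 / 2)"] by (simp add: kern_def atMost_nat_numeral atMost_Suc g1 g2 g3 g4)
  have g6: "gcoef 2 (1 / 2) 6 = - (991 / 2903040)"
    using gcoef_rec[of 5 "2" "(1 / 2)"] by (simp add: kern_def atMost_nat_numeral atMost_Suc g1 g2 g3 g4 g5)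
  have g7: "gcoef 2 (1 / 2) 7 = - (907 / 1935360)"
    using gcoef_rec[of 6 "2" "(1 / 2)"] by (simp add: kern_def atMost_nat_numeral atMost_Suc g1 g2 g3 g4 g5 g6)
  have g8: "gcoef 2 (1 / 2) 8 = - (716249 / 1393459200)"
    using gcoef_rec[of 7 "2" "(1 / 2)"] by (simp add: kern_def atMost_nat_numeral atMost_Suc g1 g2 g3 g4 g5 g6 g7)
  have g9: "gcoef 2 (1 / 2) 9 = - (41279 / 79626240)"
    using gcoef_rec[of 8 "2" "(1 / 2)"] by (simp add: kern_def atMost_nat_numeral atMost_Suc g1 g2 g3 g4 g5 g6 g7 g8)
  have g10: "gcoef 2 (1 / 2) 10 = - (37044631 / 73574645760)"
    using gcoef_rec[of 9 "2" "(1 / 2)"] by (simp add: kern_def atMost_nat_numeral atMost_Suc g1 g2 g3 g4 g5 g6 g7 g8 g9)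
  have g11: "gcoef 2 (1 / 2) 11 = - (10092211 / 21021327360)"
    using gcoef_rec[of 10 "2" "(1 / 2)"] by (simp add: kern_def atMost_nat_numeral atMost_Suc g1 g2 g3 g4 g5 g6 g7 g8 g9 g10)
  have g12: "gcoef 2 (1 / 2) 12 = - (10933117589971 / 24103053950976000)"
    using gcoef_rec[of 11 "2" "(1 / 2)"] by (simp add: kern_def atMost_nat_numeral atMost_Suc g1 g2 g3 g4 g5 g6 g7 g8 g9 g10 g11)
  have g13: "gcoef 2 (1 / 2) 13 = - (2285503676851 / 5356234211328000)"
    using gcoef_rec[of 12 "2" "(1 / 2)"] by (simp add: kern_def atMost_nat_numeral atMost_Suc g1 g2 g3 g4 g5 g6 g7 g8 g9 g10 g11 g12)
  have g14: "gcoef 2 (1 / 2) 14 = - (46359457158929 / 115694658964684800)"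
    using gcoef_rec[of 13 "2" "(1 / 2)"] by (simp add: kern_def atMost_nat_numeral atMost_Suc g1 g2 g3 g4 g5 g6 g7 g8 g9 g10 g11 g12 g13)
  have "\<bar>dcoef 2 (1 / 2) n\<bar> \<le> real n + 2" for n
    by (rule abs_dcoef_le_linear) simp_all
  from D_series_le_partial_sum[OF this, of 4 14]
  have "D_series 2 (1 / 2) 4 \<le> (\<Sum>n<14. dcoef 2 (1 / 2) n * 4 ^ n / fact n) + 2 * ((real 14 + 2) * 4 ^ 14 / fact 14)"
    by simp
  also have "(\<Sum>n<14. dcoef 2 (1 / 2) n * 4 ^ n / fact n) = - (1311208777427834287 / 2683822243742640000)"
    by (simp add: dcoef_def fact_numeral lessThan_nat_numeral lessThan_Suc g1 g2 g2[unfolded numeral_2_eq_2] g3 g4 g5 g6 g7 g8 g9 g10 g11 g12 g13 g14)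
  also have "- (1311208777427834287 / 2683822243742640000) + 2 * ((real 14 + 2) * 4 ^ 14 / fact 14) < 0"
    by (simp add: fact_numeral)
  finally show ?thesis .
qed

text \<open>
The first seventeen terms give about \<open>- 0.255\<close> and the tail is below \<open>0.082\<close>.
\<close>

lemma D_series_neg_five_halves_zero: "D_series (5 / 2) 0 5 < 0"
proof -
  have g1: "gcoef (5 / 2) 0 (Suc 0) = - (5 / 4)"
    using gcoef_rec[of 0 "(5 / 2)" "0"] by (simp add: kern_def atMost_nat_numeral atMost_Suc)
  have g2: "gcoef (5 / 2) 0 2 = 35 / 96"
    using gcoef_rec[of 1 "(5 / 2)" "0"] by (simp add: kern_def atMost_nat_numeral atMost_Suc g1 numeral_2_eq_2)
  have g3: "gcoef (5 / 2) 0 3 = - (5 / 384)"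
    using gcoef_rec[of 2 "(5 / 2)" "0"] by (simp add: kern_def atMost_nat_numeral atMost_Suc g1 g2)
  have g4: "gcoef (5 / 2) 0 4 = - (29 / 18432)"
    using gcoef_rec[of 3 "(5 / 2)" "0"] by (simp add: kern_def atMost_nat_numeral atMost_Suc g1 g2 g3)
  have g5: "gcoef (5 / 2) 0 5 = - (11 / 8192)"
    using gcoef_rec[of 4 "(5 / 2)" "0"] by (simp add: kern_def atMost_nat_numeral atMost_Suc g1 g2 g3 g4)
  have g6: "gcoef (5 / 2) 0 6 = - (46285 / 37158912)"
    using gcoef_rec[of 5 "(5 / 2)" "0"] by (simp add: kern_def atMost_nat_numeral atMost_Suc g1 g2 g3 g4 g5)
  have g7: "gcoef (5 / 2) 0 7 = - (23695 / 21233664)"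
    using gcoef_rec[of 6 "(5 / 2)" "0"] by (simp add: kern_def atMost_nat_numeral atMost_Suc g1 g2 g3 g4 g5 g6)
  have g8: "gcoef (5 / 2) 0 8 = - (14049569 / 14269022208)"
    using gcoef_rec[of 7 "(5 / 2)" "0"] by (simp add: kern_def atMost_nat_numeral atMost_Suc g1 g2 g3 g4 g5 g6 g7)
  have g9: "gcoef (5 / 2) 0 9 = - (49425475 / 57076088832)"
    using gcoef_rec[of 8 "(5 / 2)" "0"] by (simp add: kern_def atMost_nat_numeral atMost_Suc g1 g2 g3 g4 g5 g6 g7 g8)
  have g10: "gcoef (5 / 2) 0 10 = - (1642906963 / 2152583921664)"
    using gcoef_rec[of 9 "(5 / 2)" "0"] by (simp add: kern_def atMost_nat_numeral atMost_Suc g1 g2 g3 g4 g5 g6 g7 g8 g9)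
  have g11: "gcoef (5 / 2) 0 11 = - (4524759565 / 6696927756288)"
    using gcoef_rec[of 10 "(5 / 2)" "0"] by (simp add: kern_def atMost_nat_numeral atMost_Suc g1 g2 g3 g4 g5 g6 g7 g8 g9 g10)
  have g12: "gcoef (5 / 2) 0 12 = - (474877349068319 / 789808871865581568)"
    using gcoef_rec[of 11 "(5 / 2)" "0"] by (simp add: kern_def atMost_nat_numeral atMost_Suc g1 g2 g3 g4 g5 g6 g7 g8 g9 g10 g11)
  have g13: "gcoef (5 / 2) 0 13 = - (1699525488183353 / 3159235487462326272)"
    using gcoef_rec[of 12 "(5 / 2)" "0"] by (simp add: kern_def atMost_nat_numeral atMost_Suc g1 g2 g3 g4 g5 g6 g7 g8 g9 g10 g11 g12)
  have g14: "gcoef (5 / 2) 0 14 = - (36687079879522951 / 75821651699095830528)"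
    using gcoef_rec[of 13 "(5 / 2)" "0"] by (simp add: kern_def atMost_nat_numeral atMost_Suc g1 g2 g3 g4 g5 g6 g7 g8 g9 g10 g11 g12 g13)
  have g15: "gcoef (5 / 2) 0 15 = - (132653303886801587 / 303286606796383322112)"
    using gcoef_rec[of 14 "(5 / 2)" "0"] by (simp add: kern_def atMost_nat_numeral atMost_Suc g1 g2 g3 g4 g5 g6 g7 g8 g9 g10 g11 g12 g13 g14)
  have g16: "gcoef (5 / 2) 0 16 = - (30248309681096372791 / 76148268044876551028736)"
    using gcoef_rec[of 15 "(5 / 2)" "0"] by (simp add: kern_def atMost_nat_numeral atMost_Suc g1 g2 g3 g4 g5 g6 g7 g8 g9 g10 g11 g12 g13 g14 g15)
  have g17: "gcoef (5 / 2) 0 17 = - (1968071778262850209 / 5431700875629054394368)"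
    using gcoef_rec[of 16 "(5 / 2)" "0"] by (simp add: kern_def atMost_nat_numeral atMost_Suc g1 g2 g3 g4 g5 g6 g7 g8 g9 g10 g11 g12 g13 g14 g15 g16)
  have "\<bar>dcoef (5 / 2) 0 n\<bar> \<le> real n + 2" for n
    by (rule abs_dcoef_le_linear) simp_all
  from D_series_le_partial_sum[OF this, of 5 17]
  have "D_series (5 / 2) 0 5 \<le> (\<Sum>n<17. dcoef (5 / 2) 0 n * 5 ^ n / fact n) + 2 * ((real 17 + 2) * 5 ^ 17 / fact 17)"
    by simp
  also have "(\<Sum>n<17. dcoef (5 / 2) 0 n * 5 ^ n / fact n) = - (169030428039370560683957938370984915 / 662785432457431558942099088540172288)"
    by (simp add: dcoef_def fact_numeral lessThan_nat_numeral lessThan_Suc g1 g2 g2[unfolded numeral_2_eq_2] g3 g4 g5 g6 g7 g8 g9 g10 g11 g12 g13 g14 g15 g16 g17)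
  also have "- (169030428039370560683957938370984915 / 662785432457431558942099088540172288) + 2 * ((real 17 + 2) * 5 ^ 17 / fact 17) < 0"
    by (simp add: fact_numeral)
  finally show ?thesis .
qed

section \<open>Descent of the Bernstein property\<close>

text \<open>
A pair with \<open>a + c \<ge> 3\<close> and \<open>c < 1\<close> dominates \<open>(2, 1 / 2)\<close> if \<open>c \<ge> 1 / 2\<close> and \<open>(5 / 2, 0)\<close>
otherwise, strictly in the first parameter. Monotonicity would make \<open>D_series\<close> positive there.
\<close>

lemma bernstein_H_imp_sum_less_3:
  assumes a: "a > 0" and c: "0 \<le> c" "c < 1" and B: "bernstein_function (H a c)"
  shows "a + c < 3"
proof (rule ccontr)
  assume "\<not> a + c < 3"
  then have ac: "a + c \<ge> 3" by simp
  have nonneg: "D_series a c t \<ge> 0" if "t \<ge> 0" for t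
    using B that bernstein_H_iff[of a c] a c by simp
  show False
  proof (cases "c \<ge> 1 / 2")
    case True
    have "D_series 2 (1 / 2) 4 > 0"
      by (rule D_series_pos_if_smaller_parameters[of 2 a "1 / 2" c, OF _ _ _ _ _ nonneg]) (use ac c True in auto)
    with D_series_neg_two_half show False by simp
  next
    case False
    have "D_series (5 / 2) 0 5 > 0"
      by (rule D_series_pos_if_smaller_parameters[of "5 / 2" a 0 c, OF _ _ _ _ _ nonneg]) (use ac c False in auto)
    with D_series_neg_five_halves_zero show False by simp
  qed
qed

theorem proposition16:
  fixes a c :: real
  assumes "a > 0" and "0 \<le> c" and "c < 1"
    and "bernstein_function (H a c)"
  shows "\<forall>a' c'. 0 < a' \<and> a' \<le> a \<and> 0 \<le> c' \<and> c' \<le> c \<longrightarrow>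
           bernstein_function (H a' c') \<and>
           (a' < a \<or> c' < c \<longrightarrow> (\<forall>t\<ge>0. m a' c' t > 0))"
proof (intro allI impI)
  fix a' c' :: real
  assume "0 < a' \<and> a' \<le> a \<and> 0 \<le> c' \<and> c' \<le> c"
  then have le: "0 < a'" "a' \<le> a" "0 \<le> c'" "c' \<le> c" by auto
  have nonneg: "D_series a c t \<ge> 0" if "t \<ge> 0" for t
    using assms that bernstein_H_iff[of a c] by simp
  have pos: "D_series a' c' t > 0" if "a' < a \<or> c' < c" "t \<ge> 0" for t
    by (rule D_series_pos_if_smaller_parameters[OF le that(1) nonneg that(2)])
  have "bernstein_function (H a' c')"
  proof (cases "a' < a \<or> c' < c")
    case True
    then show ?thesis using pos le by (simp add: bernstein_H_iff less_imp_le)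
  next
    case False
    then have "a' = a" "c' = c" using le by auto
    then show ?thesis using assms(4) by simp
  qed
  moreover have "m a' c' t > 0" if "a' < a \<or> c' < c" "t \<ge> 0" for t
  proof -
    have "a' + c' < 3"
      using bernstein_H_imp_sum_less_3[OF assms] le by linarith
    then have "D a' c' t = D_series a' c' t"
      using le by (intro D_eq_D_series) auto
    then show ?thesis using pos[OF that] by (simp add: m_def)
  qed
  ultimately show "bernstein_function (H a' c') \<and> (a' < a \<or> c' < c \<longrightarrow> (\<forall>t\<ge>0. m a' c' t > 0))"
    by blast
qed

end
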